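(* Let $1<p<3$. There exists a constant $c>0$ such that for all $P\in\mathrm C_c^\infty(\mathbb{R}^3;\mathbb{R}^{3\times3})$ $$\|P\|_{\dot{\mathrm W}^{1,\frac{3p}{3-p}}(\mathbb{R}^3)}\le c\,\Big(\|\operatorname{dev}P\|_{\dot{\mathrm W}^{1,\frac{3p}{3-p}}(\mathbb{R}^3)}+\|\operatorname{tr}\operatorname{inc}P\|_{\mathrm L^p(\mathbb{R}^3)}\Big).$$
   Context: For $X\in\mathbb{R}^{3\times3}$: $\operatorname{dev}X=X-\frac{\operatorname{tr}X}{3}\mathbf 1_3$ with $\mathbf 1_3$ the unit matrix. $\operatorname{Curl}P$ is the row-wise classical curl of a matrix field $P$, and Kröner's incompatibility tensor is $\operatorname{inc}P=\operatorname{Curl}\big([\operatorname{Curl}P]^\top\big)$. $\|u\|_{\dot{\mathrm W}^{1,q}(\mathbb{R}^3)}=\|\mathrm Du\|_{\mathrm L^q(\mathbb{R}^3)}$. *)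

theory Defs
  imports "HOL-Analysis.Analysis"
begin

definition partial_deriv :: "'n::finite \<Rightarrow> (real^'n \<Rightarrow> 'b::real_normed_vector) \<Rightarrow> real^'n \<Rightarrow> 'b"
  where "partial_deriv k f x = frechet_derivative f (at x) (axis k 1)"

primrec times_diffble :: "nat \<Rightarrow> (real^'n::finite \<Rightarrow> 'b::real_normed_vector) \<Rightarrow> bool"
  where
    "times_diffble 0 f = True"
  | "times_diffble (Suc m) f \<longleftrightarrow>
       (\<forall>x. f differentiable (at x)) \<and> (\<forall>k. times_diffble m (partial_deriv k f))"

definition Cc_infinity :: "(real^'n::finite \<Rightarrow> 'b::real_normed_vector) set"
  where "Cc_infinity = {f. (\<forall>m. times_diffble m f) \<and> compact (closure {x. f x \<noteq> 0})}"

text \<open>The Bochner integral is 0 when the integrand is not integrable, so the next definition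
  is the \<open>L\<^sup>q\<close>-norm only for functions in \<open>L\<^sup>q\<close>. It is only applied to continuous functions
  with compact support and to \<open>1 < q < \<infinity>\<close>.\<close>

definition Lnorm :: "real \<Rightarrow> (real^'n::finite \<Rightarrow> 'b::real_normed_vector) \<Rightarrow> real"
  where "Lnorm q f = (\<integral>x. norm (f x) powr q \<partial>lborel) powr (1 / q)"

text \<open>The full derivative is collected into the vector of partial derivatives. For a matrix
  field \<open>u\<close> on \<open>\<real>\<^sup>3\<close> its norm is the Euclidean (Frobenius) norm of all entries
  \<open>\<partial>\<^sub>k u\<^sub>i\<^sub>j\<close>.\<close>

definition full_deriv :: "(real^'n::finite \<Rightarrow> 'b::real_normed_vector) \<Rightarrow> real^'n \<Rightarrow> 'b^'n"
  where "full_deriv u x = (\<chi> k. partial_deriv k u x)"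

definition W1_seminorm :: "real \<Rightarrow> (real^'n::finite \<Rightarrow> 'b::real_normed_vector) \<Rightarrow> real"
  where "W1_seminorm q u = Lnorm q (full_deriv u)"

definition dev :: "real^3^3 \<Rightarrow> real^3^3"
  where "dev X = X - (trace X / 3) *\<^sub>R mat 1"

definition vec_curl :: "(real^3 \<Rightarrow> real^3) \<Rightarrow> real^3 \<Rightarrow> real^3"
  where "vec_curl v x = vector
    [partial_deriv 2 (\<lambda>y. v y $ 3) x - partial_deriv 3 (\<lambda>y. v y $ 2) x,
     partial_deriv 3 (\<lambda>y. v y $ 1) x - partial_deriv 1 (\<lambda>y. v y $ 3) x,
     partial_deriv 1 (\<lambda>y. v y $ 2) x - partial_deriv 2 (\<lambda>y. v y $ 1) x]"

text \<open>\<open>A $ i\<close> is the \<open>i\<close>-th row of a matrix \<open>A\<close>.\<close>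

definition Curl :: "(real^3 \<Rightarrow> real^3^3) \<Rightarrow> real^3 \<Rightarrow> real^3^3"
  where "Curl P x = (\<chi> i. vec_curl (\<lambda>y. P y $ i) x)"

definition inc :: "(real^3 \<Rightarrow> real^3^3) \<Rightarrow> real^3 \<Rightarrow> real^3^3"
  where "inc P = Curl (\<lambda>x. transpose (Curl P x))"

end

theory Submission
  imports Defs
begin

text \<open>Write \<open>P = dev P + t \<cdot> 1\<close> with \<open>t = tr P / 3\<close>. Then
  \<open>tr inc P = 2 \<Delta>t - \<Sum>\<^sub>a\<^sub>b \<partial>\<^sub>a \<partial>\<^sub>b (dev P)\<^sub>b\<^sub>a\<close>, so \<open>\<Delta>t = div F + g\<close> with \<open>F\<close> controlled by the gradient
  of \<open>dev P\<close> and \<open>g = tr inc P / 2\<close>, and it suffices to bound the \<open>L\<^sup>q\<close>-norm of \<open>\<nabla>t\<close>,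
  \<open>1/q = 1/p - 1/3\<close>, by those of \<open>F\<close> in \<open>L\<^sup>q\<close> and \<open>g\<close> in \<open>L\<^sup>p\<close>.

  The datum \<open>g\<close> is itself a divergence \<open>div G\<close>, where \<open>G\<close> averages the integrals of \<open>g\<close> along
  rays over a cube of directions; a splitting argument for the Hardy-Littlewood-Sobolev inequality
  puts \<open>G\<close> into \<open>L\<^sup>q\<close>.

  This leaves the Calderon-Zygmund estimate for \<open>\<Delta>t = div H\<close> with \<open>H = F + G\<close>. Let \<open>A\<close> be the mean
  over the neighbours \<open>x \<plusminus> h e\<^sub>k\<close> and \<open>D\<^sub>k\<close> the central difference. The pairing of \<open>\<partial>\<^sub>i t\<close> with a
  test function \<open>\<phi>\<close>, telescoped along the discrete heat flow \<open>A\<^sup>m\<close>, is up to errors that vanish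
  with \<open>h\<close> a sum of the integrals of \<open>D\<^sub>i A\<^sup>m H\<^sub>j \<cdot> D\<^sub>j A\<^sup>m (\<phi> + A \<phi>)\<close>. A convex Bellman function
  \<open>B(x, y)\<close> dominated by \<open>x\<^sup>q + y\<^sup>r\<close>, \<open>1/q + 1/r = 1\<close>, whose second derivative dominates
  \<open>\<bar>dx\<bar> \<bar>dy\<bar>\<close>, loses at least a multiple of \<open>\<bar>D\<^sub>i A\<^sup>m f\<bar> \<bar>D\<^sub>j A\<^sup>m \<phi>\<bar>\<close> in each step of the flow; summing
  over \<open>m\<close> bounds the pairing uniformly in \<open>h\<close>. The choice
  \<open>\<phi> = sgn(\<partial>\<^sub>i t) \<bar>\<partial>\<^sub>i t\<bar>\<^sup>q\<^sup>-\<^sup>1\<close> then gives the estimate, without Fourier analysis or singular integrals.\<close>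

text \<open>Writing \<open>g\<close> as a divergence puts both data into one field \<open>H\<close>,
  measured at the single exponent \<open>q\<close>, the Sobolev conjugate of \<open>p\<close>. The
  price is that \<open>H\<close> is only bounded and in \<open>L\<^sup>q\<close>: a ray potential
  need not have compact support. Hence only means and differences act on it, never derivatives, and
  summation by parts always pairs a bounded with an integrable function. The flow is discrete
  because one step is a mean of finitely many values. Jensen's gap at such a mean only needs the
  second derivative of a convex function along segments, and it telescopes over finitely many steps
  without a heat semigroup. \<open>D\<^sub>k\<close> is the difference of two of the averaged
  values, so the gap controls it directly. Step size and number of steps are coupled by
  \<open>N h\<^sup>2 = T\<close>. The consistency error of one step is \<open>o(h\<^sup>2)\<close>
  and adds up to \<open>o(1)\<close> for fixed \<open>T\<close>, while the pairing left after
  \<open>N\<close> steps is of order \<open>T powr (- 1 / 2)\<close> up to such errors.\<close>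

section \<open>A Bellman function\<close>

text \<open>Young's inequality for \<open>a\<close> and \<open>m powr (s - 1)\<close> with the
  exponents \<open>s\<close> and \<open>s / (s - 1)\<close> is the tangent inequality of the power,
  rearranged. No derivative is taken, so \<open>a = 0\<close> is covered as well.\<close>

lemma powr_tangent:
  fixes a m s :: real
  assumes "1 \<le> s" "0 \<le> a" "0 \<le> m"
  shows "m powr s + s * m powr (s - 1) * (a - m) \<le> a powr s"
proof (cases "s = 1 \<or> m = 0")
  case True
  then show ?thesis using assms by (cases "m = 0") auto
next
  case False
  with assms have s: "s > 1" and m: "m > 0" by auto
  define s' where "s' = s / (s - 1)"
  have s': "s' > 1" "1/s + 1/s' = 1" using s by (auto simp: s'_def field_simps)
  have "a * m powr (s - 1) \<le> a powr s / s + (m powr (s - 1)) powr s' / s'"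
    using Youngs_inequality[of s s' a "m powr (s - 1)"] s s' assms by auto
  also have "(m powr (s - 1)) powr s' = m powr s"
    using s by (simp add: powr_powr s'_def)
  finally have "s * (a * m powr (s - 1)) \<le> a powr s + m powr s * (s / s')"
    using s by (simp add: field_simps)
  also have "s / s' = s - 1" using s by (simp add: s'_def)
  finally have "s * (a * m powr (s - 1)) \<le> a powr s + m powr s * (s - 1)" .
  moreover have "m * m powr (s - 1) = m powr s"
    using m by (simp add: powr_diff)
  ultimately show ?thesis
    by (simp add: algebra_simps)
qed

text \<open>Jensen's inequality: in the sum of the tangent inequalities at the mean the linear terms
  cancel.\<close>

lemma mean_powr_le:
  fixes X :: "'i::finite \<Rightarrow> real"
  assumes "1 \<le> s" "\<And>i. 0 \<le> X i"
  shows "((\<Sum>i\<in>UNIV. X i) / CARD('i)) powr s \<le> (\<Sum>i\<in>UNIV. X i powr s) / CARD('i)"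
proof -
  define m where "m = (\<Sum>i\<in>UNIV. X i) / CARD('i)"
  have m0: "m \<ge> 0" by (auto simp: m_def assms intro!: divide_nonneg_nonneg sum_nonneg)
  have "(\<Sum>i\<in>(UNIV::'i set). m powr s + s * m powr (s - 1) * (X i - m)) \<le> (\<Sum>i\<in>UNIV. X i powr s)"
    by (intro sum_mono powr_tangent assms m0)
  also have "(\<Sum>i\<in>(UNIV::'i set). m powr s + s * m powr (s - 1) * (X i - m)) = CARD('i) * m powr s"
    by (simp add: sum.distrib sum_distrib_left[symmetric] sum_subtractf m_def)
  finally show ?thesis by (simp add: m_def field_simps)
qed

text \<open>The weight \<open>(x\<^sup>q + y\<^sup>r)\<^bsup>1 - 2/q\<^esup>\<close> behaves like \<open>y\<^bsup>2 - r\<^esup>\<close> for small \<open>x\<close>, but unlike that power it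
  does not destroy convexity in \<open>y\<close> where \<open>y\<^sup>r\<close> is much smaller than \<open>x\<^sup>q\<close>; the second summand absorbs
  the mixed derivative.\<close>

definition bellman :: "real \<Rightarrow> real \<Rightarrow> real \<Rightarrow> real \<Rightarrow> real" where
  "bellman q r x y = x\<^sup>2 * (x powr q + y powr r) powr (1 - 2 / q) + 21 * q * y powr r"

text \<open>\<open>bellman1\<close> and \<open>bellman2\<close> are closed forms of the first and
  second derivatives of \<open>bellman q r\<close> at \<open>(x, y)\<close> in the direction
  \<open>(a, c)\<close>.\<close>

definition bellman1 :: "real \<Rightarrow> real \<Rightarrow> real \<Rightarrow> real \<Rightarrow> real \<Rightarrow> real \<Rightarrow> real" where
  "bellman1 q r x y a c =
     (let b = 1 - 2 / q; N = x powr q + y powr r;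
          N' = q * x powr (q - 1) * a + r * y powr (r - 1) * c
      in 2 * x * a * N powr b + x\<^sup>2 * (b * N powr (b - 1) * N') + 21 * q * r * y powr (r - 1) * c)"

definition bellman2 :: "real \<Rightarrow> real \<Rightarrow> real \<Rightarrow> real \<Rightarrow> real \<Rightarrow> real \<Rightarrow> real" where
  "bellman2 q r x y a c =
     (let b = 1 - 2 / q; N = x powr q + y powr r;
          N' = q * x powr (q - 1) * a + r * y powr (r - 1) * c;
          N'' = q * (q - 1) * x powr (q - 2) * a\<^sup>2 + r * (r - 1) * y powr (r - 2) * c\<^sup>2
      in 2 * a\<^sup>2 * N powr b + 4 * x * a * (b * N powr (b - 1) * N')
         + x\<^sup>2 * (b * (b - 1) * N powr (b - 2) * N'\<^sup>2 + b * N powr (b - 1) * N'')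
         + 21 * q * r * (r - 1) * y powr (r - 2) * c\<^sup>2)"

text \<open>The first derivative is linear in its direction. Applied to deviations from a mean,
  which sum to zero, this removes all first-order terms in \<open>bellman_mean\<close>.\<close>

lemma bellman1_sum:
  fixes X Y :: "'i::finite \<Rightarrow> real"
  shows "(\<Sum>i\<in>UNIV. bellman1 q r x y (X i) (Y i)) = bellman1 q r x y (\<Sum>i\<in>UNIV. X i) (\<Sum>i\<in>UNIV. Y i)"
proof -
  define b where "b = 1 - 2 / q"
  define N where "N = x powr q + y powr r"
  define U where "U = 2 * x * N powr b + x\<^sup>2 * (b * N powr (b - 1) * (q * x powr (q - 1)))"
  define V where "V = x\<^sup>2 * (b * N powr (b - 1) * (r * y powr (r - 1))) + 21 * q * r * y powr (r - 1)"
  have "bellman1 q r x y a c = a * U + c * V" for a c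
    unfolding bellman1_def Let_def b_def[symmetric] N_def[symmetric] U_def V_def
    by (simp add: algebra_simps)
  then show ?thesis by (simp add: sum.distrib sum_distrib_right)
qed

lemma bellman1_0: "bellman1 q r x y 0 0 = 0"
  by (simp add: bellman1_def)

lemma bellman_line_deriv:
  assumes "0 < x0 + s * a" "0 < y0 + s * c"
  shows "((\<lambda>s. bellman q r (x0 + s * a) (y0 + s * c)) has_real_derivative
            bellman1 q r (x0 + s * a) (y0 + s * c) a c) (at s)"
proof -
  have dx: "((\<lambda>s. x0 + s * a) has_real_derivative a) (at s)" for x0 a s :: real
    by (auto intro!: derivative_eq_intros)
  note px = DERIV_fun_powr[OF dx assms(1), of q, simplified]
  note py = DERIV_fun_powr[OF dx assms(2), of r, simplified]
  have N: "(x0 + s * a) powr q + (y0 + s * c) powr r > 0"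
    using assms by (simp add: add_pos_pos)
  note pN = DERIV_fun_powr[OF DERIV_add[OF px py] N, of "1 - 2/q", simplified]
  have "((\<lambda>s. (x0 + s * a)\<^sup>2) has_real_derivative 2 * (x0 + s * a) * a) (at s)"
    by (auto intro!: derivative_eq_intros)
  from DERIV_add[OF DERIV_mult[OF this pN] DERIV_cmult[OF py, of "21*q"]]
  show ?thesis unfolding bellman_def bellman1_def Let_def
    by (simp add: algebra_simps)
qed

lemma bellman1_line_deriv:
  assumes "0 < x0 + s * a" "0 < y0 + s * c"
  shows "((\<lambda>s. bellman1 q r (x0 + s * a) (y0 + s * c) a c) has_real_derivative
            bellman2 q r (x0 + s * a) (y0 + s * c) a c) (at s)"
proof -
  have dx: "((\<lambda>s. x0 + s * a) has_real_derivative a) (at s)" for x0 a s :: real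
    by (auto intro!: derivative_eq_intros)
  define b where "b = 1 - 2/q"
  note px = DERIV_fun_powr[OF dx assms(1), of q, simplified]
  note py = DERIV_fun_powr[OF dx assms(2), of r, simplified]
  note px1 = DERIV_fun_powr[OF dx assms(1), of "q-1", simplified]
  note py1 = DERIV_fun_powr[OF dx assms(2), of "r-1", simplified]
  have N: "(x0 + s * a) powr q + (y0 + s * c) powr r > 0"
    using assms by (simp add: add_pos_pos)
  note pN = DERIV_fun_powr[OF DERIV_add[OF px py] N, of b, simplified]
  note pN1 = DERIV_fun_powr[OF DERIV_add[OF px py] N, of "b-1", simplified]
  have dN': "((\<lambda>s. q * (x0 + s * a) powr (q-1) * a + r * (y0 + s * c) powr (r-1) * c) has_real_derivative
      q * ((q-1) * (x0 + s * a) powr (q-2) * a) * a + r * ((r-1) * (y0 + s * c) powr (r-2) * c) * c) (at s)"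
    using DERIV_add[OF DERIV_cmult_right[OF DERIV_cmult[OF px1, of q], of a]
        DERIV_cmult_right[OF DERIV_cmult[OF py1, of r], of c]]
    by (simp add: algebra_simps)
  have d2: "((\<lambda>s. (x0 + s * a)\<^sup>2) has_real_derivative 2 * (x0 + s * a) * a) (at s)"
    by (auto intro!: derivative_eq_intros)
  have d1: "((\<lambda>s. 2 * (x0 + s * a) * a) has_real_derivative 2 * a * a) (at s)"
    by (auto intro!: derivative_eq_intros)
  show ?thesis unfolding bellman1_def bellman2_def Let_def b_def[symmetric]
    by (rule DERIV_cong[OF DERIV_add[OF DERIV_add[OF DERIV_mult[OF d1 pN]
          DERIV_mult[OF d2 DERIV_mult[OF DERIV_cmult[OF pN1, of b] dN']]]
          DERIV_cmult_right[OF DERIV_cmult[OF py1, of "21*q*r"], of c]]])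
       (simp add: algebra_simps power2_eq_square)
qed

text \<open>Since \<open>x\<^sup>2 = (x powr q) powr (2 / q)\<close>, the two exponents of
  \<open>N\<close> add up to 1. This bounds the first summand of \<open>bellman\<close>, and later
  the loss in its second derivative, by multiples of \<open>N\<close>.\<close>

lemma square_mult_powr_le:
  fixes q x N :: real
  assumes "2 \<le> q" "0 \<le> x" "x powr q \<le> N"
  shows "x\<^sup>2 * N powr (1 - 2 / q) \<le> N"
proof (cases "x = 0")
  case True
  then show ?thesis using assms by auto
next
  case False
  with assms have "x > 0" by auto
  then have N: "N > 0" using assms(3) by (smt (verit) powr_gt_zero)
  have "x\<^sup>2 = (x powr q) powr (2/q)"
    using \<open>x > 0\<close> assms by (simp add: powr_powr powr_numeral)
  also have "\<dots> \<le> N powr (2/q)" using assms by (intro powr_mono2) auto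
  finally have "x\<^sup>2 * N powr (1 - 2 / q) \<le> N powr (2/q) * N powr (1 - 2 / q)"
    by (intro mult_right_mono) auto
  also have "\<dots> = N" using N by (simp add: powr_add[symmetric])
  finally show ?thesis .
qed

lemma bellman_bounds:
  assumes "2 \<le> q" "0 \<le> x"
  shows "0 \<le> bellman q r x y" "bellman q r x y \<le> 22 * q * (x powr q + y powr r)"
proof -
  show "0 \<le> bellman q r x y" using assms by (simp add: bellman_def)
  have "x\<^sup>2 * (x powr q + y powr r) powr (1 - 2 / q) \<le> 1 * (x powr q + y powr r)"
    using square_mult_powr_le[of q x "x powr q + y powr r"] assms by simp
  also have "\<dots> \<le> q * (x powr q + y powr r)" by (intro mult_right_mono) (use assms in auto)
  finally have "bellman q r x y \<le> q * (x powr q + y powr r) + 21 * q * y powr r"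
    by (simp add: bellman_def)
  moreover have "21 * q * y powr r \<le> 21 * q * (x powr q + y powr r)"
    by (intro mult_left_mono) (use assms in auto)
  ultimately show "bellman q r x y \<le> 22 * q * (x powr q + y powr r)" by linarith
qed

text \<open>The right-hand side is the second derivative of the first summand of
  \<open>bellman\<close> divided by \<open>x\<^sup>2 * N powr b\<close>, in the scale-free variables
  \<open>X = a / x\<close>, \<open>Y = c / y\<close> and the shares \<open>al\<close>,
  \<open>be\<close> of \<open>x powr q\<close>, \<open>y powr r\<close> in \<open>N\<close>. The
  mixed term is absorbed by completing a square, at the cost of a multiple of
  \<open>be * Y\<^sup>2\<close> only.\<close>

lemma bellman2_algebra:
  fixes q r al be X Y :: real
  assumes "2 \<le> q" "1 \<le> r" "r \<le> 2" "0 \<le> al" "0 \<le> be" "al + be = 1" "b = 1 - 2 / q"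
  shows "X\<^sup>2 - 20 * be * Y\<^sup>2 \<le> 2 * X\<^sup>2 + 4 * b * X * (q * al * X + r * be * Y)
     - b * (1 - b) * (q * al * X + r * be * Y)\<^sup>2
     + b * (q * (q - 1) * al * X\<^sup>2 + r * (r - 1) * be * Y\<^sup>2)" (is "_ \<le> ?R")
proof -
  have "0 \<le> 2 / q" "2 / q \<le> 1" using assms by (auto simp: field_simps)
  with assms have b: "0 \<le> b" "b \<le> 1" by auto
  have qb: "q * b = q - 2" using assms by (simp add: field_simps)
  have al: "al = 1 - be" "be \<le> 1" using assms by auto
  \<comment> \<open>The last summand is zero because \<open>q * b = q - 2\<close>. Carrying it along
    makes \<open>e\<close> a polynomial identity in independent variables, provable by
    expansion.\<close>
  have e: "?R = X\<^sup>2 + (X + 2 * b * r * be\<^sup>2 * Y)\<^sup>2 + X\<^sup>2 * (q * b) * al * (q + 1 + 2 * be)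
     - (4 * b\<^sup>2 * r\<^sup>2 * be^4 + b * (1 - b) * r\<^sup>2 * be\<^sup>2 - b * r * (r - 1) * be) * Y\<^sup>2
     + b * al * (q * b - (q - 2)) * (q * al * X\<^sup>2 + 2 * r * be * X * Y)"
    unfolding al by (simp add: algebra_simps power2_eq_square power4_eq_xxxx)
  have "b\<^sup>2 \<le> 1" "r\<^sup>2 \<le> 4" "be^4 \<le> be" "be\<^sup>2 \<le> be"
    using b assms al power_mono[of r 2 2] power_decreasing[of 1 4 be] power_decreasing[of 1 2 be]
    by (auto simp: power_le_one)
  then have "b\<^sup>2 * r\<^sup>2 * be^4 \<le> 1 * 4 * be"
    by (intro mult_mono) (use assms in auto)
  moreover have "(b * (1 - b)) * r\<^sup>2 * be\<^sup>2 \<le> 1 * 4 * be"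
    by (intro mult_mono mult_le_one) (use assms b \<open>r\<^sup>2 \<le> 4\<close> \<open>be\<^sup>2 \<le> be\<close> in auto)
  moreover have "0 \<le> b * r * (r - 1) * be" using assms b by simp
  \<comment> \<open>\<open>20 = 4 * 4 + 4\<close>: both positive terms contain
    \<open>r\<^sup>2 \<le> 4\<close>, and the third term only helps.\<close>
  ultimately have "(4 * b\<^sup>2 * r\<^sup>2 * be^4 + b * (1 - b) * r\<^sup>2 * be\<^sup>2 - b * r * (r - 1) * be) * Y\<^sup>2
      \<le> (20 * be) * Y\<^sup>2"
    by (intro mult_right_mono) (auto simp: algebra_simps)
  moreover have "0 \<le> X\<^sup>2 * (q * b) * al * (q + 1 + 2 * be)"
    using assms b by (intro mult_nonneg_nonneg) auto
  moreover have "0 \<le> (X + 2 * b * r * be\<^sup>2 * Y)\<^sup>2" by simp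
  ultimately show ?thesis unfolding e qb diff_self mult_zero_right mult_zero_left by linarith
qed

text \<open>The weights \<open>y powr (2 - r)\<close> and \<open>y powr (r - 2)\<close> are
  reciprocal, so this lower bound dominates \<open>2 * \<bar>a\<bar> * \<bar>c\<bar>\<close> at
  every point. Of the coefficient 21 in \<open>bellman\<close>, 20 parts pay for the loss in
  \<open>bellman2_algebra\<close> and one remains, because
  \<open>q * r * (r - 1) = r\<^sup>2 \<ge> 1\<close>.\<close>

lemma bellman2_ge:
  assumes q: "2 \<le> q" and r: "r = q / (q - 1)" and x: "0 < x" and y: "0 < y"
  shows "y powr (2 - r) * a\<^sup>2 + y powr (r - 2) * c\<^sup>2 \<le> bellman2 q r x y a c"
proof -
  define b where "b = 1 - 2 / q"
  define N where "N = x powr q + y powr r"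
  define al where "al = x powr q / N"
  define be where "be = y powr r / N"
  define W where "W = N powr b"
  define X where "X = a / x"
  define Y where "Y = c / y"
  have N: "N > 0" unfolding N_def using x y by (simp add: add_pos_pos)
  have r12: "1 < r" "r \<le> 2" using q by (auto simp: r field_simps)
  have albe: "0 \<le> al" "0 \<le> be" "al + be = 1"
    using N by (auto simp: al_def be_def N_def add_divide_distrib[symmetric])
  have pq: "x powr (q - 1) = al * N / x" "x powr (q - 2) = al * N / x\<^sup>2"
    using N x by (auto simp: al_def powr_diff powr_numeral)
  have pr: "y powr (r - 1) = be * N / y" "y powr (r - 2) = be * N / y\<^sup>2"
    using N y by (auto simp: be_def powr_diff powr_numeral)
  have pN: "N powr (b - 1) = W / N" "N powr (b - 2) = W / N\<^sup>2"
    using N by (auto simp: W_def powr_diff powr_numeral)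
  have W0: "W > 0" using N by (simp add: W_def)
  have "bellman2 q r x y a c = x\<^sup>2 * W * (2 * X\<^sup>2 + 4 * b * X * (q * al * X + r * be * Y)
     - b * (1 - b) * (q * al * X + r * be * Y)\<^sup>2
     + b * (q * (q - 1) * al * X\<^sup>2 + r * (r - 1) * be * Y\<^sup>2)) + 21 * q * r * (r - 1) * (be * N) * Y\<^sup>2"
    unfolding bellman2_def Let_def b_def[symmetric] N_def[symmetric] pq pr pN W_def[symmetric]
    using x y N by (simp add: X_def Y_def field_simps power2_eq_square)
  also have "\<dots> \<ge> x\<^sup>2 * W * (X\<^sup>2 - 20 * be * Y\<^sup>2) + 21 * q * r * (r - 1) * (be * N) * Y\<^sup>2"
    using bellman2_algebra[OF q _ r12(2) albe b_def] r12 x W0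
    by (intro add_right_mono mult_left_mono) auto
  finally have 1: "x\<^sup>2 * W * (X\<^sup>2 - 20 * be * Y\<^sup>2) + 21 * q * r * (r - 1) * (be * N) * Y\<^sup>2
      \<le> bellman2 q r x y a c" .
  have "x\<^sup>2 * W \<le> N" unfolding W_def b_def
    using x q y by (intro square_mult_powr_le) (auto simp: N_def)
  then have 2: "x\<^sup>2 * W * (20 * be * Y\<^sup>2) \<le> N * (20 * be * Y\<^sup>2)"
    by (intro mult_right_mono) (use albe in auto)
  have "1 \<le> q * r * (r - 1)"
  proof -
    have "q * r * (r - 1) = (q / (q-1))\<^sup>2" using q by (simp add: r field_simps power2_eq_square)
    also have "\<dots> \<ge> 1" using q by (simp add: field_simps)
    finally show ?thesis .
  qed
  then have 3: "1 * (be * N * Y\<^sup>2) \<le> q * r * (r - 1) * (be * N * Y\<^sup>2)"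
    by (intro mult_right_mono) (use albe N in auto)
  have 4: "x\<^sup>2 * W * X\<^sup>2 = W * a\<^sup>2" using x by (simp add: X_def field_simps)
  have 5: "be * N * Y\<^sup>2 = y powr (r - 2) * c\<^sup>2" using y by (simp add: pr Y_def field_simps)
  \<comment> \<open>This identity selects the exponent \<open>1 - 2 / q\<close> of the weight:
    \<open>N powr b\<close> then dominates the power of \<open>y\<close> that is reciprocal to the
    one in front of \<open>c\<^sup>2\<close>.\<close>
  have "r * b = 2 - r" using q by (simp add: b_def r divide_simps)
  then have "y powr (2 - r) = (y powr r) powr b"
    by (simp add: powr_powr)
  also have "\<dots> \<le> W" unfolding W_def using q by (intro powr_mono2) (auto simp: N_def b_def)
  finally have 6: "y powr (2 - r) * a\<^sup>2 \<le> W * a\<^sup>2" by (rule mult_right_mono) simp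
  have "x\<^sup>2 * W * X\<^sup>2 - x\<^sup>2 * W * (20 * be * Y\<^sup>2) + 21 * (q * r * (r - 1) * (be * N * Y\<^sup>2)) \<le> bellman2 q r x y a c"
    using 1 by (simp add: algebra_simps)
  moreover have "N * (20 * be * Y\<^sup>2) = 20 * (be * N * Y\<^sup>2)" by simp
  ultimately show ?thesis using 2 3 4 5 6 by linarith
qed

lemma bellman_continuous:
  assumes "2 \<le> q" "1 < r" "continuous_on S f" "continuous_on S g" "\<And>s. s \<in> S \<Longrightarrow> 0 \<le> f s" "\<And>s. s \<in> S \<Longrightarrow> 0 \<le> g s"
  shows "continuous_on S (\<lambda>s. bellman q r (f s) (g s))"
proof -
  have f: "continuous_on S (\<lambda>s. f s powr q)" and g: "continuous_on S (\<lambda>s. g s powr r)"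
    using assms by (auto intro!: continuous_on_powr' continuous_on_const)
  show ?thesis
  proof (cases "q = 2")
    case True
    \<comment> \<open>For \<open>q = 2\<close> the weight has exponent 0, and
      \<open>0 powr 0 = 0\<close> makes it jump at the origin; the factor
      \<open>(f s)\<^sup>2\<close> hides the jump.\<close>
    have "(f s)\<^sup>2 * (f s powr q + g s powr r) powr (1 - 2 / q) = (f s)\<^sup>2" if "s \<in> S" for s
      using assms(5,6)[OF that] True add_pos_nonneg[of "f s powr q" "g s powr r"]
      by (cases "f s = 0") auto
    then have "(f s)\<^sup>2 + 21 * q * g s powr r = bellman q r (f s) (g s)" if "s \<in> S" for s
      using that by (simp add: bellman_def)
    moreover have "continuous_on S (\<lambda>s. (f s)\<^sup>2 + 21 * q * g s powr r)"
      by (intro continuous_on_add continuous_on_mult continuous_on_power continuous_on_const g assms)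
    ultimately show ?thesis by (simp add: continuous_on_eq)
  next
    case False
    with assms have "0 < 1 - 2 / q" by (auto simp: field_simps)
    then have "continuous_on S (\<lambda>s. (f s powr q + g s powr r) powr (1 - 2 / q))"
      by (intro continuous_on_powr' continuous_on_add continuous_on_const f g) auto
    then show ?thesis unfolding bellman_def
      by (intro continuous_on_add continuous_on_mult continuous_on_power continuous_on_const g assms)
  qed
qed

text \<open>The bound \<open>\<kappa>\<close> is required on the first half only: along a segment that ends on the boundary of
  the quadrant the second derivative of the Bellman function degenerates.\<close>

lemma two_step_second_order_bound:
  fixes f f' f'' :: "real \<Rightarrow> real"
  assumes cont: "continuous_on {0..1} f"
    and f': "\<And>s. 0 \<le> s \<Longrightarrow> s < 1 \<Longrightarrow> (f has_real_derivative f' s) (at s)"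
    and f'': "\<And>s. 0 \<le> s \<Longrightarrow> s < 1 \<Longrightarrow> (f' has_real_derivative f'' s) (at s)"
    and nn: "\<And>s. 0 \<le> s \<Longrightarrow> s < 1 \<Longrightarrow> 0 \<le> f'' s"
    and k: "\<And>s. 0 \<le> s \<Longrightarrow> s \<le> 1/2 \<Longrightarrow> \<kappa> \<le> f'' s"
  shows "f 0 + f' 0 + \<kappa> / 4 \<le> f 1"
proof -
  have mono: "f' s \<le> f' t" if "0 \<le> s" "s \<le> t" "t < 1" for s t
    using that by (intro DERIV_nonneg_imp_nondecreasing[of s t f']) (auto intro!: f'' nn exI)
  \<comment> \<open>The slope has gained \<open>\<kappa> / 2\<close> at the midpoint. Acting over
    the remaining length \<open>1 / 2\<close>, this gain contributes
    \<open>\<kappa> / 4\<close>.\<close>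
  have half: "f' 0 + \<kappa> / 2 \<le> f' (1/2)"
  proof -
    have "f' 0 - \<kappa> * 0 \<le> f' (1/2) - \<kappa> * (1/2)"
      by (rule DERIV_nonneg_imp_nondecreasing[of 0 "1/2" "\<lambda>s. f' s - \<kappa> * s"])
        (auto intro!: exI[of _ "f'' _ - \<kappa>"] derivative_eq_intros f'' simp: k)
    then show ?thesis by simp
  qed
  have diff: "f differentiable (at s)" if "0 \<le> s" "s < 1" for s
    using f'[OF that] by (auto simp: real_differentiable_def)
  have "\<exists>l z. 0 < z \<and> z < (1/2::real) \<and> DERIV f z :> l \<and> f (1/2) - f 0 = (1/2 - 0) * l"
    by (rule MVT) (auto intro!: continuous_on_subset[OF cont] diff)
  then obtain z l where z: "0 < z" "z < 1/2" "DERIV f z :> l" "f (1/2) - f 0 = 1/2 * l" by auto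
  then have "l = f' z" using f'[of z] DERIV_unique by force
  then have 1: "f (1/2) - f 0 \<ge> 1/2 * f' 0" using mono[of 0 z] z by simp
  have "\<exists>l z. 1/2 < z \<and> z < (1::real) \<and> DERIV f z :> l \<and> f 1 - f (1/2) = (1 - 1/2) * l"
    by (rule MVT) (auto intro!: continuous_on_subset[OF cont] diff)
  then obtain z l where z: "1/2 < z" "z < 1" "DERIV f z :> l" "f 1 - f (1/2) = 1/2 * l" by auto
  then have "l = f' z" using f'[of z] DERIV_unique by force
  then have 2: "f 1 - f (1/2) \<ge> 1/2 * f' (1/2)" using mono[of "1/2" z] z by simp
  show ?thesis using 1 2 half by simp
qed

text \<open>The condition \<open>y' \<le> M * y\<close> holds automatically when \<open>y\<close> is
  the mean of \<open>M\<close> nonnegative numbers including \<open>y'\<close>. On the first half of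
  the segment the second coordinate then stays between \<open>y / 2\<close> and
  \<open>M * y\<close>, so both weights are at least their values at \<open>y\<close> divided by
  \<open>2 * M\<close>. The other factor 4 comes from
  \<open>two_step_second_order_bound\<close>.\<close>

lemma bellman_segment:
  assumes q: "2 \<le> q" and r: "r = q / (q - 1)" and m: "1 \<le> M"
    and pos: "0 < x" "0 < y" and nn: "0 \<le> x'" "0 \<le> y'" "y' \<le> M * y"
  shows "bellman q r x y + bellman1 q r x y (x' - x) (y' - y)
     + (y powr (2 - r) * (x' - x)\<^sup>2 + y powr (r - 2) * (y' - y)\<^sup>2) / (8 * M) \<le> bellman q r x' y'"
proof -
  have r12: "1 < r" "r \<le> 2" using q by (auto simp: r field_simps)
  define fx where "fx s = x + s * (x' - x)" for s :: real
  define fy where "fy s = y + s * (y' - y)" for s :: real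
  have fx: "fx s = (1 - s) * x + s * x'" for s by (simp add: fx_def algebra_simps)
  have fy: "fy s = (1 - s) * y + s * y'" for s by (simp add: fy_def algebra_simps)
  have fpos: "0 < fx s" "0 < fy s" if "0 \<le> s" "s < 1" for s
    using that pos nn by (auto simp: fx fy intro!: add_pos_nonneg)
  have fnn: "0 \<le> fx s" "0 \<le> fy s" if "s \<in> {0..1}" for s
    using that pos nn by (auto simp: fx fy intro!: add_nonneg_nonneg)
  define \<kappa> where "\<kappa> = (y powr (2 - r) * (x' - x)\<^sup>2 + y powr (r - 2) * (y' - y)\<^sup>2) / (2 * M)"
  have "bellman q r (fx 0) (fy 0) + bellman1 q r (fx 0) (fy 0) (x' - x) (y' - y) + \<kappa> / 4
      \<le> bellman q r (fx 1) (fy 1)"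
  proof (rule two_step_second_order_bound[where f'' = "\<lambda>s. bellman2 q r (fx s) (fy s) (x' - x) (y' - y)"])
    show "continuous_on {0..1} (\<lambda>s. bellman q r (fx s) (fy s))"
      using fnn by (intro bellman_continuous q r12(1)) (auto simp: fx_def fy_def intro!: continuous_intros)
    fix s :: real assume s0: "0 \<le> s"
    { assume s: "s < 1"
      note p = fpos[OF s0 s]
      show "((\<lambda>s. bellman q r (fx s) (fy s)) has_real_derivative bellman1 q r (fx s) (fy s) (x' - x) (y' - y)) (at s)"
        using p unfolding fx_def fy_def by (intro bellman_line_deriv)
      show "((\<lambda>s. bellman1 q r (fx s) (fy s) (x' - x) (y' - y)) has_real_derivative
           bellman2 q r (fx s) (fy s) (x' - x) (y' - y)) (at s)"
        using p unfolding fx_def fy_def by (intro bellman1_line_deriv)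
      show "0 \<le> bellman2 q r (fx s) (fy s) (x' - x) (y' - y)"
        by (rule order_trans[OF _ bellman2_ge[OF q r p]]) simp }
    assume s: "s \<le> 1/2"
    note p = fpos[OF s0, of]
    have lo: "y / 2 \<le> fy s"
    proof -
      have "1/2 * y \<le> (1 - s) * y" using s pos by (intro mult_right_mono) auto
      then show ?thesis using nn s0 by (simp add: fy add_increasing2)
    qed
    have hi: "fy s \<le> M * y"
    proof -
      have "1 * y \<le> M * y" using m pos by (intro mult_right_mono) auto
      then have "(1 - s) * y + s * y' \<le> (1 - s) * (M * y) + s * (M * y)"
        using s s0 nn by (intro add_mono mult_left_mono) auto
      then show ?thesis by (simp add: fy algebra_simps)
    qed
    have "1 / (2 * M) \<le> 1/2" using m by (simp add: field_simps)
    also have "1/2 \<le> (1/2::real) powr (2 - r)"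
      using powr_mono'[of "2 - r" 1 "1/2::real"] r12 by simp
    finally have "y powr (2 - r) * (1 / (2 * M)) \<le> y powr (2 - r) * (1/2) powr (2 - r)"
      by (intro mult_left_mono) auto
    also have "\<dots> = (y / 2) powr (2 - r)" using pos by (simp add: powr_mult[symmetric])
    also have "\<dots> \<le> fy s powr (2 - r)" using lo r12 pos by (intro powr_mono2) auto
    finally have 1: "y powr (2 - r) / (2 * M) * (x' - x)\<^sup>2 \<le> fy s powr (2 - r) * (x' - x)\<^sup>2"
      by (intro mult_right_mono) auto
    have "1 / (2 * M) \<le> M powr (-1)" using m by (simp add: field_simps powr_minus)
    also have "\<dots> \<le> M powr (r - 2)" using m r12 by (intro powr_mono) auto
    finally have "y powr (r - 2) * (1 / (2 * M)) \<le> y powr (r - 2) * M powr (r - 2)"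
      by (intro mult_left_mono) auto
    also have "\<dots> = (M * y) powr (r - 2)" using pos m by (simp add: powr_mult)
    also have "\<dots> \<le> fy s powr (r - 2)" using hi r12 pos m lo by (intro powr_mono2') auto
    finally have 2: "y powr (r - 2) / (2 * M) * (y' - y)\<^sup>2 \<le> fy s powr (r - 2) * (y' - y)\<^sup>2"
      by (intro mult_right_mono) auto
    have "\<kappa> \<le> fy s powr (2 - r) * (x' - x)\<^sup>2 + fy s powr (r - 2) * (y' - y)\<^sup>2"
      using 1 2 by (simp add: \<kappa>_def add_divide_distrib)
    also have "\<dots> \<le> bellman2 q r (fx s) (fy s) (x' - x) (y' - y)"
      using fpos[of s] s s0 by (intro bellman2_ge q r) auto
    finally show "\<kappa> \<le> bellman2 q r (fx s) (fy s) (x' - x) (y' - y)" .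
  qed
  then show ?thesis by (simp add: fx_def fy_def \<kappa>_def)
qed

section \<open>Jensen's gap of the Bellman function\<close>

lemma diff_square_le_sum_squares:
  fixes X :: "'i::finite \<Rightarrow> real"
  shows "(X i - X j)\<^sup>2 \<le> 4 * (\<Sum>k\<in>UNIV. (X k - m)\<^sup>2)"
proof -
  have "(X i - X j)\<^sup>2 \<le> 2 * (X i - m)\<^sup>2 + 2 * (X j - m)\<^sup>2"
    using zero_le_power2[of "(X i - m) + (X j - m)"] by (simp add: power2_eq_square algebra_simps)
  moreover have "(X l - m)\<^sup>2 \<le> (\<Sum>k\<in>UNIV. (X k - m)\<^sup>2)" for l
    by (rule member_le_sum) auto
  from this[of i] this[of j] have "2 * (X i - m)\<^sup>2 + 2 * (X j - m)\<^sup>2 \<le> 4 * (\<Sum>k\<in>UNIV. (X k - m)\<^sup>2)" by simp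
  ultimately show ?thesis by simp
qed

text \<open>Averaging \<open>bellman_segment\<close> over the points, with the mean as base point,
  leaves Jensen's gap on one side and a weighted sum of squared deviations on the other. Since the
  weights are reciprocal, that sum dominates a product of two differences wherever the mean
  lies.\<close>

lemma bellman_mean:
  fixes X Y :: "'i::finite \<Rightarrow> real"
  assumes q: "2 \<le> q" and r: "r = q / (q - 1)" and X: "\<And>i. 0 \<le> X i" and Y: "\<And>i. 0 \<le> Y i"
  defines "M \<equiv> real CARD('i)"
  shows "\<bar>X i - X j\<bar> * \<bar>Y k - Y l\<bar> \<le> 16 * M\<^sup>2 *
    ((\<Sum>i\<in>UNIV. bellman q r (X i) (Y i)) / M - bellman q r ((\<Sum>i\<in>UNIV. X i) / M) ((\<Sum>i\<in>UNIV. Y i) / M))"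
proof -
  define x where "x = (\<Sum>i\<in>UNIV. X i) / M"
  define y where "y = (\<Sum>i\<in>UNIV. Y i) / M"
  have r12: "1 < r" "r \<le> 2" using q by (auto simp: r field_simps)
  have M: "M \<ge> 1" unfolding M_def by (simp add: Suc_le_eq)
  have xy: "0 \<le> x" "0 \<le> y" using M by (auto simp: x_def y_def X Y intro!: divide_nonneg_nonneg sum_nonneg)
  consider "x = 0" | "y = 0" | "0 < x" "0 < y" using xy by force
  then show ?thesis unfolding x_def[symmetric] y_def[symmetric]
  proof cases
    \<comment> \<open>If a mean vanishes, so do all its values. The product is then zero and
      convexity of the other power suffices, whereas \<open>bellman_segment\<close> would need a
      positive base point.\<close>
    case 1
    then have X0: "X i = 0" for i
      using M X by (auto simp: x_def sum_nonneg_eq_0_iff)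
    have "bellman q r 0 v = 21 * q * v powr r" for v by (simp add: bellman_def)
    moreover have "21 * q * y powr r \<le> 21 * q * ((\<Sum>i\<in>UNIV. Y i powr r) / M)"
      unfolding y_def M_def using r12 Y q by (intro mult_left_mono mean_powr_le) auto
    ultimately show "\<bar>X i - X j\<bar> * \<bar>Y k - Y l\<bar> \<le> 16 * M\<^sup>2 * ((\<Sum>i\<in>UNIV. bellman q r (X i) (Y i)) / M - bellman q r x y)"
      using 1 by (simp add: X0 sum_distrib_left)
  next
    case 2
    then have Y0: "Y i = 0" for i
      using M Y by (auto simp: y_def sum_nonneg_eq_0_iff)
    have e: "bellman q r u 0 = u powr q" if "u \<ge> 0" for u
    proof (cases "u = 0")
      case False
      with that have "u\<^sup>2 * u powr (q - 2) = u powr q" by (simp add: powr_diff powr_numeral)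
      moreover have "q * (1 - 2 / q) = q - 2" using q by (simp add: field_simps)
      ultimately show ?thesis by (simp add: bellman_def powr_powr)
    qed (simp add: bellman_def)
    have "x powr q \<le> (\<Sum>i\<in>UNIV. X i powr q) / M"
      unfolding x_def M_def using X q by (intro mean_powr_le) auto
    then show "\<bar>X i - X j\<bar> * \<bar>Y k - Y l\<bar> \<le> 16 * M\<^sup>2 * ((\<Sum>i\<in>UNIV. bellman q r (X i) (Y i)) / M - bellman q r x y)"
      using 2 xy X by (simp add: Y0 e)
  next
    case 3
    define \<tau> where "\<tau> = y powr (2 - r)"
    define \<tau>' where "\<tau>' = y powr (r - 2)"
    have \<tau>: "\<tau> * \<tau>' = 1" "\<tau> > 0" "\<tau>' > 0" using 3 by (auto simp: \<tau>_def \<tau>'_def powr_add[symmetric])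
    have Yle: "Y i \<le> M * y" for i
      using M Y by (auto simp: y_def intro!: member_le_sum)
    have "(\<Sum>i\<in>(UNIV::'i set). bellman q r x y + bellman1 q r x y (X i - x) (Y i - y)
       + (\<tau> * (X i - x)\<^sup>2 + \<tau>' * (Y i - y)\<^sup>2) / (8 * M)) \<le> (\<Sum>i\<in>UNIV. bellman q r (X i) (Y i))"
      unfolding \<tau>_def \<tau>'_def by (intro sum_mono bellman_segment q r M 3 X Y Yle)
    moreover have "(\<Sum>i\<in>(UNIV::'i set). X i - x) = 0" "(\<Sum>i\<in>(UNIV::'i set). Y i - y) = 0"
      using M by (auto simp: sum_subtractf x_def y_def M_def)
    ultimately have "M * bellman q r x y + (\<tau> * (\<Sum>i\<in>UNIV. (X i - x)\<^sup>2) + \<tau>' * (\<Sum>i\<in>UNIV. (Y i - y)\<^sup>2)) / (8 * M)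
       \<le> (\<Sum>i\<in>UNIV. bellman q r (X i) (Y i))"
      by (simp add: sum.distrib bellman1_sum bellman1_0 sum_divide_distrib[symmetric] sum_distrib_left M_def)
    moreover have "2 * (\<bar>X i - X j\<bar> * \<bar>Y k - Y l\<bar>) \<le> \<tau> * (X i - X j)\<^sup>2 + \<tau>' * (Y k - Y l)\<^sup>2"
    proof -
      have "0 \<le> \<tau> * (\<bar>X i - X j\<bar> - \<tau>' * \<bar>Y k - Y l\<bar>)\<^sup>2" using \<tau> by simp
      also have "\<dots> = \<tau> * \<bar>X i - X j\<bar>\<^sup>2 - 2 * (\<tau> * \<tau>') * (\<bar>X i - X j\<bar> * \<bar>Y k - Y l\<bar>) + (\<tau> * \<tau>') * \<tau>' * \<bar>Y k - Y l\<bar>\<^sup>2"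
        by (simp add: power2_eq_square algebra_simps)
      finally show ?thesis using \<tau> by simp
    qed
    moreover have "\<tau> * (X i - X j)\<^sup>2 + \<tau>' * (Y k - Y l)\<^sup>2
        \<le> \<tau> * (4 * (\<Sum>k\<in>UNIV. (X k - x)\<^sup>2)) + \<tau>' * (4 * (\<Sum>k\<in>UNIV. (Y k - y)\<^sup>2))"
      using \<tau> by (intro add_mono mult_left_mono diff_square_le_sum_squares) auto
    \<comment> \<open>\<open>32 * M\<close> is the factor 4 of
      \<open>diff_square_le_sum_squares\<close> times the \<open>8 * M\<close> from the
      segments.\<close>
    ultimately have "2 * (\<bar>X i - X j\<bar> * \<bar>Y k - Y l\<bar>) / (32 * M) \<le> (\<Sum>i\<in>UNIV. bellman q r (X i) (Y i)) - M * bellman q r x y"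
      using M by (simp add: field_simps)
    then have "\<bar>X i - X j\<bar> * \<bar>Y k - Y l\<bar> \<le> 16 * M * ((\<Sum>i\<in>UNIV. bellman q r (X i) (Y i)) - M * bellman q r x y)"
      using M by (simp add: field_simps)
    also have "\<dots> = 16 * M\<^sup>2 * ((\<Sum>i\<in>UNIV. bellman q r (X i) (Y i)) / M - bellman q r x y)"
      using M by (simp add: field_simps power2_eq_square)
    finally show "\<bar>X i - X j\<bar> * \<bar>Y k - Y l\<bar> \<le> \<dots>" .
  qed
qed

section \<open>Smooth functions with compact support\<close>

text \<open>There is no division by \<open>2 * h\<close>: the bilinear estimates are then uniform in
  \<open>h\<close>, and powers of \<open>h\<close> appear only in comparisons with
  derivatives.\<close>

definition cdiff :: "real \<Rightarrow> 'n::finite \<Rightarrow> (real^'n \<Rightarrow> 'b::real_normed_vector) \<Rightarrow> real^'n \<Rightarrow> 'b"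
  where "cdiff h k f x = f (x + h *\<^sub>R axis k 1) - f (x - h *\<^sub>R axis k 1)"

lemma partial_deriv_along:
  fixes f :: "real^'n::finite \<Rightarrow> real"
  assumes "\<And>x. f differentiable (at x)"
  shows "((\<lambda>s. f (x + s *\<^sub>R axis k 1)) has_real_derivative partial_deriv k f (x + s *\<^sub>R axis k 1)) (at s)"
proof -
  let ?D = "frechet_derivative f (at (x + s *\<^sub>R axis k 1))"
  have D: "(f has_derivative ?D) (at (x + s *\<^sub>R axis k 1))"
    using assms frechet_derivative_works by blast
  have "((\<lambda>s. x + s *\<^sub>R axis k 1) has_derivative (\<lambda>s. s *\<^sub>R axis k 1)) (at s)"
    by (auto intro!: derivative_eq_intros)
  from diff_chain_at[OF this D]
  have "((\<lambda>s. f (x + s *\<^sub>R axis k 1)) has_derivative (\<lambda>s. ?D (s *\<^sub>R axis k 1))) (at s)"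
    by (simp add: o_def)
  moreover have "?D (t *\<^sub>R axis k 1) = t * ?D (axis k 1)" for t
    using linear_frechet_derivative[OF assms] by (simp add: linear_cmul)
  ultimately show ?thesis
    by (simp add: has_field_derivative_def partial_deriv_def mult_commute_abs)
qed

lemma partial_deriv_bounded_linear:
  assumes "bounded_linear L" "f differentiable (at x)"
  shows "partial_deriv k (\<lambda>x. L (f x)) x = L (partial_deriv k f x)"
proof -
  have "(f has_derivative frechet_derivative f (at x)) (at x)"
    using assms frechet_derivative_works by blast
  from bounded_linear.has_derivative[OF assms(1) this]
  show ?thesis unfolding partial_deriv_def by (simp add: frechet_derivative_at[symmetric])
qed

lemma partial_deriv_add:
  assumes "f differentiable (at x)" "g differentiable (at x)"
  shows "partial_deriv k (\<lambda>x. f x + g x) x = partial_deriv k f x + partial_deriv k g x"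
proof -
  have "(f has_derivative frechet_derivative f (at x)) (at x)" "(g has_derivative frechet_derivative g (at x)) (at x)"
    using assms frechet_derivative_works by blast+
  from has_derivative_add[OF this]
  show ?thesis unfolding partial_deriv_def by (simp add: frechet_derivative_at[symmetric])
qed

lemma times_diffble_bounded_linear:
  assumes "bounded_linear L" "times_diffble m f"
  shows "times_diffble m (\<lambda>x. L (f x))"
  using assms(2)
proof (induction m arbitrary: f)
  case (Suc m)
  then have d: "f differentiable (at x)" for x by auto
  have "partial_deriv k (\<lambda>x. L (f x)) = (\<lambda>x. L (partial_deriv k f x))" for k
    by (rule ext) (rule partial_deriv_bounded_linear[OF assms(1) d])
  moreover have "(\<lambda>x. L (f x)) differentiable (at x)" for x
    using bounded_linear.has_derivative[OF assms(1)] d unfolding differentiable_def by blast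
  ultimately show ?case using Suc by simp
qed simp

lemma times_diffble_add:
  assumes "times_diffble m f" "times_diffble m g"
  shows "times_diffble m (\<lambda>x. f x + g x)"
  using assms
proof (induction m arbitrary: f g)
  case (Suc m)
  then have d: "f differentiable (at x)" "g differentiable (at x)" for x by auto
  have "partial_deriv k (\<lambda>x. f x + g x) = (\<lambda>x. partial_deriv k f x + partial_deriv k g x)" for k
    by (rule ext) (rule partial_deriv_add[OF d])
  then show ?case using Suc d by (simp add: differentiable_add)
qed simp

lemma Cc_differentiable: "f \<in> Cc_infinity \<Longrightarrow> f differentiable (at x)"
  unfolding Cc_infinity_def using times_diffble.simps(2) by blast

lemma compact_closure_subset:
  "compact (closure S) \<Longrightarrow> T \<subseteq> closure S \<Longrightarrow> compact (closure (T :: 'a::heine_borel set))"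
  using bounded_subset[of "closure S" T] by (simp add: compact_closure compact_imp_bounded)

lemma Cc_bounded_linear:
  assumes "bounded_linear L" "f \<in> Cc_infinity"
  shows "(\<lambda>x. L (f x)) \<in> Cc_infinity"
proof -
  have "{x. L (f x) \<noteq> 0} \<subseteq> closure {x. f x \<noteq> 0}"
    using linear_0[OF bounded_linear.linear[OF assms(1)]] closure_subset by fastforce
  then show ?thesis using assms times_diffble_bounded_linear compact_closure_subset
    unfolding Cc_infinity_def by blast
qed

lemma Cc_add:
  assumes "f \<in> Cc_infinity" "g \<in> Cc_infinity"
  shows "(\<lambda>x. f x + g x) \<in> Cc_infinity"
proof -
  have "{x. f x + g x \<noteq> 0} \<subseteq> closure ({x. f x \<noteq> 0} \<union> {x. g x \<noteq> 0})"
    by (rule order_trans[OF _ closure_subset]) auto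
  moreover have "compact (closure ({x. f x \<noteq> 0} \<union> {x. g x \<noteq> 0}))"
    using assms by (auto simp: Cc_infinity_def closure_Un)
  ultimately have "compact (closure {x. f x + g x \<noteq> 0})" using compact_closure_subset by blast
  then show ?thesis using assms times_diffble_add unfolding Cc_infinity_def by blast
qed

lemma Cc_partial_deriv:
  assumes "f \<in> Cc_infinity"
  shows "partial_deriv k f \<in> Cc_infinity"
proof -
  have "partial_deriv k f x = 0" if "x \<notin> closure {x. f x \<noteq> 0}" for x
  proof -
    have "\<forall>\<^sub>F y in nhds x. f y = 0"
      using that unfolding eventually_nhds
      by (intro exI[of _ "- closure {x. f x \<noteq> 0}"]) (use closure_subset[of "{x. f x \<noteq> 0}"] in auto)
    then have "eventually (\<lambda>y. f y = 0) (at x)" "f x = 0"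
      by (auto simp: eventually_at_filter elim: eventually_mono dest: eventually_nhds_x_imp_x)
    then have "(f has_derivative (\<lambda>_. 0)) (at x)"
      by (intro has_derivative_transform_eventually[OF has_derivative_const[of 0]]) auto
    then show ?thesis unfolding partial_deriv_def by (simp add: frechet_derivative_at[symmetric])
  qed
  then have "{x. partial_deriv k f x \<noteq> 0} \<subseteq> closure {x. f x \<noteq> 0}" by blast
  moreover have "times_diffble m (partial_deriv k f)" for m
    using assms times_diffble.simps(2)[of m f] unfolding Cc_infinity_def by blast
  ultimately show ?thesis using assms compact_closure_subset unfolding Cc_infinity_def by blast
qed

lemma Cc_zero: "((\<lambda>_. 0) :: real^'n::finite \<Rightarrow> 'b::real_normed_vector) \<in> Cc_infinity"
proof -
  have "times_diffble m (\<lambda>_::real^'n. 0::'b)" for m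
  proof (induction m)
    case (Suc m)
    have "partial_deriv k (\<lambda>_::real^'n. 0::'b) = (\<lambda>_. 0)" for k
      by (simp add: partial_deriv_def fun_eq_iff)
    with Suc show ?case by simp
  qed simp
  then show ?thesis by (simp add: Cc_infinity_def)
qed

lemma Cc_sum:
  assumes "\<And>i. i \<in> I \<Longrightarrow> f i \<in> Cc_infinity"
  shows "(\<lambda>x. \<Sum>i\<in>I. f i x) \<in> Cc_infinity"
  using assms by (induction I rule: infinite_finite_induct) (auto simp: Cc_zero Cc_add)

lemma partial_deriv_sum:
  assumes "\<And>i. i \<in> I \<Longrightarrow> f i \<in> Cc_infinity"
  shows "partial_deriv k (\<lambda>x. \<Sum>i\<in>I. f i x) x = (\<Sum>i\<in>I. partial_deriv k (f i) x)"
  using assms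
proof (induction I rule: infinite_finite_induct)
  case (insert i I)
  have "(\<lambda>x. \<Sum>i\<in>I. f i x) \<in> Cc_infinity" using insert by (intro Cc_sum) auto
  with insert show ?case by (simp add: partial_deriv_add Cc_differentiable)
qed (auto simp: partial_deriv_def)

text \<open>Unlike \<open>Cc_infinity\<close>, this class is closed under composition with
  continuous maps that fix 0. It contains the powers of norms and the test function of the final
  duality argument, which need not be smooth.\<close>

definition ccont :: "('a::real_normed_vector \<Rightarrow> 'b::real_normed_vector) \<Rightarrow> bool"
  where "ccont f \<longleftrightarrow> continuous_on UNIV f \<and> (\<exists>R. \<forall>x. R < norm x \<longrightarrow> f x = 0)"

lemma Cc_ccont:
  assumes "f \<in> Cc_infinity"
  shows "ccont f"
proof -
  have "continuous_on UNIV f"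
    using Cc_differentiable[OF assms] differentiable_imp_continuous_within
    by (auto intro!: continuous_at_imp_continuous_on)
  moreover obtain R where "\<And>x. x \<in> closure {x. f x \<noteq> 0} \<Longrightarrow> norm x \<le> R"
  proof -
    have "bounded (closure {x. f x \<noteq> 0})"
      using assms by (simp add: Cc_infinity_def compact_imp_bounded)
    then show ?thesis using that unfolding bounded_iff by meson
  qed
  then have "\<forall>x. R < norm x \<longrightarrow> f x = 0"
    using subsetD[OF closure_subset[of "{x. f x \<noteq> 0}"]] by (metis linorder_not_less mem_Collect_eq)
  ultimately show ?thesis unfolding ccont_def by blast
qed

lemma ccont_compose:
  assumes "ccont f" "continuous_on UNIV g" "g 0 = 0"
  shows "ccont (\<lambda>x. g (f x))"
  using assms continuous_on_compose2[OF assms(2), of UNIV f] unfolding ccont_def by (metis subset_UNIV)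

lemma ccont_bounded:
  fixes f :: "'a::euclidean_space \<Rightarrow> 'b::real_normed_vector"
  assumes "ccont f"
  obtains C where "\<And>x. norm (f x) \<le> C" "0 \<le> C"
proof -
  obtain R where R: "\<And>x. R < norm x \<Longrightarrow> f x = 0" and c: "continuous_on UNIV f"
    using assms unfolding ccont_def by blast
  have "compact (f ` cball 0 R)"
    by (intro compact_continuous_image continuous_on_subset[OF c]) auto
  then obtain C where C: "\<And>y. y \<in> f ` cball 0 R \<Longrightarrow> norm y \<le> C"
    using compact_imp_bounded bounded_iff by metis
  have "norm (f x) \<le> max C 0" for x
    using C[of "f x"] R[of x] by (cases "norm x \<le> R") (auto simp: le_max_iff_disj)
  then show ?thesis using that[of "max C 0"] by simp
qed

lemma ccont_uniform:
  fixes f :: "'a::euclidean_space \<Rightarrow> 'b::real_normed_vector"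
  assumes "ccont f" "0 < e"
  obtains d where "0 < d" "\<And>x y. norm (x - y) < d \<Longrightarrow> norm (f x - f y) < e"
proof -
  obtain R where R: "\<And>x. R < norm x \<Longrightarrow> f x = 0" and c: "continuous_on UNIV f"
    using assms unfolding ccont_def by blast
  \<comment> \<open>The margin 1 has this purpose: if two points are closer than 1 and one of them
    leaves the larger ball, then both lie where \<open>f\<close> vanishes.\<close>
  have "uniformly_continuous_on (cball 0 (R + 1)) f"
    by (intro compact_uniformly_continuous continuous_on_subset[OF c]) auto
  then obtain d where d: "d > 0" "\<And>x y. x \<in> cball 0 (R + 1) \<Longrightarrow> y \<in> cball 0 (R + 1) \<Longrightarrow> dist y x < d \<Longrightarrow> dist (f y) (f x) < e"
    using assms(2) unfolding uniformly_continuous_on_def by meson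
  have "norm (f x - f y) < e" if "norm (x - y) < min d 1" for x y
  proof (cases "norm x \<le> R + 1 \<and> norm y \<le> R + 1")
    case True
    then show ?thesis using d(2)[of y x] that by (auto simp: dist_norm)
  next
    case False
    moreover have "norm x \<le> norm y + norm (x - y)" "norm y \<le> norm x + norm (x - y)"
      using norm_triangle_ineq[of y "x - y"] norm_triangle_ineq[of x "y - x"] by (auto simp: norm_minus_commute)
    ultimately have "norm x > R" "norm y > R" using that by auto
    then show ?thesis using R assms(2) by simp
  qed
  then show ?thesis using that[of "min d 1"] d by auto
qed

lemma ccont_integrable:
  fixes f :: "'a::euclidean_space \<Rightarrow> 'b::{banach, second_countable_topology}"
  assumes "ccont f"
  shows "integrable lborel f"
proof -
  obtain R where R: "\<And>x. R < norm x \<Longrightarrow> f x = 0" and c: "continuous_on UNIV f"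
    using assms unfolding ccont_def by blast
  have "integrable lborel (\<lambda>x. indicator (cball 0 R) x *\<^sub>R f x)"
    by (intro borel_integrable_compact continuous_on_subset[OF c]) auto
  also have "(\<lambda>x. indicator (cball 0 R) x *\<^sub>R f x) = f"
    using R by (auto simp: fun_eq_iff indicator_def)
  finally show ?thesis .
qed

lemma ccont_powr_integrable:
  fixes f :: "'a::euclidean_space \<Rightarrow> 'b::{banach, second_countable_topology}"
  assumes "ccont f" "0 < s"
  shows "integrable lborel (\<lambda>x. norm (f x) powr s)"
proof (rule ccont_integrable)
  have "continuous_on UNIV (\<lambda>y::'b. norm y powr s)"
    using assms by (intro continuous_on_powr') (auto intro!: continuous_intros)
  from ccont_compose[OF assms(1) this] show "ccont (\<lambda>x. norm (f x) powr s)" by simp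
qed

lemma ccont_measurable: "ccont f \<Longrightarrow> f \<in> borel_measurable borel"
  by (auto simp: ccont_def intro: borel_measurable_continuous_onI)

section \<open>Central differences compared with derivatives\<close>

lemma cdiff_approx:
  fixes f :: "real^'n::finite \<Rightarrow> real"
  assumes f: "f \<in> Cc_infinity" and e: "0 < e"
  obtains d where "0 < d" "\<And>h x. 0 < h \<Longrightarrow> h < d \<Longrightarrow> \<bar>cdiff h k f x - 2 * h * partial_deriv k f x\<bar> \<le> e * h"
proof -
  obtain d where d: "0 < d" "\<And>x y. norm (x - y) < d \<Longrightarrow> norm (partial_deriv k f x - partial_deriv k f y) < e / 2"
    using ccont_uniform[OF Cc_ccont[OF Cc_partial_deriv[OF f]], of "e / 2" k] e by auto
  have "\<bar>cdiff h k f x - 2 * h * partial_deriv k f x\<bar> \<le> e * h" if h: "0 < h" "h < d" for h x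
  proof -
    note D = partial_deriv_along[OF Cc_differentiable[OF f], of x k]
    have "\<exists>z. z > -h \<and> z < h \<and> f (x + h *\<^sub>R axis k 1) - f (x + (-h) *\<^sub>R axis k 1)
        = (h - (-h)) * partial_deriv k f (x + z *\<^sub>R axis k 1)"
      by (rule MVT2) (use h D in auto)
    then obtain z where z: "-h < z" "z < h" "cdiff h k f x = 2 * h * partial_deriv k f (x + z *\<^sub>R axis k 1)"
      by (auto simp: cdiff_def)
    have "norm (partial_deriv k f (x + z *\<^sub>R axis k 1) - partial_deriv k f x) < e / 2"
      using z h by (intro d) auto
    then have "2 * h * \<bar>partial_deriv k f (x + z *\<^sub>R axis k 1) - partial_deriv k f x\<bar> \<le> 2 * h * (e / 2)"
      using h by (intro mult_left_mono) auto
    moreover have "\<bar>cdiff h k f x - 2 * h * partial_deriv k f x\<bar> = 2 * h * \<bar>partial_deriv k f (x + z *\<^sub>R axis k 1) - partial_deriv k f x\<bar>"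
      using h unfolding z(3) right_diff_distrib[symmetric] abs_mult by simp
    ultimately show ?thesis by (simp add: mult.commute)
  qed
  then show ?thesis using that d by blast
qed

text \<open>The mean value theorem removes the outer difference, after which
  \<open>cdiff_approx\<close> for \<open>partial_deriv i f\<close> and uniform continuity finish,
  uniformly in \<open>x\<close>. The derivatives come out in the order \<open>j\<close> after
  \<open>i\<close>; exchanging the roles of \<open>i\<close> and \<open>j\<close> will give the
  symmetry of mixed derivatives.\<close>

lemma cdiff_cdiff_approx:
  fixes f :: "real^'n::finite \<Rightarrow> real"
  assumes f: "f \<in> Cc_infinity" and e: "0 < e"
  obtains d where "0 < d" "\<And>h x. 0 < h \<Longrightarrow> h < d \<Longrightarrow>
    \<bar>cdiff h i (cdiff h j f) x - 4 * h\<^sup>2 * partial_deriv j (partial_deriv i f) x\<bar> \<le> e * h\<^sup>2"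
proof -
  let ?g = "partial_deriv i f"
  let ?u = "partial_deriv j ?g"
  have g: "?g \<in> Cc_infinity" by (rule Cc_partial_deriv[OF f])
  obtain d1 where d1: "0 < d1" "\<And>x y. norm (x - y) < d1 \<Longrightarrow> norm (?u x - ?u y) < e / 8"
    using ccont_uniform[OF Cc_ccont[OF Cc_partial_deriv[OF g]], of "e / 8" j] e by auto
  obtain d2 where d2: "0 < d2" "\<And>h x. 0 < h \<Longrightarrow> h < d2 \<Longrightarrow> \<bar>cdiff h j ?g x - 2 * h * ?u x\<bar> \<le> e / 4 * h"
    using cdiff_approx[OF g, of "e / 4" j] e by auto
  have "\<bar>cdiff h i (cdiff h j f) x - 4 * h\<^sup>2 * ?u x\<bar> \<le> e * h\<^sup>2" if h: "0 < h" "h < min d1 d2" for h x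
  proof -
    note D = partial_deriv_along[OF Cc_differentiable[OF f], of _ i]
    have D2: "((\<lambda>s. cdiff h j f (x + s *\<^sub>R axis i 1)) has_real_derivative cdiff h j ?g (x + s *\<^sub>R axis i 1)) (at s)" for s
      using DERIV_diff[OF D[of "x + h *\<^sub>R axis j 1" s] D[of "x - h *\<^sub>R axis j 1" s]]
      by (simp add: cdiff_def algebra_simps)
    have "\<exists>z. z > -h \<and> z < h \<and> cdiff h j f (x + h *\<^sub>R axis i 1) - cdiff h j f (x + (-h) *\<^sub>R axis i 1)
        = (h - (-h)) * cdiff h j ?g (x + z *\<^sub>R axis i 1)"
      by (rule MVT2) (use h D2 in auto)
    then obtain z where z: "-h < z" "z < h" "cdiff h i (cdiff h j f) x = 2 * h * cdiff h j ?g (x + z *\<^sub>R axis i 1)"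
      by (auto simp: cdiff_def[of h i])
    let ?y = "x + z *\<^sub>R axis i 1"
    have "norm (?u ?y - ?u x) < e / 8" using z h by (intro d1) auto
    then have "2 * h * \<bar>?u ?y - ?u x\<bar> \<le> 2 * h * (e / 8)"
      using h by (intro mult_left_mono) auto
    moreover have "\<bar>2 * h * ?u ?y - 2 * h * ?u x\<bar> = 2 * h * \<bar>?u ?y - ?u x\<bar>"
      using h by (simp add: right_diff_distrib[symmetric] abs_mult)
    moreover have "\<bar>cdiff h j ?g ?y - 2 * h * ?u ?y\<bar> \<le> e / 4 * h" using d2 h by auto
    moreover have "2 * h * (e / 8) = e / 4 * h" "e / 4 * h + e / 4 * h = e / 2 * h" by simp_all
    ultimately have "\<bar>cdiff h j ?g ?y - 2 * h * ?u x\<bar> \<le> e / 2 * h" by linarith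
    then have "2 * h * \<bar>cdiff h j ?g ?y - 2 * h * ?u x\<bar> \<le> 2 * h * (e / 2 * h)"
      using h by (intro mult_left_mono) auto
    moreover have "\<bar>cdiff h i (cdiff h j f) x - 4 * h\<^sup>2 * ?u x\<bar> = \<bar>2 * h * (cdiff h j ?g ?y - 2 * h * ?u x)\<bar>"
      unfolding z(3) by (simp add: algebra_simps power2_eq_square)
    moreover have "\<bar>2 * h * (cdiff h j ?g ?y - 2 * h * ?u x)\<bar> = 2 * h * \<bar>cdiff h j ?g ?y - 2 * h * ?u x\<bar>"
      using h by (simp add: abs_mult)
    moreover have "2 * h * (e / 2 * h) = e * h\<^sup>2" by (simp add: power2_eq_square)
    ultimately show ?thesis by linarith
  qed
  then show ?thesis using that[of "min d1 d2"] d1 d2 by auto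
qed

section \<open>The trace of the incompatibility tensor\<close>

lemma vec_curl_nth:
  "vec_curl v x $ 1 = partial_deriv 2 (\<lambda>y. v y $ 3) x - partial_deriv 3 (\<lambda>y. v y $ 2) x"
  "vec_curl v x $ 2 = partial_deriv 3 (\<lambda>y. v y $ 1) x - partial_deriv 1 (\<lambda>y. v y $ 3) x"
  "vec_curl v x $ 3 = partial_deriv 1 (\<lambda>y. v y $ 2) x - partial_deriv 2 (\<lambda>y. v y $ 1) x"
  by (simp_all add: vec_curl_def)

lemma Cc_entry:
  fixes P :: "real^'n::finite \<Rightarrow> real^'m^'l"
  assumes "P \<in> Cc_infinity"
  shows "(\<lambda>x. P x $ i $ j) \<in> Cc_infinity"
  using Cc_bounded_linear[OF bounded_linear_compose[OF bounded_linear_vec_nth bounded_linear_vec_nth] assms] .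

lemma Cc_uminus: "f \<in> Cc_infinity \<Longrightarrow> (\<lambda>x. - f x) \<in> Cc_infinity"
  by (rule Cc_bounded_linear[OF bounded_linear_minus[OF bounded_linear_ident]])

lemma Cc_diff: "f \<in> Cc_infinity \<Longrightarrow> g \<in> Cc_infinity \<Longrightarrow> (\<lambda>x. f x - g x) \<in> Cc_infinity"
  using Cc_add[OF _ Cc_uminus, of f g] by simp

lemma Cc_scale: "f \<in> Cc_infinity \<Longrightarrow> (\<lambda>x. c *\<^sub>R f x) \<in> Cc_infinity"
  by (rule Cc_bounded_linear[OF bounded_linear_scaleR_right])

lemma partial_deriv_diff:
  assumes "f \<in> Cc_infinity" "g \<in> Cc_infinity"
  shows "partial_deriv k (\<lambda>x. f x - g x) x = partial_deriv k f x - partial_deriv k g x"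
  using partial_deriv_add[OF Cc_differentiable[OF assms(1)] Cc_differentiable[OF Cc_uminus[OF assms(2)]], of k x]
    partial_deriv_bounded_linear[OF bounded_linear_minus[OF bounded_linear_ident] Cc_differentiable[OF assms(2)], of k x]
  by simp

text \<open>This is the Laplacian of the trace minus the double divergence. The terms with
  \<open>a = b\<close> cancel, and the other twelve are the four second derivatives in each of the
  three diagonal entries, already in matching order, so mixed derivatives need not be
  interchanged.\<close>

lemma trace_inc:
  fixes P :: "real^3 \<Rightarrow> real^3^3"
  assumes "P \<in> Cc_infinity"
  shows "trace (inc P x) =
    (\<Sum>a\<in>UNIV. \<Sum>b\<in>UNIV. partial_deriv a (partial_deriv a (\<lambda>y. P y $ b $ b)) x
       - partial_deriv a (partial_deriv b (\<lambda>y. P y $ b $ a)) x)"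
proof -
  note E = Cc_entry[OF assms]
  note PE = Cc_partial_deriv[OF E]
  have diag: "inc P x $ l $ l = vec_curl (\<lambda>y. \<chi> b. vec_curl (\<lambda>z. P z $ b) y $ l) x $ l" for l
    by (simp add: inc_def Curl_def transpose_def)
  have 1: "inc P x $ 1 $ 1 = partial_deriv 2 (partial_deriv 2 (\<lambda>y. P y $ 3 $ 3)) x
      - partial_deriv 2 (partial_deriv 3 (\<lambda>y. P y $ 3 $ 2)) x
      - (partial_deriv 3 (partial_deriv 2 (\<lambda>y. P y $ 2 $ 3)) x
      - partial_deriv 3 (partial_deriv 3 (\<lambda>y. P y $ 2 $ 2)) x)"
    unfolding diag vec_curl_nth vec_lambda_beta by (subst (1 2) partial_deriv_diff; (intro PE refl)?)
  have 2: "inc P x $ 2 $ 2 = partial_deriv 3 (partial_deriv 3 (\<lambda>y. P y $ 1 $ 1)) x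
      - partial_deriv 3 (partial_deriv 1 (\<lambda>y. P y $ 1 $ 3)) x
      - (partial_deriv 1 (partial_deriv 3 (\<lambda>y. P y $ 3 $ 1)) x
      - partial_deriv 1 (partial_deriv 1 (\<lambda>y. P y $ 3 $ 3)) x)"
    unfolding diag vec_curl_nth vec_lambda_beta by (subst (1 2) partial_deriv_diff; (intro PE refl)?)
  have 3: "inc P x $ 3 $ 3 = partial_deriv 1 (partial_deriv 1 (\<lambda>y. P y $ 2 $ 2)) x
      - partial_deriv 1 (partial_deriv 2 (\<lambda>y. P y $ 2 $ 1)) x
      - (partial_deriv 2 (partial_deriv 1 (\<lambda>y. P y $ 1 $ 2)) x
      - partial_deriv 2 (partial_deriv 2 (\<lambda>y. P y $ 1 $ 1)) x)"
    unfolding diag vec_curl_nth vec_lambda_beta by (subst (1 2) partial_deriv_diff; (intro PE refl)?)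
  show ?thesis
    unfolding trace_def sum_3 1 2 3 by simp
qed

section \<open>Neighbour means and the bilinear embedding\<close>

text \<open>Indexing the neighbours by the finite type \<open>'n \<times> bool\<close> makes their
  mean an instance of \<open>bellman_mean\<close>, and the reversal of a direction a flip of the
  second component.\<close>

definition unit_dir :: "'n::finite \<times> bool \<Rightarrow> real^'n"
  where "unit_dir i = (if snd i then axis (fst i) 1 else - axis (fst i) 1)"

definition shift_mean :: "real \<Rightarrow> (real^'n::finite \<Rightarrow> real) \<Rightarrow> real^'n \<Rightarrow> real"
  where "shift_mean h f x = (\<Sum>i\<in>UNIV. f (x + h *\<^sub>R unit_dir i)) / CARD('n \<times> bool)"

abbreviation mean_pow :: "real \<Rightarrow> nat \<Rightarrow> (real^'n::finite \<Rightarrow> real) \<Rightarrow> real^'n \<Rightarrow> real"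
  where "mean_pow h n f \<equiv> (shift_mean h ^^ n) f"

lemma cdiff_unit_dir: "cdiff h k f x = f (x + h *\<^sub>R unit_dir (k, True)) - f (x + h *\<^sub>R unit_dir (k, False))"
  by (simp add: cdiff_def unit_dir_def)

lemma unit_dir_uminus: "unit_dir (fst i, \<not> snd i) = - unit_dir i"
  by (simp add: unit_dir_def)

lemma integrable_translate:
  fixes f :: "'a::euclidean_space \<Rightarrow> 'b::{banach, second_countable_topology}"
  assumes "integrable lborel f"
  shows "integrable lborel (\<lambda>x. f (x + a))"
proof -
  have "integrable (distr lborel borel ((+) a)) f"
    using assms by (simp add: lborel_distr_plus)
  then show ?thesis by (subst (asm) integrable_distr_eq) (use assms in \<open>auto simp: add.commute\<close>)
qed

lemma integral_translate:
  fixes f :: "'a::euclidean_space \<Rightarrow> 'b::{banach, second_countable_topology}"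
  assumes "f \<in> borel_measurable borel"
  shows "integral\<^sup>L lborel (\<lambda>x. f (x + a)) = integral\<^sup>L lborel f"
proof -
  have "integral\<^sup>L lborel f = integral\<^sup>L (distr lborel borel ((+) a)) f"
    by (simp add: lborel_distr_plus)
  also have "\<dots> = integral\<^sup>L lborel (\<lambda>x. f (a + x))"
    by (subst integral_distr) (use assms in auto)
  finally show ?thesis by (simp add: add.commute)
qed

lemma shift_mean_measurable[measurable]:
  assumes [measurable]: "f \<in> borel_measurable borel"
  shows "shift_mean h f \<in> borel_measurable borel"
  unfolding shift_mean_def[abs_def] by measurable

lemma mean_pow_measurable[measurable]:
  "f \<in> borel_measurable borel \<Longrightarrow> mean_pow h n f \<in> borel_measurable borel"
  by (induction n) auto

lemma cdiff_measurable[measurable]: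
  fixes f :: "real^'n::finite \<Rightarrow> real"
  assumes [measurable]: "f \<in> borel_measurable borel"
  shows "cdiff h k f \<in> borel_measurable borel"
  unfolding cdiff_def[abs_def] by measurable

lemma shift_mean_add: "shift_mean h (\<lambda>x. f x + g x) = (\<lambda>x. shift_mean h f x + shift_mean h g x)"
  by (simp add: shift_mean_def fun_eq_iff sum.distrib add_divide_distrib)

lemma shift_mean_cmult: "shift_mean h (\<lambda>x. c * f x) = (\<lambda>x. c * shift_mean h f x)"
  by (simp add: shift_mean_def fun_eq_iff sum_distrib_left)

lemma mean_pow_add: "mean_pow h n (\<lambda>x. f x + g x) = (\<lambda>x. mean_pow h n f x + mean_pow h n g x)"
  by (induction n) (auto simp: shift_mean_add)

lemma mean_pow_cmult: "mean_pow h n (\<lambda>x. c * f x) = (\<lambda>x. c * mean_pow h n f x)"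
  by (induction n) (auto simp: shift_mean_cmult)

lemma mean_pow_diff: "mean_pow h n (\<lambda>x. f x - g x) = (\<lambda>x. mean_pow h n f x - mean_pow h n g x)"
  using mean_pow_add[of n h f "\<lambda>x. (-1) * g x"] unfolding mean_pow_cmult by simp

lemma mean_pow_sum: "mean_pow h n (\<lambda>x. \<Sum>j\<in>J. f j x) = (\<lambda>x. \<Sum>j\<in>J. mean_pow h n (f j) x)"
proof (induction J rule: infinite_finite_induct)
  case (insert j J)
  then show ?case by (simp add: mean_pow_add)
qed (use mean_pow_cmult[of n h 0 "\<lambda>_. 0"] in auto)

lemma shift_mean_cdiff: "shift_mean h (cdiff h' k f) = cdiff h' k (shift_mean h f)"
  by (simp add: shift_mean_def cdiff_def fun_eq_iff sum_subtractf diff_divide_distrib algebra_simps)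

lemma mean_pow_cdiff: "mean_pow h n (cdiff h' k f) = cdiff h' k (mean_pow h n f)"
  by (induction n) (auto simp: shift_mean_cdiff)

lemma shift_mean_nonneg: "(\<And>x. 0 \<le> f x) \<Longrightarrow> 0 \<le> shift_mean h f x"
  by (auto simp: shift_mean_def intro!: divide_nonneg_nonneg sum_nonneg)

lemma mean_pow_nonneg: "(\<And>x. 0 \<le> f x) \<Longrightarrow> 0 \<le> mean_pow h n f x"
  by (induction n arbitrary: x) (auto intro: shift_mean_nonneg)

lemma shift_mean_abs_le:
  fixes f :: "real^'n::finite \<Rightarrow> real"
  assumes "\<And>x. \<bar>f x\<bar> \<le> C"
  shows "\<bar>shift_mean h f x\<bar> \<le> C"
proof -
  have "\<bar>\<Sum>i\<in>UNIV. f (x + h *\<^sub>R unit_dir (i :: 'n \<times> bool))\<bar> \<le> (\<Sum>i\<in>(UNIV :: ('n \<times> bool) set). C)"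
    by (intro order_trans[OF sum_abs] sum_mono assms)
  then show ?thesis by (simp add: shift_mean_def field_simps del: card_UNIV_bool card_prod)
qed

lemma mean_pow_abs_le: "(\<And>x. \<bar>f x\<bar> \<le> C) \<Longrightarrow> \<bar>mean_pow h n f x\<bar> \<le> C"
  by (induction n arbitrary: x) (auto intro: shift_mean_abs_le)

lemma shift_mean_integrable:
  assumes "integrable lborel f"
  shows "integrable lborel (shift_mean h f)"
  unfolding shift_mean_def[abs_def]
  by (intro integrable_divide Bochner_Integration.integrable_sum integrable_translate assms)

lemma integral_shift_mean:
  assumes "integrable lborel f"
  shows "integral\<^sup>L lborel (shift_mean h f) = integral\<^sup>L lborel f"
  unfolding shift_mean_def[abs_def] using assms
  by (simp add: integrable_translate integral_translate)

lemma mean_pow_integrable: "integrable lborel f \<Longrightarrow> integrable lborel (mean_pow h n f)"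
  by (induction n) (auto intro: shift_mean_integrable)

lemma integral_abs_mean_pow:
  assumes "integrable lborel f"
  shows "(LBINT x. \<bar>mean_pow h n f x\<bar>) \<le> (LBINT x. \<bar>f x\<bar>)"
proof (induction n)
  case (Suc n)
  let ?g = "mean_pow h n f"
  have g: "integrable lborel ?g" by (rule mean_pow_integrable[OF assms])
  have "\<bar>shift_mean h ?g x\<bar> \<le> shift_mean h (\<lambda>x. \<bar>?g x\<bar>) x" for x
    unfolding shift_mean_def by (simp add: divide_right_mono sum_abs)
  then have "(LBINT x. \<bar>shift_mean h ?g x\<bar>) \<le> (LBINT x. shift_mean h (\<lambda>x. \<bar>?g x\<bar>) x)"
    by (intro integral_mono integrable_abs shift_mean_integrable g)
  also have "\<dots> = (LBINT x. \<bar>?g x\<bar>)"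
    by (intro integral_shift_mean integrable_abs g)
  finally show ?case using Suc by simp
qed simp

lemma integrable_bounded_mult:
  fixes f g :: "'a::euclidean_space \<Rightarrow> real"
  assumes "f \<in> borel_measurable borel" "\<And>x. \<bar>f x\<bar> \<le> C" "integrable lborel g"
  shows "integrable lborel (\<lambda>x. f x * g x)"
proof (rule Bochner_Integration.integrable_bound)
  show "integrable lborel (\<lambda>x. C * g x)" using assms by simp
  show "(\<lambda>x. f x * g x) \<in> borel_measurable lborel" using assms by auto
  have "\<bar>f x\<bar> \<le> \<bar>C\<bar>" for x using assms(2)[of x] by linarith
  then show "AE x in lborel. norm (f x * g x) \<le> norm (C * g x)"
    by (auto simp: abs_mult intro!: mult_right_mono)
qed

lemma integral_translate_mult:
  fixes f g :: "'a::euclidean_space \<Rightarrow> real"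
  assumes "f \<in> borel_measurable borel" "g \<in> borel_measurable borel"
  shows "(LBINT x. f (x + a) * g x) = (LBINT x. f x * g (x - a))"
  using integral_translate[of "\<lambda>x. f x * g (x - a)" a] assms by simp

lemma shift_mean_self_adjoint:
  assumes f: "f \<in> borel_measurable borel" "\<And>x. \<bar>f x\<bar> \<le> C" and g: "integrable lborel g"
  shows "(LBINT x. shift_mean h f x * g x) = (LBINT x. f x * shift_mean h g x)"
proof -
  let ?M = "real CARD('a \<times> bool)"
  have gm: "g \<in> borel_measurable borel" using g by auto
  have "(LBINT x. shift_mean h f x * g x)
      = (\<Sum>i\<in>UNIV. LBINT x. f (x + h *\<^sub>R unit_dir (i :: 'a \<times> bool)) * g x) / ?M"
  proof -
    have "integrable lborel (\<lambda>x. f (x + h *\<^sub>R unit_dir i) * g x)" for i :: "'a \<times> bool"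
      using f by (intro integrable_bounded_mult[OF _ _ g, where C = C]) auto
    then show ?thesis
      unfolding shift_mean_def times_divide_eq_left sum_distrib_right by simp
  qed
  also have "\<dots> = (\<Sum>i\<in>UNIV. LBINT x. f x * g (x + h *\<^sub>R unit_dir (fst i, \<not> snd (i :: 'a \<times> bool)))) / ?M"
    using f gm by (simp add: integral_translate_mult unit_dir_uminus)
  \<comment> \<open>Passing to the opposite neighbour permutes the summands.\<close>
  also have "\<dots> = (\<Sum>i\<in>UNIV. LBINT x. f x * g (x + h *\<^sub>R unit_dir (i :: 'a \<times> bool))) / ?M"
  proof -
    have "bij (\<lambda>i :: 'a \<times> bool. (fst i, \<not> snd i))"
      by (rule bij_betw_byWitness[where f' = "\<lambda>i. (fst i, \<not> snd i)"]) auto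
    from sum.reindex_bij_betw[OF this, of "\<lambda>i. LBINT x. f x * g (x + h *\<^sub>R unit_dir i)"]
    show ?thesis by simp
  qed
  also have "\<dots> = (LBINT x. f x * shift_mean h g x)"
  proof -
    have "integrable lborel (\<lambda>x. f x * g (x + h *\<^sub>R unit_dir i))" for i :: "'a \<times> bool"
      using f g by (intro integrable_bounded_mult[where C = C] integrable_translate) auto
    then show ?thesis
      unfolding shift_mean_def times_divide_eq_right sum_distrib_left by simp
  qed
  finally show ?thesis .
qed

text \<open>One factor is bounded and the other integrable because the differences will act on a
  field containing a ray potential, which is bounded but need not have compact support.\<close>

lemma cdiff_skew_adjoint:
  fixes f g :: "real^'n::finite \<Rightarrow> real"
  assumes f: "f \<in> borel_measurable borel" "\<And>x. \<bar>f x\<bar> \<le> C" and g: "integrable lborel g"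
  shows "(LBINT x. cdiff h k f x * g x) = - (LBINT x. f x * cdiff h k g x)"
proof -
  have gm: "g \<in> borel_measurable borel" using g by auto
  have *: "integrable lborel (\<lambda>x. f (x + a) * g x)" "integrable lborel (\<lambda>x. f x * g (x + a))" for a
    using f g by (auto intro!: integrable_bounded_mult[where C = C] integrable_translate)
  have **: "(LBINT x. f (x + a) * g x) = (LBINT x. f x * g (x + (- a)))" for a
    using integral_translate_mult[OF f(1) gm, of a] by simp
  let ?a = "h *\<^sub>R axis k (1::real) :: real^'n"
  have "(LBINT x. cdiff h k f x * g x) = (LBINT x. f (x + ?a) * g x - f (x + (- ?a)) * g x)"
    by (simp add: cdiff_def algebra_simps)
  also have "\<dots> = (LBINT x. f x * g (x + (- ?a))) - (LBINT x. f x * g (x + ?a))"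
    by (subst Bochner_Integration.integral_diff[OF * (1) *(1)]) (simp only: ** minus_minus)
  also have "\<dots> = - (LBINT x. f x * g (x + ?a) - f x * g (x + (- ?a)))"
    by (subst Bochner_Integration.integral_diff[OF * (2) *(2)]) simp
  also have "\<dots> = - (LBINT x. f x * cdiff h k g x)"
    by (simp add: cdiff_def algebra_simps)
  finally show ?thesis .
qed

section \<open>Contraction in \<open>L\<^sup>s\<close> and the bilinear embedding\<close>

lemma shift_mean_powr:
  fixes f :: "real^'n::finite \<Rightarrow> real"
  assumes s: "1 \<le> s" and f: "f \<in> borel_measurable borel" "integrable lborel (\<lambda>x. \<bar>f x\<bar> powr s)"
  shows "integrable lborel (\<lambda>x. \<bar>shift_mean h f x\<bar> powr s)"
    and "(LBINT x. \<bar>shift_mean h f x\<bar> powr s) \<le> (LBINT x. \<bar>f x\<bar> powr s)"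
proof -
  let ?g = "shift_mean h (\<lambda>x. \<bar>f x\<bar> powr s)"
  have le: "\<bar>shift_mean h f x\<bar> powr s \<le> ?g x" for x
  proof -
    have "\<bar>shift_mean h f x\<bar> \<le> shift_mean h (\<lambda>x. \<bar>f x\<bar>) x"
      unfolding shift_mean_def by (simp add: divide_right_mono sum_abs)
    then have "\<bar>shift_mean h f x\<bar> powr s \<le> (shift_mean h (\<lambda>x. \<bar>f x\<bar>) x) powr s"
      using s by (intro powr_mono2) auto
    also have "\<dots> \<le> ?g x"
      unfolding shift_mean_def using s by (intro mean_powr_le) auto
    finally show ?thesis .
  qed
  have g: "integrable lborel ?g" by (rule shift_mean_integrable[OF f(2)])
  show i: "integrable lborel (\<lambda>x. \<bar>shift_mean h f x\<bar> powr s)"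
    by (rule Bochner_Integration.integrable_bound[OF g]) (use f le in \<open>auto intro!: AE_I2 order_trans[OF le]\<close>)
  show "(LBINT x. \<bar>shift_mean h f x\<bar> powr s) \<le> (LBINT x. \<bar>f x\<bar> powr s)"
    using integral_mono[OF i g le] integral_shift_mean[OF f(2), of h] by simp
qed

lemma mean_pow_powr:
  fixes f :: "real^'n::finite \<Rightarrow> real"
  assumes s: "1 \<le> s" and f: "f \<in> borel_measurable borel" "integrable lborel (\<lambda>x. \<bar>f x\<bar> powr s)"
  shows "integrable lborel (\<lambda>x. \<bar>mean_pow h n f x\<bar> powr s)
    \<and> (LBINT x. \<bar>mean_pow h n f x\<bar> powr s) \<le> (LBINT x. \<bar>f x\<bar> powr s)"
proof (induction n)
  case (Suc n)
  then show ?case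
    using shift_mean_powr[OF s mean_pow_measurable[OF f(1)], of n h h] by auto
qed (use f in auto)

text \<open>Averaging preserves the integral of \<open>b n\<close>, so Jensen's gap from
  \<open>bellman_mean\<close> integrates to the decrease from \<open>b n\<close> to
  \<open>b (Suc n)\<close>. The sum telescopes, and the growth bound of \<open>bellman\<close> for
  \<open>b 0\<close> contributes \<open>22 * q\<close>.\<close>

lemma bilinear_embedding_nonneg:
  fixes f g :: "real^'n::finite \<Rightarrow> real"
  assumes q: "2 \<le> q" and r: "r = q / (q - 1)"
    and f: "f \<in> borel_measurable borel" "\<And>x. 0 \<le> f x" "integrable lborel (\<lambda>x. f x powr q)"
    and g: "g \<in> borel_measurable borel" "\<And>x. 0 \<le> g x" "integrable lborel (\<lambda>x. g x powr r)"
  defines "M \<equiv> real CARD('n \<times> bool)"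
  shows "integrable lborel (\<lambda>x. \<bar>cdiff h i (mean_pow h n f) x\<bar> * \<bar>cdiff h j (mean_pow h n g) x\<bar>)" (is "integrable _ (?P n)")
    and "(\<Sum>n<N. LBINT x. \<bar>cdiff h i (mean_pow h n f) x\<bar> * \<bar>cdiff h j (mean_pow h n g) x\<bar>)
      \<le> 16 * M\<^sup>2 * (22 * q) * ((LBINT x. f x powr q) + (LBINT x. g x powr r))"
proof -
  have r1: "1 < r" using q by (auto simp: r field_simps)
  define b where "b n x = bellman q r (mean_pow h n f x) (mean_pow h n g x)" for n x
  have fn: "mean_pow h n f \<in> borel_measurable borel" and gn: "mean_pow h n g \<in> borel_measurable borel" for n
    using f g by (auto intro: mean_pow_measurable)
  note nn = mean_pow_nonneg[of f _ h, OF f(2)] mean_pow_nonneg[of g _ h, OF g(2)]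
  have fi: "integrable lborel (\<lambda>x. mean_pow h n f x powr q)" for n
    using mean_pow_powr[of q f n h] f q nn by simp
  have gi: "integrable lborel (\<lambda>x. mean_pow h n g x powr r)" for n
    using mean_pow_powr[of r g n h] g r1 nn by simp
  have bm: "b n \<in> borel_measurable borel" for n
    using fn gn unfolding b_def[abs_def] bellman_def by measurable
  have bi: "integrable lborel (b n)" for n
    by (rule Bochner_Integration.integrable_bound[OF integrable_mult_right[OF Bochner_Integration.integrable_add[OF fi[of n] gi[of n]], of "22 * q"]])
      (use bm bellman_bounds[OF q nn(1)] q in \<open>auto simp: b_def intro!: AE_I2\<close>)
  have le: "?P n x \<le> 16 * M\<^sup>2 * (shift_mean h (b n) x - b (Suc n) x)" for n x
    unfolding cdiff_unit_dir b_def shift_mean_def[of h "\<lambda>x. bellman q r _ _"] M_def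
    using bellman_mean[OF q r, of "\<lambda>i. mean_pow h n f (x + h *\<^sub>R unit_dir i)" "\<lambda>i. mean_pow h n g (x + h *\<^sub>R unit_dir i)"
        "(i, True)" "(i, False)" "(j, True)" "(j, False)"] nn
    by (simp add: shift_mean_def del: card_UNIV_bool card_prod)
  have mi: "integrable lborel (\<lambda>x. 16 * M\<^sup>2 * (shift_mean h (b n) x - b (Suc n) x))" for n
    by (intro integrable_mult_right Bochner_Integration.integrable_diff shift_mean_integrable bi)
  show Pi: "integrable lborel (?P n)" for n
  proof (rule Bochner_Integration.integrable_bound[OF mi[of n]])
    show "?P n \<in> borel_measurable lborel" using fn gn by simp
    show "AE x in lborel. norm (?P n x) \<le> norm (16 * M\<^sup>2 * (shift_mean h (b n) x - b (Suc n) x))"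
      using order_trans[OF le abs_ge_self] by (intro AE_I2) (simp add: abs_mult)
  qed
  have "(LBINT x. ?P n x) \<le> 16 * M\<^sup>2 * (integral\<^sup>L lborel (b n) - integral\<^sup>L lborel (b (Suc n)))" for n
    using integral_mono[OF Pi[of n] mi[of n] le] bi shift_mean_integrable[OF bi]
    by (simp add: integral_shift_mean)
  then have "(\<Sum>n<N. LBINT x. ?P n x)
      \<le> (\<Sum>n<N. 16 * M\<^sup>2 * (integral\<^sup>L lborel (b n) - integral\<^sup>L lborel (b (Suc n))))"
    by (rule sum_mono)
  also have "\<dots> = 16 * M\<^sup>2 * (integral\<^sup>L lborel (b 0) - integral\<^sup>L lborel (b N))"
    unfolding sum_distrib_left[symmetric] sum_lessThan_telescope'[of "\<lambda>n. integral\<^sup>L lborel (b n)"] ..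
  also have "\<dots> \<le> 16 * M\<^sup>2 * integral\<^sup>L lborel (b 0)"
    using bellman_bounds(1)[OF q nn(1)] by (auto simp: b_def intro!: mult_left_mono Bochner_Integration.integral_nonneg)
  also have "\<dots> \<le> 16 * M\<^sup>2 * (LBINT x. 22 * q * (f x powr q + g x powr r))"
    by (intro mult_left_mono integral_mono[OF bi]) (use f g bellman_bounds(2)[OF q f(2)] in \<open>auto simp: b_def\<close>)
  also have "(LBINT x. 22 * q * (f x powr q + g x powr r))
      = 22 * q * ((LBINT x. f x powr q) + (LBINT x. g x powr r))"
    using f g by simp
  finally show "(\<Sum>n<N. LBINT x. ?P n x) \<le> 16 * M\<^sup>2 * (22 * q) * ((LBINT x. f x powr q) + (LBINT x. g x powr r))"
    by (simp only: mult.assoc)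
qed

text \<open>\<open>bellman_mean\<close> needs nonnegative values, so both functions are split into
  positive and negative parts; the four resulting pairs account for the factor 4.\<close>

lemma bilinear_embedding_ge2:
  fixes f g :: "real^'n::finite \<Rightarrow> real"
  assumes q: "2 \<le> q" and r: "r = q / (q - 1)"
    and f: "f \<in> borel_measurable borel" "integrable lborel (\<lambda>x. \<bar>f x\<bar> powr q)"
    and g: "g \<in> borel_measurable borel" "integrable lborel (\<lambda>x. \<bar>g x\<bar> powr r)"
  defines "M \<equiv> real CARD('n \<times> bool)"
  shows "(\<Sum>n<N. LBINT x. \<bar>cdiff h i (mean_pow h n f) x\<bar> * \<bar>cdiff h j (mean_pow h n g) x\<bar>)
      \<le> 4 * (16 * M\<^sup>2 * (22 * q)) * ((LBINT x. \<bar>f x\<bar> powr q) + (LBINT x. \<bar>g x\<bar> powr r))"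
proof -
  have r1: "1 < r" using q by (auto simp: r field_simps)
  define K where "K = 16 * M\<^sup>2 * (22 * q)"
  have K: "0 \<le> K" using q by (simp add: K_def)
  define u where "u s x = max 0 (s * f x)" for s x
  define v where "v s x = max 0 (s * g x)" for s x
  have um: "u s \<in> borel_measurable borel" and vm: "v s \<in> borel_measurable borel" for s
    using f g unfolding u_def[abs_def] v_def[abs_def] by measurable
  have ule: "u s x powr q \<le> \<bar>f x\<bar> powr q" and vle: "v s x powr r \<le> \<bar>g x\<bar> powr r" if "s \<in> {-1, 1}" for s x
    using that q r1 by (auto simp: u_def v_def intro!: powr_mono2)
  have ui: "integrable lborel (\<lambda>x. u s x powr q)" if "s \<in> {-1, 1}" for s
    by (rule Bochner_Integration.integrable_bound[OF f(2)]) (use um ule[OF that] in auto)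
  have vi: "integrable lborel (\<lambda>x. v s x powr r)" if "s \<in> {-1, 1}" for s
    by (rule Bochner_Integration.integrable_bound[OF g(2)]) (use vm vle[OF that] in auto)
  define P where "P s t n x = \<bar>cdiff h i (mean_pow h n (u s)) x\<bar> * \<bar>cdiff h j (mean_pow h n (v t)) x\<bar>" for s t n x
  have nn: "0 \<le> u s x" "0 \<le> v s x" for s x by (auto simp: u_def v_def)
  have Pi: "integrable lborel (P s t n)"
    and PS: "(\<Sum>n<N. integral\<^sup>L lborel (P s t n)) \<le> K * ((LBINT x. \<bar>f x\<bar> powr q) + (LBINT x. \<bar>g x\<bar> powr r))"
    if st: "s \<in> {-1, 1}" "t \<in> {-1, 1}" for s t n
  proof -
    show "integrable lborel (P s t n)"
      unfolding P_def[abs_def] by (intro bilinear_embedding_nonneg(1)[OF q r] um vm nn ui vi st)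
    have "(\<Sum>n<N. integral\<^sup>L lborel (P s t n)) \<le> K * ((LBINT x. u s x powr q) + (LBINT x. v t x powr r))"
      unfolding P_def[abs_def] K_def M_def by (intro bilinear_embedding_nonneg(2)[OF q r] um vm nn ui vi st)
    also have "\<dots> \<le> K * ((LBINT x. \<bar>f x\<bar> powr q) + (LBINT x. \<bar>g x\<bar> powr r))"
      by (intro mult_left_mono add_mono integral_mono ui vi st f g ule vle K)
    finally show "(\<Sum>n<N. integral\<^sup>L lborel (P s t n)) \<le> K * ((LBINT x. \<bar>f x\<bar> powr q) + (LBINT x. \<bar>g x\<bar> powr r))" .
  qed
  have fe: "f = (\<lambda>x. u 1 x - u (-1) x)" and ge: "g = (\<lambda>x. v 1 x - v (-1) x)"
    by (auto simp: u_def v_def max_def)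
  have le: "\<bar>cdiff h i (mean_pow h n f) x\<bar> * \<bar>cdiff h j (mean_pow h n g) x\<bar>
      \<le> P 1 1 n x + P 1 (-1) n x + P (-1) 1 n x + P (-1) (-1) n x" for n x
  proof -
    have "cdiff h i (mean_pow h n f) x = cdiff h i (mean_pow h n (u 1)) x - cdiff h i (mean_pow h n (u (-1))) x"
      by (subst fe) (simp add: mean_pow_diff cdiff_def)
    then have 1: "\<bar>cdiff h i (mean_pow h n f) x\<bar> \<le> \<bar>cdiff h i (mean_pow h n (u 1)) x\<bar> + \<bar>cdiff h i (mean_pow h n (u (-1))) x\<bar>"
      by linarith
    have "cdiff h j (mean_pow h n g) x = cdiff h j (mean_pow h n (v 1)) x - cdiff h j (mean_pow h n (v (-1))) x"
      by (subst ge) (simp add: mean_pow_diff cdiff_def)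
    then have 2: "\<bar>cdiff h j (mean_pow h n g) x\<bar> \<le> \<bar>cdiff h j (mean_pow h n (v 1)) x\<bar> + \<bar>cdiff h j (mean_pow h n (v (-1))) x\<bar>"
      by linarith
    from mult_mono[OF 1 2] show ?thesis by (simp add: P_def algebra_simps)
  qed
  have "(LBINT x. \<bar>cdiff h i (mean_pow h n f) x\<bar> * \<bar>cdiff h j (mean_pow h n g) x\<bar>)
      \<le> (LBINT x. P 1 1 n x + P 1 (-1) n x + P (-1) 1 n x + P (-1) (-1) n x)" for n
  proof (rule integral_mono'[OF _ le])
    show "integrable lborel (\<lambda>x. P 1 1 n x + P 1 (-1) n x + P (-1) 1 n x + P (-1) (-1) n x)"
      by (intro Bochner_Integration.integrable_add Pi) auto
  qed (auto simp: P_def)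
  also have "(LBINT x. P 1 1 n x + P 1 (-1) n x + P (-1) 1 n x + P (-1) (-1) n x)
      = integral\<^sup>L lborel (P 1 1 n) + integral\<^sup>L lborel (P 1 (-1) n)
        + integral\<^sup>L lborel (P (-1) 1 n) + integral\<^sup>L lborel (P (-1) (-1) n)" for n
    by (simp add: Pi)
  finally have "(\<Sum>n<N. LBINT x. \<bar>cdiff h i (mean_pow h n f) x\<bar> * \<bar>cdiff h j (mean_pow h n g) x\<bar>)
      \<le> (\<Sum>n<N. integral\<^sup>L lborel (P 1 1 n) + integral\<^sup>L lborel (P 1 (-1) n)
        + integral\<^sup>L lborel (P (-1) 1 n) + integral\<^sup>L lborel (P (-1) (-1) n))"
    by (rule sum_mono)
  then show ?thesis
    using PS[of 1 1] PS[of 1 "-1"] PS[of "-1" 1] PS[of "-1" "-1"]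
    unfolding K_def[symmetric] by (simp add: sum.distrib)
qed

text \<open>Scaling the two functions independently turns a bound by a sum into one by a product:
  \<open>l\<close> and \<open>m\<close> make both terms equal to 1, whence the factor 2.\<close>

lemma conjugate_homogenize:
  fixes S F G C q r :: real
  assumes "1 < q" "1 < r" "0 \<le> F" "0 \<le> G" "0 \<le> C"
    and S: "\<And>l m. 0 < l \<Longrightarrow> 0 < m \<Longrightarrow> l * m * S \<le> C * (l powr q * F + m powr r * G)"
  shows "S \<le> 2 * C * F powr (1 / q) * G powr (1 / r)"
proof (cases "F = 0 \<or> G = 0")
  case False
  then have FG: "0 < F" "0 < G" using assms by auto
  let ?l = "F powr (- (1 / q))" and ?m = "G powr (- (1 / r))"
  have "?l * ?m * S \<le> C * (?l powr q * F + ?m powr r * G)"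
    using FG by (intro S) auto
  also have "?l powr q * F + ?m powr r * G = 2"
  proof -
    have "?l powr q = F powr - 1" "?m powr r = G powr - 1" using assms by (simp_all add: powr_powr)
    then show ?thesis using FG by (simp add: powr_minus)
  qed
  finally have "?l * ?m * S \<le> 2 * C" by simp
  then show ?thesis using FG by (simp add: powr_minus field_simps)
next
  case True
  have "\<not> 0 < S"
  proof
    assume pos: "0 < S"
    consider "F = 0" | "G = 0" using True by blast
    then show False
    proof cases
      case 1
      \<comment> \<open>With \<open>F = 0\<close> the right-hand side is \<open>C * G\<close> for
        every \<open>l\<close>, and this \<open>l\<close> makes the left-hand side
        \<open>C * G + 1\<close>.\<close>
      have "(C * G + 1) / S * 1 * S \<le> C * (((C * G + 1) / S) powr q * F + 1 powr r * G)"
        using assms pos by (intro S divide_pos_pos add_nonneg_pos) auto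
      then show False using 1 pos by simp
    next
      case 2
      have "1 * ((C * F + 1) / S) * S \<le> C * (1 powr q * F + ((C * F + 1) / S) powr r * G)"
        using assms pos by (intro S divide_pos_pos add_nonneg_pos) auto
      then show False using 2 pos by simp
    qed
  qed
  moreover have "0 \<le> 2 * C * F powr (1 / q) * G powr (1 / r)" using assms by simp
  ultimately show ?thesis by linarith
qed

text \<open>The Bellman function requires \<open>2 \<le> q\<close>. Otherwise the conjugate exponent
  is at least 2 and the two functions exchange roles in the symmetric product.\<close>

lemma bilinear_embedding:
  fixes q r :: real
  assumes q: "1 < q" and r: "r = q / (q - 1)"
  shows "\<exists>K>0. \<forall>h i j N (f :: real^'n::finite \<Rightarrow> real) g.
    f \<in> borel_measurable borel \<longrightarrow> integrable lborel (\<lambda>x. \<bar>f x\<bar> powr q) \<longrightarrow>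
    g \<in> borel_measurable borel \<longrightarrow> integrable lborel (\<lambda>x. \<bar>g x\<bar> powr r) \<longrightarrow>
    (\<Sum>n<N. LBINT x. \<bar>cdiff h i (mean_pow h n f) x\<bar> * \<bar>cdiff h j (mean_pow h n g) x\<bar>)
      \<le> K * (LBINT x. \<bar>f x\<bar> powr q) powr (1 / q) * (LBINT x. \<bar>g x\<bar> powr r) powr (1 / r)"
proof -
  have r1: "1 < r" and qr: "q = r / (r - 1)" using q by (auto simp: r field_simps)
  define K where "K = 4 * (16 * (real CARD('n \<times> bool))\<^sup>2 * (22 * max q r))"
  have K: "0 < K" using q by (simp add: K_def)
  have le: "(\<Sum>n<N. LBINT x. \<bar>cdiff h i (mean_pow h n f) x\<bar> * \<bar>cdiff h j (mean_pow h n g) x\<bar>)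
      \<le> K * ((LBINT x. \<bar>f x\<bar> powr q) + (LBINT x. \<bar>g x\<bar> powr r))" (is "?S f g \<le> _")
    if f: "f \<in> borel_measurable borel" "integrable lborel (\<lambda>x. \<bar>f x\<bar> powr q)"
      and g: "g \<in> borel_measurable borel" "integrable lborel (\<lambda>x. \<bar>g x\<bar> powr r)"
    for h i j N and f g :: "real^'n \<Rightarrow> real"
  proof (cases "2 \<le> q")
    case True
    then have "r \<le> q" by (simp add: r field_simps)
    then have "K = 4 * (16 * (real CARD('n \<times> bool))\<^sup>2 * (22 * q))" by (simp add: K_def max_absorb1)
    then show ?thesis using bilinear_embedding_ge2[OF True r f g, of h i j N] by (simp only:)
  next
    case False
    then have r2: "2 \<le> r" using q by (simp add: r field_simps)
    then have "q \<le> r" using False by simp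
    then have "K = 4 * (16 * (real CARD('n \<times> bool))\<^sup>2 * (22 * r))" by (simp add: K_def max_absorb2)
    then show ?thesis using bilinear_embedding_ge2[OF r2 qr g f, of h j i N]
      by (simp only: mult.commute[of "\<bar>cdiff h j (mean_pow h _ g) _\<bar>"] add.commute)
  qed
  have "?S h i j N f g \<le> 2 * K * (LBINT x. \<bar>f x\<bar> powr q) powr (1 / q) * (LBINT x. \<bar>g x\<bar> powr r) powr (1 / r)"
    if f: "f \<in> borel_measurable borel" "integrable lborel (\<lambda>x. \<bar>f x\<bar> powr q)"
      and g: "g \<in> borel_measurable borel" "integrable lborel (\<lambda>x. \<bar>g x\<bar> powr r)"
    for h i j N and f g :: "real^'n \<Rightarrow> real"
  proof (rule conjugate_homogenize[OF q r1])
    fix l m :: real assume lm: "0 < l" "0 < m"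
    have e: "\<bar>l * f x\<bar> powr q = l powr q * \<bar>f x\<bar> powr q" "\<bar>m * g x\<bar> powr r = m powr r * \<bar>g x\<bar> powr r" for x
      using lm by (auto simp: abs_mult powr_mult)
    have c: "\<bar>cdiff h i (mean_pow h n (\<lambda>x. l * f x)) x\<bar> * \<bar>cdiff h j (mean_pow h n (\<lambda>x. m * g x)) x\<bar>
      = l * m * (\<bar>cdiff h i (mean_pow h n f) x\<bar> * \<bar>cdiff h j (mean_pow h n g) x\<bar>)" for n x
      using lm by (simp add: mean_pow_cmult cdiff_def right_diff_distrib[symmetric] abs_mult)
    have "?S h i j N (\<lambda>x. l * f x) (\<lambda>x. m * g x) \<le>
        K * ((LBINT x. \<bar>l * f x\<bar> powr q) + (LBINT x. \<bar>m * g x\<bar> powr r))"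
      by (rule le) (use f g in \<open>auto simp: e\<close>)
    then show "l * m * ?S h i j N f g \<le> K * (l powr q * (LBINT x. \<bar>f x\<bar> powr q) + m powr r * (LBINT x. \<bar>g x\<bar> powr r))"
      by (simp add: e c sum_distrib_left)
  qed (use K in auto)
  then show ?thesis using K by (intro exI[of _ "2 * K"]) auto
qed

section \<open>Integrals along rays\<close>

text \<open>The directions form the unit cube \<open>[1, 2]\<^sup>n\<close>. It has volume 1, so averaging needs no
  normalization, and all coordinates of a direction are at least 1, so a ray spends parameter
  length at most \<open>2 R\<close> in a ball of radius \<open>R\<close>.\<close>

definition rays :: "(real \<times> (real^'n::finite)) set"
  where "rays = {0..} \<times> cbox 1 2"

text \<open>Substituting \<open>y = r w\<close> shows a convolution with a kernel homogeneous of
  degree \<open>1 - n\<close>, as for the Riesz potential of order 1; hence the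
  Hardy-Littlewood-Sobolev exponents. The value \<open>s = - 1\<close> reverses the rays and gives
  the adjoint, which appears when the order of integration is exchanged.\<close>

definition ray_integral :: "real \<Rightarrow> (real^'n::finite \<Rightarrow> real) \<Rightarrow> real^'n \<Rightarrow> ennreal"
  where "ray_integral s f x = (\<integral>\<^sup>+z. indicator rays z * ennreal (f (x + (s * fst z) *\<^sub>R snd z)) \<partial>lborel)"

lemma rays_measurable[measurable]: "(rays :: (real \<times> (real^'n::finite)) set) \<in> sets borel"
  unfolding rays_def by (intro borel_closed closed_Times) auto

lemma emeasure_cbox_1_2: "emeasure lborel (cbox 1 2 :: (real^'n::finite) set) = 1"
proof -
  have "(\<Prod>b\<in>(Basis :: (real^'n) set). (2 - 1) \<bullet> b) = 1"
    by (intro prod.neutral ballI) (auto simp: Basis_vec_def inner_axis)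
  moreover have "(1::real^'n) \<bullet> b \<le> 2 \<bullet> b" if "b \<in> Basis" for b :: "real^'n"
    using that by (auto simp: Basis_vec_def inner_axis)
  ultimately show ?thesis by (subst emeasure_lborel_cbox) auto
qed

lemma ray_point_measurable[measurable]:
  "(\<lambda>z :: real \<times> (real^'n::finite). x + (s * fst z) *\<^sub>R snd z) \<in> borel \<rightarrow>\<^sub>M borel"
  by (intro borel_measurable_continuous_onI continuous_intros)

lemma ray_point_measurable1[measurable]:
  "(\<lambda>z :: real \<times> (real^'n::finite). x + fst z *\<^sub>R snd z) \<in> borel \<rightarrow>\<^sub>M borel"
  "(\<lambda>z :: real \<times> (real^'n::finite). x - fst z *\<^sub>R snd z) \<in> borel \<rightarrow>\<^sub>M borel"
  by (intro borel_measurable_continuous_onI continuous_intros)+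

lemma joint_ray_point_measurable[measurable]:
  "(\<lambda>p :: (real^'n::finite) \<times> real \<times> (real^'n). fst p + (s * fst (snd p)) *\<^sub>R snd (snd p)) \<in> borel \<rightarrow>\<^sub>M borel"
  by (intro borel_measurable_continuous_onI continuous_intros)

lemma rays_indicator: "(indicator rays (r, w) :: ennreal) = indicator {0..} r * indicator (cbox 1 2) w"
  by (auto simp: rays_def indicator_def)

text \<open>Both orders are used: averages over directions at a fixed parameter for truncated
  functions, and integrals along a single ray for functions with bounded support.\<close>

lemma nn_integral_rays:
  assumes [measurable]: "F \<in> borel_measurable borel"
  shows "(\<integral>\<^sup>+z. indicator rays z * F z \<partial>lborel)
      = (\<integral>\<^sup>+r. indicator {0..} r * (\<integral>\<^sup>+w. indicator (cbox 1 2) w * F (r, w :: real^'n::finite) \<partial>lborel) \<partial>lborel)" (is ?A)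
    and "(\<integral>\<^sup>+z. indicator rays z * F z \<partial>lborel)
      = (\<integral>\<^sup>+w. indicator (cbox 1 2) w * (\<integral>\<^sup>+r. indicator {0..} r * F (r, w) \<partial>lborel) \<partial>lborel)" (is ?B)
proof -
  have m: "(\<lambda>z. indicator rays z * F z) \<in> borel_measurable (lborel \<Otimes>\<^sub>M lborel)"
    by (simp add: lborel_prod)
  have F[measurable]: "F \<in> borel_measurable (borel \<Otimes>\<^sub>M borel)" by (simp add: borel_prod)
  have "(\<integral>\<^sup>+z. indicator rays z * F z \<partial>lborel) = (\<integral>\<^sup>+r. \<integral>\<^sup>+w. indicator rays (r, w) * F (r, w) \<partial>lborel \<partial>lborel)"
    using lborel.nn_integral_fst[OF m] by (simp add: lborel_prod)
  then show ?A by (simp add: rays_indicator mult.assoc nn_integral_cmult)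
  have "(\<integral>\<^sup>+z. indicator rays z * F z \<partial>lborel) = (\<integral>\<^sup>+w. \<integral>\<^sup>+r. indicator rays (r, w) * F (r, w) \<partial>lborel \<partial>lborel)"
    using lborel_pair.nn_integral_snd[OF m] by (simp add: lborel_prod)
  then show ?B by (simp add: rays_indicator mult.assoc mult.left_commute[of "indicator {0..} _"] nn_integral_cmult)
qed

lemma nn_integral_affine:
  fixes f :: "'a::euclidean_space \<Rightarrow> ennreal"
  assumes [measurable]: "f \<in> borel_measurable borel" and c: "c \<noteq> 0"
  shows "ennreal (\<bar>c\<bar> ^ DIM('a)) * (\<integral>\<^sup>+w. f (x + c *\<^sub>R w) \<partial>lborel) = (\<integral>\<^sup>+w. f w \<partial>lborel)"
proof -
  have "(\<integral>\<^sup>+w. f w \<partial>lborel) = (\<integral>\<^sup>+w. f w \<partial>(density (distr lborel borel (\<lambda>w. x + c *\<^sub>R w)) (\<lambda>_. \<bar>c\<bar> ^ DIM('a))))"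
    using lborel_affine[OF c, of x] by simp
  also have "\<dots> = ennreal (\<bar>c\<bar> ^ DIM('a)) * (\<integral>\<^sup>+w. f (x + c *\<^sub>R w) \<partial>lborel)"
    by (simp add: nn_integral_density nn_integral_distr nn_integral_cmult)
  finally show ?thesis ..
qed

lemma nn_integral_translate:
  fixes f :: "'a::euclidean_space \<Rightarrow> ennreal"
  assumes "f \<in> borel_measurable borel"
  shows "(\<integral>\<^sup>+w. f (w + a) \<partial>lborel) = (\<integral>\<^sup>+w. f w \<partial>lborel)"
  using nn_integral_affine[OF assms, of 1 a] by (simp add: add.commute)

lemma ray_integral_bounded_support:
  fixes f :: "real^'n::finite \<Rightarrow> real"
  assumes [measurable]: "f \<in> borel_measurable borel" and C: "\<And>y. f y \<le> C" "0 \<le> C" and R: "\<And>y. R < norm y \<Longrightarrow> f y = 0" "0 \<le> R"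
  shows "ray_integral 1 f x \<le> ennreal (2 * R * C)"
proof -
  \<comment> \<open>An arbitrary coordinate will do. It grows along the ray with speed at least 1,
    so it is at most \<open>R\<close> in absolute value only for parameters in an interval of length
    at most \<open>2 * R\<close>.\<close>
  let ?k = "undefined :: 'n"
  have inner: "(\<integral>\<^sup>+r. indicator {0..} r * ennreal (f (x + r *\<^sub>R w)) \<partial>lborel) \<le> ennreal (2 * R * C)"
    if w: "w \<in> cbox 1 2" for w
  proof -
    define l where "l = (- R - x $ ?k) / w $ ?k"
    define u where "u = (R - x $ ?k) / w $ ?k"
    have wk: "1 \<le> w $ ?k" using w by (auto simp: mem_box_cart)
    have lu: "l \<le> u" "u - l \<le> 2 * R"
      using wk R by (auto simp: l_def u_def divide_right_mono diff_divide_distrib[symmetric] field_simps)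
        (metis R(2) mult_le_cancel_left1 mult.commute linorder_not_less)
    have "f (x + r *\<^sub>R w) = 0" if "r \<notin> {l..u}" for r
    proof -
      have "R < \<bar>(x + r *\<^sub>R w) $ ?k\<bar>"
        using that wk by (auto simp: l_def u_def field_simps)
      also have "\<dots> \<le> norm (x + r *\<^sub>R w)" by (rule component_le_norm_cart)
      finally show ?thesis by (rule R)
    qed
    then have "indicator {0..} r * ennreal (f (x + r *\<^sub>R w)) \<le> ennreal C * indicator {l..u} r" for r
      using C by (cases "r \<in> {l..u}") (auto simp: indicator_def intro: ennreal_leI)
    then have "(\<integral>\<^sup>+r. indicator {0..} r * ennreal (f (x + r *\<^sub>R w)) \<partial>lborel) \<le> (\<integral>\<^sup>+r. ennreal C * indicator {l..u} r \<partial>lborel)"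
      by (intro nn_integral_mono)
    also have "\<dots> = ennreal (C * (u - l))"
      using lu C by (simp add: nn_integral_cmult ennreal_mult)
    also have "\<dots> \<le> ennreal (2 * R * C)"
      using lu C by (intro ennreal_leI) (metis mult.commute mult_left_mono)
    finally show ?thesis .
  qed
  have "ray_integral 1 f x = (\<integral>\<^sup>+w. indicator (cbox 1 2) w * (\<integral>\<^sup>+r. indicator {0..} r * ennreal (f (x + r *\<^sub>R w)) \<partial>lborel) \<partial>lborel)"
    unfolding ray_integral_def by (subst nn_integral_rays(2)) simp_all
  also have "\<dots> \<le> (\<integral>\<^sup>+w. indicator (cbox 1 2) w * ennreal (2 * R * C) \<partial>(lborel :: (real^'n) measure))"
    using inner by (intro nn_integral_mono) (auto simp: indicator_def)
  also have "\<dots> = ennreal (2 * R * C)"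
    by (simp add: nn_integral_multc emeasure_cbox_1_2)
  finally show ?thesis .
qed

text \<open>The average \<open>A r\<close> of \<open>f\<close> over the directions at parameter \<open>r\<close> is at most \<open>l\<close>, and at most
  \<open>2 r\<^bsup>-n/p\<^esup>\<close> because scaling by \<open>r\<close> costs \<open>r\<^bsup>-n\<^esup>\<close>; the two bounds balance near \<open>r = l\<^bsup>-p/n\<^esup>\<close>.\<close>

lemma ray_integral_truncated:
  fixes p s l :: real and f :: "real^'n::finite \<Rightarrow> real"
  assumes p: "1 < p" "p < real CARD('n)" and s: "\<bar>s\<bar> = 1"
    and f[measurable]: "f \<in> borel_measurable borel" and nn: "\<And>x. 0 \<le> f x" and le: "\<And>x. f x \<le> l" and l: "0 < l"
    and int: "(\<integral>\<^sup>+x. ennreal (f x powr p) \<partial>lborel) \<le> 1"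
  shows "ray_integral s f x \<le> ennreal ((1 + 2 * p / (CARD('n) - p)) * l powr (1 - p / CARD('n)))"
proof -
  define n where "n = real CARD('n)"
  have n: "p < n" "0 < n" using p by (auto simp: n_def)
  define A where "A r = (\<integral>\<^sup>+w. indicator (cbox 1 2) w * ennreal (f (x + (s * r) *\<^sub>R w)) \<partial>(lborel :: (real^'n) measure))" for r
  have A1: "A r \<le> ennreal l" for r
  proof -
    have "A r \<le> (\<integral>\<^sup>+w. indicator (cbox 1 2) w * ennreal l \<partial>(lborel :: (real^'n) measure))"
      unfolding A_def using le by (intro nn_integral_mono mult_left_mono ennreal_leI) auto
    also have "\<dots> = ennreal l" by (simp add: nn_integral_multc emeasure_cbox_1_2)
    finally show ?thesis .
  qed
  have A2: "A r \<le> ennreal (2 * r powr (- (n / p)))" if r: "0 < r" for r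
  proof -
    \<comment> \<open>\<open>c\<close> solves \<open>c powr (1 - p) * r powr (- n) = c\<close>:
      splitting \<open>f\<close> at the height \<open>c\<close> yields two equal contributions,
      hence the factor 2 in \<open>A2\<close>.\<close>
    define c where "c = r powr (- (n / p))"
    have c: "0 < c" using r by (simp add: c_def)
    have young: "f y \<le> c powr (1 - p) * f y powr p + c" for y
    proof (cases "f y \<le> c")
      case False
      then have "1 \<le> (f y / c) powr (p - 1)" using c p by (intro ge_one_powr_ge_zero) auto
      then have "f y * 1 \<le> f y * (f y / c) powr (p - 1)" by (intro mult_left_mono nn)
      also have "\<dots> = c powr (1 - p) * f y powr p"
        using False c nn[of y] by (simp add: powr_divide powr_diff field_simps)
      finally show ?thesis using c by simp
    qed (simp add: add_increasing)
    have "A r \<le> (\<integral>\<^sup>+w. ennreal (c powr (1 - p)) * ennreal (f (x + (s * r) *\<^sub>R w) powr p) + indicator (cbox 1 2) w * ennreal c \<partial>(lborel :: (real^'n) measure))"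
      unfolding A_def
    proof (intro nn_integral_mono)
      fix w :: "real^'n"
      have "ennreal (f (x + (s * r) *\<^sub>R w)) \<le> ennreal (c powr (1 - p)) * ennreal (f (x + (s * r) *\<^sub>R w) powr p) + ennreal c"
        using young[of "x + (s * r) *\<^sub>R w"] c
        by (simp add: ennreal_mult[symmetric] ennreal_plus[symmetric] del: ennreal_plus)
      then show "indicator (cbox 1 2) w * ennreal (f (x + (s * r) *\<^sub>R w)) \<le> ennreal (c powr (1 - p)) * ennreal (f (x + (s * r) *\<^sub>R w) powr p) + indicator (cbox 1 2) w * ennreal c"
        by (auto simp: indicator_def)
    qed
    also have "\<dots> = ennreal (c powr (1 - p)) * (\<integral>\<^sup>+w. ennreal (f (x + (s * r) *\<^sub>R w) powr p) \<partial>(lborel :: (real^'n) measure)) + ennreal c"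
      by (simp add: nn_integral_add nn_integral_cmult nn_integral_multc emeasure_cbox_1_2)
    also have "(\<integral>\<^sup>+w. ennreal (f (x + (s * r) *\<^sub>R w) powr p) \<partial>(lborel :: (real^'n) measure)) \<le> ennreal (r powr (- n))"
    proof -
      have sr: "\<bar>s * r\<bar> ^ DIM(real^'n) = r powr n" using s r by (simp add: abs_mult n_def powr_realpow)
      have "ennreal (r powr n) * (\<integral>\<^sup>+w. ennreal (f (x + (s * r) *\<^sub>R w) powr p) \<partial>(lborel :: (real^'n) measure)) \<le> 1"
        using nn_integral_affine[of "\<lambda>y. ennreal (f y powr p)" "s * r" x] s r int unfolding sr by auto
      then have "ennreal (r powr (- n)) * (ennreal (r powr n) * (\<integral>\<^sup>+w. ennreal (f (x + (s * r) *\<^sub>R w) powr p) \<partial>(lborel :: (real^'n) measure))) \<le> ennreal (r powr (- n)) * 1"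
        by (intro mult_left_mono) auto
      moreover have "ennreal (r powr (- n)) * ennreal (r powr n) = 1"
        using r by (simp add: ennreal_mult[symmetric] powr_add[symmetric])
      ultimately show ?thesis by (simp add: mult.assoc[symmetric])
    qed
    finally have "A r \<le> ennreal (c powr (1 - p)) * ennreal (r powr (- n)) + ennreal c"
      by (simp add: mult_left_mono add_right_mono)
    also have "c powr (1 - p) * r powr (- n) = c"
      using r p by (simp add: c_def powr_powr powr_add[symmetric] field_simps)
    then have "ennreal (c powr (1 - p)) * ennreal (r powr (- n)) + ennreal c = ennreal (2 * c)"
      using c by (simp add: ennreal_mult[symmetric] ennreal_plus[symmetric] del: ennreal_plus)
    finally show ?thesis by (simp add: c_def)
  qed
  define \<rho> where "\<rho> = l powr (- (p / n))"
  have \<rho>: "0 < \<rho>" using l by (simp add: \<rho>_def)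
  \<comment> \<open>This is where \<open>p < n\<close> enters: the bound \<open>A2\<close> is
    integrable at infinity.\<close>
  have np: "1 < n / p" using n p by (simp add: field_simps)
  have tail: "(\<integral>\<^sup>+r. ennreal (2 * r powr (- (n / p))) * indicator {\<rho>..} r \<partial>lborel) = ennreal (2 * \<rho> powr (1 - n / p) / (n / p - 1))"
  proof -
    have "(\<integral>\<^sup>+r. ennreal (2 * r powr (- (n / p))) * indicator {\<rho>..} r \<partial>lborel) = ennreal (0 - 2 * \<rho> powr (1 - n / p) / (1 - n / p))"
    proof (rule nn_integral_FTC_atLeast)
      show "DERIV (\<lambda>r. 2 * r powr (1 - n / p) / (1 - n / p)) r :> 2 * r powr (- (n / p))" if "\<rho> \<le> r" for r
      proof -
        have "DERIV (\<lambda>r. 2 * r powr (1 - n / p) / (1 - n / p)) r :>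
            2 * ((1 - n / p) * r powr (1 - n / p - 1)) / (1 - n / p)"
          using that \<rho> by (intro DERIV_cdivide DERIV_cmult has_real_derivative_powr) auto
        then show ?thesis using np n p by simp
      qed
      have "((\<lambda>r. r powr (1 - n / p)) \<longlongrightarrow> 0) at_top"
        using np by (intro tendsto_neg_powr filterlim_ident) auto
      from tendsto_divide[OF tendsto_mult[OF tendsto_const[of 2] this] tendsto_const[of "1 - n / p"]]
      show "((\<lambda>r. 2 * r powr (1 - n / p) / (1 - n / p)) \<longlongrightarrow> 0) at_top"
        using np n p by simp
    qed auto
    also have "0 - 2 * \<rho> powr (1 - n / p) / (1 - n / p) = 2 * \<rho> powr (1 - n / p) / (n / p - 1)"
      by (simp add: minus_divide_right)
    finally show ?thesis .
  qed
  have "ray_integral s f x = (\<integral>\<^sup>+r. indicator {0..} r * A r \<partial>lborel)"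
    unfolding ray_integral_def A_def by (subst nn_integral_rays(1)) simp_all
  also have "\<dots> \<le> (\<integral>\<^sup>+r. ennreal l * indicator {0..\<rho>} r + ennreal (2 * r powr (- (n / p))) * indicator {\<rho>..} r \<partial>lborel)"
  proof (intro nn_integral_mono)
    fix r :: real
    show "indicator {0..} r * A r \<le> ennreal l * indicator {0..\<rho>} r + ennreal (2 * r powr (- (n / p))) * indicator {\<rho>..} r"
      using A1[of r] A2[of r] \<rho> by (cases "r < \<rho>") (auto simp: indicator_def intro: add_increasing)
  qed
  also have "\<dots> = ennreal (l * \<rho>) + ennreal (2 * \<rho> powr (1 - n / p) / (n / p - 1))"
  proof -
    have "(\<integral>\<^sup>+r. ennreal l * indicator {0..\<rho>} r \<partial>lborel) = ennreal (l * \<rho>)"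
      using l \<rho> by (simp add: nn_integral_cmult ennreal_mult)
    then show ?thesis unfolding tail[symmetric] by (subst nn_integral_add) simp_all
  qed
  also have "\<dots> = ennreal (l * \<rho> + 2 * \<rho> powr (1 - n / p) / (n / p - 1))"
    using l \<rho> np by (simp add: ennreal_plus[symmetric] del: ennreal_plus)
  also have "l * \<rho> + 2 * \<rho> powr (1 - n / p) / (n / p - 1) = (1 + 2 * p / (n - p)) * l powr (1 - p / n)"
  proof -
    have "l * \<rho> = l powr (1 - p / n)" using l by (simp add: \<rho>_def powr_diff powr_minus field_simps)
    moreover have "- (p / n) * (1 - n / p) = 1 - p / n" using n p by (simp add: field_simps)
    then have "\<rho> powr (1 - n / p) = l powr (1 - p / n)" by (simp add: \<rho>_def powr_powr)
    moreover have "2 / (n / p - 1) = 2 * p / (n - p)" using n p by (simp add: field_simps)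
    ultimately show ?thesis unfolding times_divide_eq_left[symmetric] distrib_right mult_1_left by simp
  qed
  finally show ?thesis by (simp add: n_def)
qed

lemma ray_integral_measurable[measurable]:
  fixes f :: "real^'n::finite \<Rightarrow> real"
  assumes [measurable]: "f \<in> borel_measurable borel"
  shows "ray_integral s f \<in> borel_measurable borel"
proof -
  have "(\<lambda>p. f (fst p + (s * fst (snd p)) *\<^sub>R snd (snd p))) \<in> borel_measurable (borel \<Otimes>\<^sub>M (borel :: (real \<times> (real^'n)) measure))"
    unfolding borel_prod by (rule measurable_compose[OF joint_ray_point_measurable]) simp
  then have [measurable]: "(\<lambda>(x, z). f (x + (s * fst z) *\<^sub>R snd z)) \<in> borel_measurable (borel \<Otimes>\<^sub>M (lborel :: (real \<times> (real^'n)) measure))"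
    by (simp add: case_prod_beta')
  have [measurable]: "rays \<in> sets (lborel :: (real \<times> (real^'n)) measure)" by simp
  show ?thesis
    unfolding ray_integral_def[abs_def] by measurable
qed

lemma ray_integral_cmult:
  assumes "0 \<le> c" and [measurable]: "f \<in> borel_measurable borel" and "\<And>x. 0 \<le> f x"
  shows "ray_integral s (\<lambda>x. c * f x) x = ennreal c * ray_integral s f x"
  unfolding ray_integral_def using assms
  by (simp add: ennreal_mult mult.left_commute nn_integral_cmult[symmetric])

text \<open>Hardy-Littlewood-Sobolev in bilinear form. The pairs \<open>(x, y)\<close> are split according to which of
  \<open>f(y)\<^sup>p\<close> and \<open>g(x)\<^sup>t\<close> is larger, so that in each part the smaller function is truncated at a power
  of the other and the pointwise estimate above applies.\<close>

lemma ray_integral_bilinear: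
  fixes p t :: real and f g :: "real^'n::finite \<Rightarrow> real"
  assumes p: "1 < p" "p < real CARD('n)" and t: "1 < t" "t < real CARD('n)"
    and pt: "1 / p + 1 / t = 1 + 1 / real CARD('n)"
    and f[measurable]: "f \<in> borel_measurable borel" and fnn: "\<And>x. 0 \<le> f x"
    and g[measurable]: "g \<in> borel_measurable borel" and gnn: "\<And>x. 0 \<le> g x"
    and fint: "(\<integral>\<^sup>+x. ennreal (f x powr p) \<partial>lborel) \<le> 1"
    and gint: "(\<integral>\<^sup>+x. ennreal (g x powr t) \<partial>lborel) \<le> 1"
  shows "(\<integral>\<^sup>+x. ennreal (g x) * ray_integral 1 f x \<partial>lborel)
    \<le> ennreal (2 + 2 * p / (CARD('n) - p) + 2 * t / (CARD('n) - t))"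
proof -
  define n where "n = real CARD('n)"
  define Cp where "Cp = 1 + 2 * p / (n - p)"
  define Ct where "Ct = 1 + 2 * t / (n - t)"
  have C: "0 < Cp" "0 < Ct" using p t by (auto simp: Cp_def Ct_def n_def add_pos_pos)
  \<comment> \<open>Both halves of the split have this form: \<open>a\<close>, with exponent
    \<open>v\<close>, is truncated at the height \<open>b y powr (u / v)\<close> set by the other
    function. The relation \<open>uv\<close> makes the resulting power of \<open>b y\<close> exactly
    \<open>u\<close>, whose integral is controlled.\<close>
  have part: "ennreal (b y) * ray_integral s (\<lambda>z. if a z \<le> b y powr (u / v) then a z else 0) y
      \<le> ennreal (K * b y powr u)"
    if v: "1 < v" "v < real CARD('n)" and u: "1 < u" and s: "\<bar>s\<bar> = 1" and uv: "1 / v + 1 / u = 1 + 1 / n"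
      and a[measurable]: "a \<in> borel_measurable borel" and ann: "\<And>x. 0 \<le> a x"
      and aint: "(\<integral>\<^sup>+x. ennreal (a x powr v) \<partial>lborel) \<le> 1"
      and bnn: "0 \<le> b y" and K: "K = 1 + 2 * v / (n - v)"
    for u v s K y and a b :: "real^'n \<Rightarrow> real"
  proof (cases "b y = 0")
    case False
    with bnn have by0: "0 < b y" by simp
    let ?l = "b y powr (u / v)"
    have "(\<integral>\<^sup>+z. ennreal ((if a z \<le> ?l then a z else 0) powr v) \<partial>lborel) \<le> (\<integral>\<^sup>+z. ennreal (a z powr v) \<partial>lborel)"
      by (intro nn_integral_mono) auto
    also note aint
    finally have "ray_integral s (\<lambda>z. if a z \<le> ?l then a z else 0) y
        \<le> ennreal ((1 + 2 * v / (CARD('n) - v)) * ?l powr (1 - v / CARD('n)))"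
      using by0 ann s by (intro ray_integral_truncated[OF v]) auto
    then have "ennreal (b y) * ray_integral s (\<lambda>z. if a z \<le> ?l then a z else 0) y
        \<le> ennreal (b y) * ennreal (K * ?l powr (1 - v / n))"
      by (intro mult_left_mono) (auto simp: K n_def)
    also have "\<dots> = ennreal (K * (b y * ?l powr (1 - v / n)))"
      using v bnn by (simp add: ennreal_mult[symmetric] K n_def mult.left_commute)
    also have "b y * ?l powr (1 - v / n) = b y powr u"
    proof -
      have "u / v * (1 - v / n) = u * (1 / v + 1 / u - 1 / n) - 1" using v u by (simp add: field_simps)
      also have "\<dots> = u - 1" by (simp add: uv)
      finally have "?l powr (1 - v / n) = b y powr (u - 1)" by (simp add: powr_powr)
      then show ?thesis using by0 by (simp add: powr_diff)
    qed
    finally show ?thesis .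
  qed simp
  define H1 where "H1 x y = ennreal (g x * (if f y \<le> g x powr (t / p) then f y else 0))" for x y
  define H2 where "H2 x y = ennreal (f y * (if g x \<le> f y powr (p / t) then g x else 0))" for x y
  have H: "ennreal (g x * f y) \<le> H1 x y + H2 x y" for x y
  proof (cases "f y \<le> g x powr (t / p)")
    case False
    then have "(g x powr (t / p)) powr (p / t) \<le> f y powr (p / t)"
      using p t by (intro powr_mono2) auto
    then have "g x \<le> f y powr (p / t)" using p t gnn[of x] by (simp add: powr_powr)
    then show ?thesis by (simp add: H1_def H2_def mult.commute)
  qed (simp add: H1_def)
  have H1m[measurable]: "(\<lambda>(x, y). H1 x y) \<in> borel_measurable (borel \<Otimes>\<^sub>M borel)"
    and H2m[measurable]: "(\<lambda>(x, y). H2 x y) \<in> borel_measurable (borel \<Otimes>\<^sub>M borel)"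
    unfolding H1_def H2_def by measurable
  have pm: "(\<lambda>q. (fst q, fst q + fst (snd q) *\<^sub>R snd (snd q))) \<in> borel \<Otimes>\<^sub>M (borel :: (real \<times> (real^'n)) measure) \<rightarrow>\<^sub>M borel \<Otimes>\<^sub>M borel"
    unfolding borel_prod by (intro borel_measurable_continuous_onI continuous_intros)
  have "(\<integral>\<^sup>+x. ennreal (g x) * ray_integral 1 f x \<partial>lborel)
      = (\<integral>\<^sup>+x. \<integral>\<^sup>+z. indicator rays z * ennreal (g x * f (x + fst z *\<^sub>R snd z)) \<partial>lborel \<partial>lborel)"
    unfolding ray_integral_def using gnn fnn
    by (simp add: ennreal_mult mult.left_commute nn_integral_cmult[symmetric])
  also have "\<dots> \<le> (\<integral>\<^sup>+x. (\<integral>\<^sup>+z. indicator rays z * H1 x (x + fst z *\<^sub>R snd z) \<partial>lborel)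
       + (\<integral>\<^sup>+z. indicator rays z * H2 x (x + fst z *\<^sub>R snd z) \<partial>lborel) \<partial>lborel)"
  proof (intro nn_integral_mono)
    fix x :: "real^'n"
    have [measurable]: "H1 x \<in> borel_measurable borel" "H2 x \<in> borel_measurable borel"
      unfolding H1_def[abs_def] H2_def[abs_def] by measurable
    have "(\<integral>\<^sup>+z. indicator rays z * ennreal (g x * f (x + fst z *\<^sub>R snd z)) \<partial>lborel)
        \<le> (\<integral>\<^sup>+z. indicator rays z * H1 x (x + fst z *\<^sub>R snd z) + indicator rays z * H2 x (x + fst z *\<^sub>R snd z) \<partial>lborel)"
      unfolding distrib_left[symmetric] by (intro nn_integral_mono mult_left_mono H) auto
    also have "\<dots> = (\<integral>\<^sup>+z. indicator rays z * H1 x (x + fst z *\<^sub>R snd z) \<partial>lborel)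
       + (\<integral>\<^sup>+z. indicator rays z * H2 x (x + fst z *\<^sub>R snd z) \<partial>lborel)"
      by (intro nn_integral_add) simp_all
    finally show "(\<integral>\<^sup>+z. indicator rays z * ennreal (g x * f (x + fst z *\<^sub>R snd z)) \<partial>lborel)
        \<le> (\<integral>\<^sup>+z. indicator rays z * H1 x (x + fst z *\<^sub>R snd z) \<partial>lborel)
       + (\<integral>\<^sup>+z. indicator rays z * H2 x (x + fst z *\<^sub>R snd z) \<partial>lborel)" .
  qed
  also have "\<dots> = (\<integral>\<^sup>+x. \<integral>\<^sup>+z. indicator rays z * H1 x (x + fst z *\<^sub>R snd z) \<partial>lborel \<partial>lborel)
       + (\<integral>\<^sup>+x. \<integral>\<^sup>+z. indicator rays z * H2 x (x + fst z *\<^sub>R snd z) \<partial>lborel \<partial>lborel)"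
  proof (intro nn_integral_add)
    have "(\<lambda>q. H1 (fst q) (fst q + fst (snd q) *\<^sub>R snd (snd q))) \<in> borel_measurable (borel \<Otimes>\<^sub>M borel)"
      "(\<lambda>q. H2 (fst q) (fst q + fst (snd q) *\<^sub>R snd (snd q))) \<in> borel_measurable (borel \<Otimes>\<^sub>M borel)"
      using measurable_compose[OF pm H1m] measurable_compose[OF pm H2m] by simp_all
    then have [measurable]: "(\<lambda>(x, z). H1 x (x + fst z *\<^sub>R snd z)) \<in> borel_measurable (lborel \<Otimes>\<^sub>M lborel)"
      "(\<lambda>(x, z). H2 x (x + fst z *\<^sub>R snd z)) \<in> borel_measurable (lborel \<Otimes>\<^sub>M lborel)"
      by (simp_all add: case_prod_beta')
    have [measurable]: "rays \<in> sets (lborel :: (real \<times> (real^'n)) measure)" by simp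
    show "(\<lambda>x. \<integral>\<^sup>+z. indicator rays z * H1 x (x + fst z *\<^sub>R snd z) \<partial>lborel) \<in> borel_measurable lborel"
      "(\<lambda>x. \<integral>\<^sup>+z. indicator rays z * H2 x (x + fst z *\<^sub>R snd z) \<partial>lborel) \<in> borel_measurable lborel"
      by measurable
  qed
  also have "(\<integral>\<^sup>+x. \<integral>\<^sup>+z. indicator rays z * H1 x (x + fst z *\<^sub>R snd z) \<partial>lborel \<partial>lborel) \<le> ennreal Cp"
  proof -
    have "(\<integral>\<^sup>+z. indicator rays z * H1 x (x + fst z *\<^sub>R snd z) \<partial>lborel) \<le> ennreal Cp * ennreal (g x powr t)" for x
    proof -
      have "(\<integral>\<^sup>+z. indicator rays z * H1 x (x + fst z *\<^sub>R snd z) \<partial>lborel)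
          = ennreal (g x) * ray_integral 1 (\<lambda>z. if f z \<le> g x powr (t / p) then f z else 0) x"
        unfolding ray_integral_def H1_def using gnn fnn
        by (simp add: ennreal_mult mult.left_commute nn_integral_cmult[symmetric] cong: if_cong)
      also have "\<dots> \<le> ennreal (Cp * g x powr t)"
        by (rule part[OF p t(1) _ _ f fnn fint gnn]) (use pt in \<open>auto simp: Cp_def n_def\<close>)
      finally show ?thesis using C by (simp add: ennreal_mult)
    qed
    then have "(\<integral>\<^sup>+x. \<integral>\<^sup>+z. indicator rays z * H1 x (x + fst z *\<^sub>R snd z) \<partial>lborel \<partial>lborel)
        \<le> (\<integral>\<^sup>+x. ennreal Cp * ennreal (g x powr t) \<partial>lborel)"
      by (intro nn_integral_mono)
    also have "\<dots> \<le> ennreal Cp" using gint by (simp add: nn_integral_cmult mult_left_le)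
    finally show ?thesis .
  qed
  also have "(\<integral>\<^sup>+x. \<integral>\<^sup>+z. indicator rays z * H2 x (x + fst z *\<^sub>R snd z) \<partial>lborel \<partial>lborel) \<le> ennreal Ct"
  proof -
    have 1: "(\<lambda>q. H2 (fst q) (fst q + fst (snd q) *\<^sub>R snd (snd q))) \<in> borel_measurable (borel \<Otimes>\<^sub>M borel)"
      using measurable_compose[OF pm H2m] by simp
    then have [measurable]: "(\<lambda>(x, z). H2 x (x + fst z *\<^sub>R snd z)) \<in> borel_measurable (lborel \<Otimes>\<^sub>M lborel)"
      by (simp add: case_prod_beta')
    have pm': "(\<lambda>q. (fst q - fst (snd q) *\<^sub>R snd (snd q), fst q)) \<in> borel \<Otimes>\<^sub>M (borel :: (real \<times> (real^'n)) measure) \<rightarrow>\<^sub>M borel \<Otimes>\<^sub>M borel"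
      unfolding borel_prod by (intro borel_measurable_continuous_onI continuous_intros)
    have "(\<lambda>q. H2 (fst q - fst (snd q) *\<^sub>R snd (snd q)) (fst q)) \<in> borel_measurable (borel \<Otimes>\<^sub>M borel)"
      using measurable_compose[OF pm' H2m] by simp
    then have [measurable]: "(\<lambda>(y, z). H2 (y - fst z *\<^sub>R snd z) y) \<in> borel_measurable (lborel \<Otimes>\<^sub>M lborel)"
      by (simp add: case_prod_beta')
    have [measurable]: "rays \<in> sets (lborel :: (real \<times> (real^'n)) measure)" by simp
    have [measurable]: "(\<lambda>x. H2 x (x + a)) \<in> borel_measurable borel" "(\<lambda>x. H2 (x - a) x) \<in> borel_measurable borel" for a
      unfolding H2_def by measurable
    \<comment> \<open>In this half the truncation height depends on the end point \<open>y\<close>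
      of the ray, so \<open>y\<close> must become the base point. After the exchange of integrals
      and a translation by the ray vector the rays run backwards.\<close>
    have "(\<integral>\<^sup>+x. \<integral>\<^sup>+z. indicator rays z * H2 x (x + fst z *\<^sub>R snd z) \<partial>lborel \<partial>lborel)
        = (\<integral>\<^sup>+z. \<integral>\<^sup>+x. indicator rays z * H2 x (x + fst z *\<^sub>R snd z) \<partial>lborel \<partial>lborel)"
      by (rule lborel_pair.Fubini'[symmetric]) measurable
    also have "\<dots> = (\<integral>\<^sup>+z. \<integral>\<^sup>+y. indicator rays z * H2 (y - fst z *\<^sub>R snd z) y \<partial>lborel \<partial>lborel)"
    proof (rule nn_integral_cong)
      fix z :: "real \<times> (real^'n)"
      have "(\<integral>\<^sup>+x. H2 x (x + fst z *\<^sub>R snd z) \<partial>lborel) = (\<integral>\<^sup>+y. H2 (y - fst z *\<^sub>R snd z) y \<partial>lborel)"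
        using nn_integral_translate[of "\<lambda>y. H2 (y - fst z *\<^sub>R snd z) y" "fst z *\<^sub>R snd z"] by simp
      then show "(\<integral>\<^sup>+x. indicator rays z * H2 x (x + fst z *\<^sub>R snd z) \<partial>lborel) = (\<integral>\<^sup>+y. indicator rays z * H2 (y - fst z *\<^sub>R snd z) y \<partial>lborel)"
        by (simp add: nn_integral_cmult)
    qed
    also have "\<dots> = (\<integral>\<^sup>+y. \<integral>\<^sup>+z. indicator rays z * H2 (y - fst z *\<^sub>R snd z) y \<partial>lborel \<partial>lborel)"
      by (rule lborel_pair.Fubini') measurable
    also have "\<dots> \<le> (\<integral>\<^sup>+y. ennreal Ct * ennreal (f y powr p) \<partial>lborel)"
    proof (intro nn_integral_mono)
      fix y :: "real^'n"
      have "(\<integral>\<^sup>+z. indicator rays z * H2 (y - fst z *\<^sub>R snd z) y \<partial>lborel)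
          = ennreal (f y) * ray_integral (- 1) (\<lambda>z. if g z \<le> f y powr (p / t) then g z else 0) y"
        unfolding ray_integral_def H2_def using gnn fnn
        by (simp add: ennreal_mult mult.left_commute nn_integral_cmult[symmetric] cong: if_cong)
      also have "\<dots> \<le> ennreal (Ct * f y powr p)"
        by (rule part[OF t p(1) _ _ g gnn gint fnn]) (use pt in \<open>auto simp: Ct_def n_def\<close>)
      finally show "(\<integral>\<^sup>+z. indicator rays z * H2 (y - fst z *\<^sub>R snd z) y \<partial>lborel) \<le> ennreal Ct * ennreal (f y powr p)"
        using C by (simp add: ennreal_mult)
    qed
    also have "\<dots> \<le> ennreal Ct" using fint by (simp add: nn_integral_cmult mult_left_le)
    finally show ?thesis .
  qed
  finally have "(\<integral>\<^sup>+x. ennreal (g x) * ray_integral 1 f x \<partial>lborel) \<le> ennreal Cp + ennreal Ct"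
    by (simp add: add_left_mono add_right_mono)
  also have "\<dots> = ennreal (Cp + Ct)" using C by simp
  also have "Cp + Ct = 2 + 2 * p / (CARD('n) - p) + 2 * t / (CARD('n) - t)"
    by (simp add: Cp_def Ct_def n_def)
  finally show ?thesis .
qed

text \<open>Duality: the bilinear estimate is tested with the normalized power \<open>S\<^bsup>q-1\<^esup>\<close> of the ray integral
  \<open>S\<close>, cut off to balls since the finiteness of the \<open>L\<^sup>q\<close>-norm is not yet known.\<close>

lemma ray_integral_Lq_normalized:
  fixes p q t K :: real and f :: "real^'n::finite \<Rightarrow> real"
  assumes p: "1 < p" "p < real CARD('n)" and q: "1 / q = 1 / p - 1 / real CARD('n)"
    and f[measurable]: "f \<in> borel_measurable borel" and fnn: "\<And>x. 0 \<le> f x"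
    and C: "\<And>x. f x \<le> C" and R: "\<And>x. R < norm x \<Longrightarrow> f x = 0"
    and fint: "(\<integral>\<^sup>+x. ennreal (f x powr p) \<partial>lborel) \<le> 1"
  defines "t \<equiv> q / (q - 1)"
  defines "K \<equiv> 2 + 2 * p / (CARD('n) - p) + 2 * t / (CARD('n) - t)"
  shows "(\<integral>\<^sup>+x. ennreal (enn2real (ray_integral 1 f x) powr q) \<partial>lborel) \<le> ennreal (K powr q)"
proof -
  define n where "n = real CARD('n)"
  have n: "p < n" "0 < n" using p by (auto simp: n_def)
  have "1 / n < 1 / p" using n p by (simp add: field_simps)
  then have q0: "0 < 1 / q" "1 / q < 1 / p" using n by (auto simp: q n_def)
  then have qp: "p < q" using p by (simp add: field_simps zero_less_divide_iff)
  then have q1: "1 < q" using p by simp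
  have t1: "1 < t" using q1 by (simp add: t_def)
  have tq: "1 / t = 1 - 1 / q" using q1 by (simp add: t_def field_simps)
  have "1 / n < 1 / t" unfolding tq q using p by (simp add: n_def[symmetric])
  then have tn: "t < n" using n t1 by (simp add: field_simps)
  have pt: "1 / p + 1 / t = 1 + 1 / n" unfolding tq q by (simp add: n_def)
  have Kpos: "0 < K" unfolding K_def using p tn t1 by (simp add: n_def add_pos_pos)
  define S where "S x = enn2real (ray_integral 1 f x)" for x
  define B where "B = 2 * max R 0 * max C 0"
  have ri: "ray_integral 1 f x \<le> ennreal B" for x
    unfolding B_def by (rule ray_integral_bounded_support[OF f]) (use C R in \<open>auto simp: le_max_iff_disj\<close>)
  have B: "0 \<le> B" by (simp add: B_def)
  \<comment> \<open>\<open>enn2real\<close> sends infinity to 0. The bound by \<open>B\<close>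
    excludes this case, so \<open>S\<close> is the ray integral itself.\<close>
  have S: "ennreal (S x) = ray_integral 1 f x" "S x \<le> B" "0 \<le> S x" for x
    using ri[of x] B unfolding S_def
    by (auto simp: enn2real_leI intro!: ennreal_enn2real le_less_trans[OF ri])
  have Sm[measurable]: "S \<in> borel_measurable borel" unfolding S_def[abs_def] by measurable
  define X where "X k = (\<integral>\<^sup>+x. ennreal (S x powr q) * indicator (ball 0 (real k)) x \<partial>lborel)" for k :: nat
  have Sqm: "(\<lambda>x. ennreal (S x powr q) * indicator (ball 0 (real k)) x) \<in> borel_measurable lborel" for k :: nat
    by (intro borel_measurable_times_ennreal measurable_compose[OF _ measurable_ennreal]
        powr_real_measurable borel_measurable_const borel_measurable_indicator) (use Sm in auto)
  have Xle: "X k \<le> ennreal (K powr q)" for k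
  proof -
    have "X k \<le> (\<integral>\<^sup>+x. ennreal (B powr q) * indicator (ball 0 (real k) :: (real^'n) set) x \<partial>lborel)"
      unfolding X_def using S q1 by (intro nn_integral_mono mult_right_mono ennreal_leI powr_mono2) auto
    also have "\<dots> < \<infinity>"
      using emeasure_lborel_ball_finite[of "0 :: real^'n" "real k"]
      by (subst nn_integral_cmult_indicator) (auto simp: ennreal_mult_less_top)
    finally have fin: "X k < \<infinity>" .
    define Y where "Y = enn2real (X k)"
    have XY: "X k = ennreal Y" "0 \<le> Y" using fin by (auto simp: Y_def)
    show ?thesis
    proof (cases "Y = 0")
      case False
      with XY have Y: "0 < Y" by simp
      define g where "g x = Y powr (- (1 / t)) * (S x powr (q - 1) * indicator (ball 0 (real k)) x)" for x
      have gm: "g \<in> borel_measurable borel" unfolding g_def[abs_def]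
        by (intro borel_measurable_times borel_measurable_const powr_real_measurable borel_measurable_indicator Sm) auto
      have "ennreal (g x powr t) = ennreal (1 / Y) * (ennreal (S x powr q) * indicator (ball 0 (real k)) x)" for x
      proof (cases "x \<in> ball 0 (real k)")
        case True
        then have "g x powr t = Y powr (- (1 / t) * t) * S x powr ((q - 1) * t)"
          by (simp add: g_def powr_mult powr_powr)
        also have "(q - 1) * t = q" using q1 by (simp add: t_def)
        also have "- (1 / t) * t = - 1" using t1 by simp
        also have "Y powr - 1 = 1 / Y" using Y by (simp add: powr_minus divide_inverse)
        finally show ?thesis using True Y by (simp add: ennreal_mult[symmetric])
      qed (simp add: g_def)
      then have "(\<integral>\<^sup>+x. ennreal (g x powr t) \<partial>lborel) = ennreal (1 / Y) * X k"
        by (simp add: X_def nn_integral_cmult[OF Sqm])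
      also have "\<dots> = 1" using Y by (simp add: XY ennreal_mult[symmetric])
      finally have gint: "(\<integral>\<^sup>+x. ennreal (g x powr t) \<partial>lborel) \<le> 1" by simp
      have "(\<integral>\<^sup>+x. ennreal (g x) * ray_integral 1 f x \<partial>lborel) \<le> ennreal K"
        unfolding K_def
        by (rule ray_integral_bilinear[OF p t1 _ _ f fnn gm _ fint gint]) (use tn pt Y in \<open>auto simp: n_def g_def\<close>)
      moreover have "ennreal (g x) * ray_integral 1 f x
          = ennreal (Y powr (- (1 / t))) * (ennreal (S x powr q) * indicator (ball 0 (real k)) x)" for x
      proof -
        have "S x powr (q - 1) * S x = S x powr q"
          using S(3)[of x] by (cases "S x = 0") (auto simp: powr_diff)
        then have "g x * S x = Y powr (- (1 / t)) * (S x powr q * indicator (ball 0 (real k)) x)"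
          by (simp add: g_def ac_simps)
        moreover have "0 \<le> g x" by (simp add: g_def)
        ultimately show ?thesis
          unfolding S(1)[symmetric] using S(3)[of x]
          by (simp add: ennreal_mult[symmetric] ennreal_indicator[symmetric])
      qed
      ultimately have "ennreal (Y powr (- (1 / t))) * X k \<le> ennreal K"
        by (simp add: X_def nn_integral_cmult[OF Sqm])
      then have "Y powr (- (1 / t)) * Y \<le> K"
        using Y Kpos by (simp add: XY ennreal_mult[symmetric])
      also have "Y powr (- (1 / t)) * Y = Y powr (1 / q)"
        using Y by (simp add: tq powr_diff powr_minus field_simps)
      finally have "(Y powr (1 / q)) powr q \<le> K powr q" using q1 by (intro powr_mono2) auto
      then have "Y \<le> K powr q" using q1 Y by (simp add: powr_powr)
      then show ?thesis by (simp add: XY ennreal_leI)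
    qed (simp add: XY)
  qed
  have "(\<integral>\<^sup>+x. ennreal (S x powr q) \<partial>lborel) = (\<integral>\<^sup>+x. (SUP k. ennreal (S x powr q) * indicator (ball 0 (real k)) x) \<partial>lborel)"
  proof (rule nn_integral_cong)
    fix x :: "real^'n"
    obtain k :: nat where k: "norm x < real k" using reals_Archimedean2 by blast
    show "ennreal (S x powr q) = (SUP k. ennreal (S x powr q) * indicator (ball 0 (real k)) x)"
    proof (rule antisym)
      show "ennreal (S x powr q) \<le> (SUP k. ennreal (S x powr q) * indicator (ball 0 (real k)) x)"
        by (rule SUP_upper2[of k]) (use k in auto)
      show "(SUP k. ennreal (S x powr q) * indicator (ball 0 (real k)) x) \<le> ennreal (S x powr q)"
        by (intro SUP_least) (auto simp: indicator_def)
    qed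
  qed
  also have "\<dots> = (SUP k. X k)"
    unfolding X_def
    by (intro nn_integral_monotone_convergence_SUP Sqm) (auto simp: incseq_def le_fun_def indicator_def)
  also have "\<dots> \<le> ennreal (K powr q)" by (intro SUP_least Xle)
  finally show ?thesis by (simp add: S_def)
qed

lemma ray_integral_Lq:
  fixes p q :: real
  assumes p: "1 < p" "p < real CARD('n::finite)" and q: "1 / q = 1 / p - 1 / real CARD('n)"
  shows "\<exists>K>0. \<forall>f :: real^'n \<Rightarrow> real. ccont f \<longrightarrow> (\<forall>x. 0 \<le> f x) \<longrightarrow>
    (\<integral>\<^sup>+x. ennreal (enn2real (ray_integral 1 f x) powr q) \<partial>lborel)
      \<le> ennreal (K * (LBINT x. f x powr p) powr (q / p))"
proof -
  define t where "t = q / (q - 1)"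
  define K where "K = 2 + 2 * p / (CARD('n) - p) + 2 * t / (CARD('n) - t)"
  define L where "L = K powr q + 1"
  have L: "0 < L" by (simp add: L_def add_nonneg_pos)
  have "1 / real CARD('n) < 1 / p" using p by (simp add: field_simps)
  then have "0 < 1 / q" by (simp add: q)
  then have q0: "0 < q" by (simp add: zero_less_divide_iff)
  have main: "ennreal (c powr q) * (\<integral>\<^sup>+x. ennreal (enn2real (ray_integral 1 f x) powr q) \<partial>lborel) \<le> ennreal L"
    if c: "0 < c" "c powr p * (LBINT x. f x powr p) \<le> 1" and f: "ccont f" "\<And>x. 0 \<le> f x"
    for c and f :: "real^'n \<Rightarrow> real"
  proof -
    have fm[measurable]: "f \<in> borel_measurable borel" using f(1) by (rule ccont_measurable)
    obtain C where C: "\<And>x. norm (f x) \<le> C" using ccont_bounded[OF f(1)] by blast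
    obtain R where R: "\<And>x. R < norm x \<Longrightarrow> f x = 0" using f(1) unfolding ccont_def by blast
    have int: "integrable lborel (\<lambda>x. f x powr p)"
      using ccont_powr_integrable[OF f(1), of p] p f(2) by simp
    have pw: "(c * f x) powr p = c powr p * f x powr p" for x
      using c f(2) by (simp add: powr_mult)
    have "(\<integral>\<^sup>+x. ennreal ((c * f x) powr p) \<partial>lborel) = ennreal (LBINT x. c powr p * f x powr p)"
      unfolding pw using int by (intro nn_integral_eq_integral) auto
    also have "\<dots> \<le> 1" using c by simp
    finally have "(\<integral>\<^sup>+x. ennreal ((c * f x) powr p) \<partial>lborel) \<le> 1" .
    then have "(\<integral>\<^sup>+x. ennreal (enn2real (ray_integral 1 (\<lambda>x. c * f x) x) powr q) \<partial>lborel) \<le> ennreal (K powr q)"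
      unfolding K_def t_def
      by (intro ray_integral_Lq_normalized[OF p q, where C = "c * C" and R = R])
        (use c f C R in \<open>auto intro!: mult_left_mono abs_le_D1\<close>)
    also have "\<dots> \<le> ennreal L" by (intro ennreal_leI) (simp add: L_def)
    finally have "(\<integral>\<^sup>+x. ennreal (enn2real (ray_integral 1 (\<lambda>x. c * f x) x) powr q) \<partial>lborel) \<le> ennreal L" .
    moreover have "ennreal (enn2real (ray_integral 1 (\<lambda>x. c * f x) x) powr q)
        = ennreal (c powr q) * ennreal (enn2real (ray_integral 1 f x) powr q)" for x
      using c f(2) by (simp add: ray_integral_cmult enn2real_mult powr_mult ennreal_mult)
    ultimately show ?thesis by (simp add: nn_integral_cmult)
  qed
  have "(\<integral>\<^sup>+x. ennreal (enn2real (ray_integral 1 f x) powr q) \<partial>lborel)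
      \<le> ennreal (L * (LBINT x. f x powr p) powr (q / p))" (is "?I \<le> _")
    if f: "ccont f" "\<And>x. 0 \<le> f x" for f :: "real^'n \<Rightarrow> real"
  proof (cases "(LBINT x. f x powr p) = 0")
    case True
    have le: "ennreal (c powr q) * ?I \<le> ennreal L" if "0 < c" for c
      using main[OF that _ f] True by simp
    have "?I \<noteq> \<infinity>" using le[of 1] by (auto simp: top_unique)
    then obtain I where I: "?I = ennreal I" "0 \<le> I" by (metis ennreal_cases infinity_ennreal_def)
    \<comment> \<open>When the \<open>L\<^sup>p\<close> integral vanishes, every multiple
      \<open>c * f\<close> is admissible. A positive \<open>I\<close> would contradict the choice
      \<open>c powr q * I = L + 1\<close>.\<close>
    have "I = 0"
    proof (rule ccontr)
      assume "I \<noteq> 0"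
      with I have "0 < I" by simp
      define c where "c = ((L + 1) / I) powr (1 / q)"
      have c: "0 < c" "c powr q = (L + 1) / I" using L \<open>0 < I\<close> q0 by (auto simp: c_def powr_powr)
      have "c powr q * I \<le> L" using le[OF c(1)] L I by (simp add: ennreal_mult[symmetric])
      then show False using c \<open>0 < I\<close> by simp
    qed
    then show ?thesis using I by simp
  next
    case False
    define F where "F = (LBINT x. f x powr p)"
    have "0 \<le> F" unfolding F_def by (intro Bochner_Integration.integral_nonneg) simp
    with False have F: "0 < F" unfolding F_def by linarith
    define c where "c = F powr (- (1 / p))"
    have "c powr p = F powr - 1" using p by (simp add: c_def powr_powr)
    then have c: "0 < c" "c powr p * F \<le> 1" using F by (auto simp: c_def powr_minus)
    have "c powr q * F powr (q / p) = 1"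
      using F by (simp add: c_def powr_powr powr_add[symmetric])
    then have "?I = ennreal (F powr (q / p)) * (ennreal (c powr q) * ?I)"
      by (simp add: mult.assoc[symmetric] ennreal_mult[symmetric] mult.commute)
    also have "\<dots> \<le> ennreal (F powr (q / p)) * ennreal L"
      using main[OF c(1) _ f] c(2) by (intro mult_left_mono) (auto simp: F_def)
    also have "\<dots> = ennreal (L * F powr (q / p))" using L by (simp add: ennreal_mult[symmetric] mult.commute)
    finally show ?thesis by (simp add: F_def)
  qed
  then show ?thesis using L by (intro exI[of _ L]) auto
qed

section \<open>Ray potentials: fields with prescribed divergence\<close>

lemma ccont_add: "ccont f \<Longrightarrow> ccont g \<Longrightarrow> ccont (\<lambda>x. f x + g x)"
  unfolding ccont_def
proof (elim conjE exE, intro conjI)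
  fix R S assume "\<forall>x. R < norm x \<longrightarrow> f x = 0" "\<forall>x. S < norm x \<longrightarrow> g x = 0"
  then show "\<exists>R. \<forall>x. R < norm x \<longrightarrow> f x + g x = 0" by (intro exI[of _ "max R S"]) auto
qed (intro continuous_on_add)

lemma ccont_cmult: "ccont f \<Longrightarrow> ccont (\<lambda>x. c * f x :: real)"
  by (rule ccont_compose[where g = "\<lambda>y. c * y"]) (auto intro!: continuous_intros)

lemma ccont_translate:
  assumes "ccont f"
  shows "ccont (\<lambda>x. f (x + a))"
proof -
  obtain R where R: "\<And>x. R < norm x \<Longrightarrow> f x = 0" and c: "continuous_on UNIV f"
    using assms unfolding ccont_def by blast
  have "f (x + a) = 0" if "R + norm a < norm x" for x
    using that norm_diff_ineq[of x a] by (intro R) linarith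
  moreover have "continuous_on UNIV (\<lambda>x. f (x + a))"
    by (intro continuous_on_compose2[OF c]) (auto intro!: continuous_intros)
  ultimately show ?thesis unfolding ccont_def by blast
qed

lemma ccont_diff: "ccont f \<Longrightarrow> ccont g \<Longrightarrow> ccont (\<lambda>x. f x - g x :: real)"
  using ccont_add[of f "\<lambda>x. -1 * g x"] ccont_cmult[of g "-1"] by simp

lemma ccont_cdiff: "ccont f \<Longrightarrow> ccont (cdiff h k f :: real^'n::finite \<Rightarrow> real)"
  using ccont_diff[OF ccont_translate[of f "h *\<^sub>R axis k 1"] ccont_translate[of f "- (h *\<^sub>R axis k 1)"]]
  by (simp add: cdiff_def[abs_def])

lemma ccont_shift_mean: 
  fixes f :: "real^'n::finite \<Rightarrow> real"
  assumes "ccont f"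
  shows "ccont (shift_mean h f)"
proof -
  have "ccont (\<lambda>x. \<Sum>i\<in>I. f (x + h *\<^sub>R unit_dir i))" for I :: "('n \<times> bool) set"
  proof (induction I rule: infinite_finite_induct)
    case (insert i I)
    then show ?case using ccont_add[OF ccont_translate[OF assms]] by simp
  qed (auto simp: ccont_def)
  from ccont_cmult[OF this[of UNIV], of "1 / CARD('n \<times> bool)"]
  show ?thesis by (simp add: shift_mean_def[abs_def])
qed

text \<open>The \<open>k\<close>-th component of the field \<open>G\<close> of the overview. The
  weight \<open>snd z $ k\<close> is the factor that the chain rule puts in front of the
  \<open>k\<close>-th partial derivative along the ray.\<close>

definition ray_potential :: "'n \<Rightarrow> (real^'n::finite \<Rightarrow> real) \<Rightarrow> real^'n \<Rightarrow> real"
  where "ray_potential k f x = - (LBINT z. indicator rays z * (snd z $ k * f (x + fst z *\<^sub>R snd z)))"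

lemma rays_nth: "z \<in> rays \<Longrightarrow> 0 \<le> fst z \<and> 1 \<le> snd z $ k \<and> snd z $ k \<le> 2"
  by (auto simp: rays_def mem_box_cart)

lemma ray_potential_bounds:
  fixes f :: "real^'n::finite \<Rightarrow> real"
  assumes f[measurable]: "f \<in> borel_measurable borel" and C: "\<And>y. \<bar>f y\<bar> \<le> C" "0 \<le> C"
    and R: "\<And>y. R < norm y \<Longrightarrow> f y = 0" "0 \<le> R"
  shows "integrable lborel (\<lambda>z. indicator rays z * (snd z $ k * f (x + fst z *\<^sub>R snd z)))" (is "integrable _ ?F")
    and "\<bar>ray_potential k f x\<bar> \<le> 2 * enn2real (ray_integral 1 (\<lambda>y. \<bar>f y\<bar>) x)"
    and "enn2real (ray_integral 1 (\<lambda>y. \<bar>f y\<bar>) x) \<le> 2 * R * C"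
proof -
  have le: "ray_integral 1 (\<lambda>y. \<bar>f y\<bar>) x \<le> ennreal (2 * R * C)"
    using C R by (intro ray_integral_bounded_support) auto
  have Fm: "?F \<in> borel_measurable lborel"
  proof -
    have [measurable]: "(\<lambda>z :: real \<times> (real^'n). snd z $ k) \<in> borel_measurable borel"
      by (intro borel_measurable_continuous_onI continuous_intros)
    show ?thesis by measurable
  qed
  \<comment> \<open>2 is the largest coordinate of a direction in the cube. Removing the weight
    makes the estimates for the nonnegative \<open>ray_integral\<close> available.\<close>
  have Fle: "ennreal (norm (?F z)) \<le> ennreal 2 * (indicator rays z * ennreal \<bar>f (x + (1 * fst z) *\<^sub>R snd z)\<bar>)" for z
  proof (cases "z \<in> rays")
    case True
    then have "\<bar>snd z $ k\<bar> * \<bar>f (x + fst z *\<^sub>R snd z)\<bar> \<le> 2 * \<bar>f (x + fst z *\<^sub>R snd z)\<bar>"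
      using rays_nth[of z k] by (intro mult_right_mono) auto
    then have "ennreal (norm (?F z)) \<le> ennreal (2 * \<bar>f (x + fst z *\<^sub>R snd z)\<bar>)"
      using True by (intro ennreal_leI) (simp add: abs_mult)
    then show ?thesis using True by (simp add: ennreal_mult)
  qed simp
  have "(\<integral>\<^sup>+z. ennreal (norm (?F z)) \<partial>lborel) \<le> (\<integral>\<^sup>+z. ennreal 2 * (indicator rays z * ennreal \<bar>f (x + (1 * fst z) *\<^sub>R snd z)\<bar>) \<partial>lborel)"
    by (intro nn_integral_mono Fle)
  also have "\<dots> = ennreal 2 * ray_integral 1 (\<lambda>y. \<bar>f y\<bar>) x"
    unfolding ray_integral_def by (rule nn_integral_cmult) simp
  finally have F2: "(\<integral>\<^sup>+z. ennreal (norm (?F z)) \<partial>lborel) \<le> ennreal 2 * ray_integral 1 (\<lambda>y. \<bar>f y\<bar>) x" .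
  have top: "ray_integral 1 (\<lambda>y. \<bar>f y\<bar>) x < \<infinity>" using le by (rule le_less_trans) simp
  show "enn2real (ray_integral 1 (\<lambda>y. \<bar>f y\<bar>) x) \<le> 2 * R * C"
    using le C R by (intro enn2real_leI) auto
  have "(\<integral>\<^sup>+z. ennreal (norm (?F z)) \<partial>lborel) < \<infinity>"
    using top by (intro le_less_trans[OF F2]) (simp add: ennreal_mult_less_top)
  then show int: "integrable lborel ?F" using Fm by (intro integrableI_bounded)
  have "\<bar>ray_potential k f x\<bar> \<le> (LBINT z. norm (?F z))"
    unfolding ray_potential_def abs_minus_cancel real_norm_def
    by (rule integral_norm_bound[of lborel ?F, unfolded real_norm_def])
  also have "\<dots> = enn2real (\<integral>\<^sup>+z. ennreal (norm (?F z)) \<partial>lborel)"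
    using Fm by (intro integral_eq_nn_integral) auto
  also have "\<dots> \<le> enn2real (ennreal 2 * ray_integral 1 (\<lambda>y. \<bar>f y\<bar>) x)"
    using top by (intro enn2real_mono F2) (auto simp: ennreal_mult_less_top)
  also have "\<dots> = 2 * enn2real (ray_integral 1 (\<lambda>y. \<bar>f y\<bar>) x)"
    by (simp add: enn2real_mult)
  finally show "\<bar>ray_potential k f x\<bar> \<le> 2 * enn2real (ray_integral 1 (\<lambda>y. \<bar>f y\<bar>) x)" .
qed

lemma ccont_support_bound:
  fixes f :: "'a::euclidean_space \<Rightarrow> real"
  assumes "ccont f"
  obtains C R where "\<And>y. \<bar>f y\<bar> \<le> C" "0 \<le> C" "\<And>y. R < norm y \<Longrightarrow> f y = 0" "0 \<le> R"
proof -
  obtain C where C: "\<And>y. norm (f y) \<le> C" "0 \<le> C" using ccont_bounded[OF assms] by blast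
  obtain R where "\<And>y. R < norm y \<Longrightarrow> f y = 0" using assms unfolding ccont_def by blast
  then show ?thesis using that[of C "max R 0"] C by simp
qed

lemma ray_potential_integrable:
  fixes f :: "real^'n::finite \<Rightarrow> real"
  assumes "ccont f"
  shows "integrable lborel (\<lambda>z. indicator rays z * (snd z $ k * f (x + fst z *\<^sub>R snd z)))"
  by (rule ccont_support_bound[OF assms], rule ray_potential_bounds(1)[OF ccont_measurable[OF assms]])

lemma ray_potential_diff:
  fixes f g :: "real^'n::finite \<Rightarrow> real"
  assumes "ccont f" "ccont g"
  shows "ray_potential k (\<lambda>x. f x - g x) x = ray_potential k f x - ray_potential k g x"
proof -
  have "(LBINT z. indicator rays z * (snd z $ k * (f (x + fst z *\<^sub>R snd z) - g (x + fst z *\<^sub>R snd z))))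
     = (LBINT z. indicator rays z * (snd z $ k * f (x + fst z *\<^sub>R snd z)) - indicator rays z * (snd z $ k * g (x + fst z *\<^sub>R snd z)))"
    by (simp add: right_diff_distrib)
  then show ?thesis unfolding ray_potential_def using assms by (simp add: ray_potential_integrable)
qed

lemma ray_potential_cmult: "ray_potential k (\<lambda>x. c * f x) x = c * ray_potential k f x"
proof -
  have "indicator rays z * (snd z $ k * (c * f (x + fst z *\<^sub>R snd z)))
      = c * (indicator rays z * (snd z $ k * f (x + fst z *\<^sub>R snd z)))" for z by simp
  then show ?thesis unfolding ray_potential_def by (simp only: integral_mult_right_zero mult_minus_right)
qed

lemma ray_potential_translate: "ray_potential k (\<lambda>x. f (x + a)) x = ray_potential k f (x + a)"
proof -
  have "x + fst z *\<^sub>R snd z + a = x + a + fst z *\<^sub>R snd z" for z by simp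
  then show ?thesis unfolding ray_potential_def by (simp only:)
qed

text \<open>Only translations have to commute with the integral. Ray potentials themselves are never
  differentiated: differences are moved onto the smooth function inside.\<close>

lemma ray_potential_cdiff:
  fixes f :: "real^'n::finite \<Rightarrow> real"
  assumes "ccont f"
  shows "ray_potential k (cdiff h j f) x = cdiff h j (ray_potential k f) x"
  using ray_potential_diff[OF ccont_translate[OF assms, of "h *\<^sub>R axis j 1"] ccont_translate[OF assms, of "- (h *\<^sub>R axis j 1)"], of k x]
    ray_potential_translate[of k f "h *\<^sub>R axis j 1" x] ray_potential_translate[of k f "- (h *\<^sub>R axis j 1)" x]
  by (simp add: cdiff_def[abs_def])

lemma ray_potential_measurable[measurable]:
  fixes f :: "real^'n::finite \<Rightarrow> real"
  assumes [measurable]: "f \<in> borel_measurable borel"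
  shows "ray_potential k f \<in> borel_measurable borel"
proof -
  have "(\<lambda>p. f (fst p + (1 * fst (snd p)) *\<^sub>R snd (snd p))) \<in> borel_measurable (borel \<Otimes>\<^sub>M (borel :: (real \<times> (real^'n)) measure))"
    unfolding borel_prod by (rule measurable_compose[OF joint_ray_point_measurable]) simp
  then have [measurable]: "(\<lambda>(x, z). f (x + fst z *\<^sub>R snd z)) \<in> borel_measurable (borel \<Otimes>\<^sub>M (lborel :: (real \<times> (real^'n)) measure))"
    by (simp add: case_prod_beta')
  have [measurable]: "(\<lambda>z :: real \<times> (real^'n). snd z $ k) \<in> borel_measurable borel"
    by (intro borel_measurable_continuous_onI continuous_intros)
  have [measurable]: "rays \<in> sets (lborel :: (real \<times> (real^'n)) measure)" by simp
  show ?thesis unfolding ray_potential_def[abs_def] by measurable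
qed

lemma directional_deriv:
  fixes u :: "real^'n::finite \<Rightarrow> real"
  assumes "\<And>x. u differentiable (at x)"
  shows "((\<lambda>r. u (x + r *\<^sub>R w)) has_real_derivative (\<Sum>k\<in>UNIV. w $ k * partial_deriv k u (x + r *\<^sub>R w))) (at r)"
proof -
  let ?D = "frechet_derivative u (at (x + r *\<^sub>R w))"
  have D: "(u has_derivative ?D) (at (x + r *\<^sub>R w))"
    using assms frechet_derivative_works by blast
  have lin: "linear ?D" by (rule linear_frechet_derivative[OF assms])
  have "((\<lambda>r. x + r *\<^sub>R w) has_derivative (\<lambda>r. r *\<^sub>R w)) (at r)"
    by (auto intro!: derivative_eq_intros)
  from diff_chain_at[OF this D]
  have "((\<lambda>r. u (x + r *\<^sub>R w)) has_derivative (\<lambda>t. ?D (t *\<^sub>R w))) (at r)"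
    by (simp add: o_def)
  moreover have "?D (t *\<^sub>R w) = (\<Sum>k\<in>UNIV. w $ k * partial_deriv k u (x + r *\<^sub>R w)) * t" for t
  proof -
    have "(\<Sum>k\<in>UNIV. w $ k *\<^sub>R axis k 1) = w"
      using basis_expansion[of w] by (simp add: scalar_mult_eq_scaleR)
    then have "?D w = ?D (\<Sum>k\<in>UNIV. w $ k *\<^sub>R axis k 1)" by simp
    also have "\<dots> = (\<Sum>k\<in>UNIV. w $ k * partial_deriv k u (x + r *\<^sub>R w))"
      using lin by (simp add: linear_sum linear_cmul partial_deriv_def)
    finally show ?thesis using lin by (simp add: linear_cmul)
  qed
  ultimately show ?thesis by (simp add: has_field_derivative_def mult_commute_abs)
qed

text \<open>For every direction \<open>w\<close> the integral of \<open>- d/dr u(x + r w)\<close> over \<open>r \<ge> 0\<close> is \<open>u(x)\<close>. Since ray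
  potentials commute with derivatives, \<open>u\<close> is the divergence of its ray potentials.\<close>

lemma ray_potential_divergence:
  fixes u :: "real^'n::finite \<Rightarrow> real"
  assumes u: "u \<in> Cc_infinity"
  shows "(\<Sum>k\<in>UNIV. ray_potential k (partial_deriv k u) x) = u x"
proof -
  note cc = Cc_ccont[OF Cc_partial_deriv[OF u]]
  define D where "D r w = (\<Sum>k\<in>UNIV. w $ k * partial_deriv k u (x + r *\<^sub>R w))" for r w
  have "\<exists>R. \<forall>y. R < norm y \<longrightarrow> partial_deriv k u y = 0" for k
    using cc[of k] unfolding ccont_def by blast
  then obtain Rk where Rk: "\<And>k y. Rk k < norm y \<Longrightarrow> partial_deriv k u y = 0" by metis
  obtain R0 where R0: "\<And>y. R0 < norm y \<Longrightarrow> u y = 0" using Cc_ccont[OF u] unfolding ccont_def by blast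
  \<comment> \<open>From parameter \<open>L\<close> on, a ray from \<open>x\<close> has left the
    supports of \<open>u\<close> and of all its partial derivatives, so the improper integral along
    it is one over \<open>{0..L}\<close>. The sum over \<open>k\<close> serves as a common bound for
    the radii.\<close>
  define L where "L = norm x + \<bar>R0\<bar> + (\<Sum>k\<in>UNIV. \<bar>Rk k\<bar>) + 1"
  have L: "0 \<le> L" by (simp add: L_def sum_nonneg)
  have far: "L - norm x \<le> norm (x + r *\<^sub>R w)" if "L \<le> r" "w \<in> cbox 1 2" for r w
  proof -
    have "r * 1 \<le> r * norm w"
    proof (intro mult_left_mono)
      have "1 \<le> w $ undefined" using that(2) by (simp add: mem_box_cart)
      then show "1 \<le> norm w"
        using component_le_norm_cart[of w undefined] by linarith
      show "0 \<le> r" using that L by simp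
    qed
    then have "r \<le> norm (r *\<^sub>R w)" using that L by simp
    then show ?thesis using that norm_diff_ineq[of "r *\<^sub>R w" x] by (simp add: add.commute)
  qed
  have Rkle: "\<bar>Rk k\<bar> \<le> (\<Sum>k\<in>UNIV. \<bar>Rk k\<bar>)" for k by (rule member_le_sum) auto
  have far0: "u (x + r *\<^sub>R w) = 0" "D r w = 0" if "L \<le> r" "w \<in> cbox 1 2" for r w
  proof -
    have "R0 < norm (x + r *\<^sub>R w)" "Rk k < norm (x + r *\<^sub>R w)" for k
      using far[OF that] Rkle[of k] sum_nonneg[of UNIV "\<lambda>k. \<bar>Rk k\<bar>"] by (auto simp: L_def)
    then show "u (x + r *\<^sub>R w) = 0" "D r w = 0" by (auto simp: R0 Rk D_def)
  qed
  have inner: "(LBINT r. indicator rays (r, w) * D r w) = - u x * indicator (cbox 1 2) w" for w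
  proof (cases "w \<in> cbox 1 2")
    case True
    have "indicator rays (r, w) * D r w = D r w * indicator {0..L} r" for r
      using True far0[of r w] by (cases "r \<le> L") (auto simp: rays_def indicator_def)
    then have "(LBINT r. indicator rays (r, w) * D r w) = (LBINT r. D r w * indicator {0..L} r)"
      by (simp only:)
    also have "\<dots> = u (x + L *\<^sub>R w) - u (x + 0 *\<^sub>R w)"
    proof (rule integral_FTC_Icc_real[OF L])
      show "DERIV (\<lambda>r. u (x + r *\<^sub>R w)) r :> D r w" for r
        unfolding D_def by (rule directional_deriv[OF Cc_differentiable[OF u]])
      have c: "continuous_on UNIV (partial_deriv k u)" for k using cc[of k] by (simp add: ccont_def)
      have "continuous_on UNIV (\<lambda>r. D r w)"
        unfolding D_def by (intro continuous_intros continuous_on_compose2[OF c]) auto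
      then show "isCont (\<lambda>r. D r w) r" for r by (simp add: continuous_on_eq_continuous_at)
    qed
    finally show ?thesis using far0(1)[OF order_refl True] True by simp
  qed (simp add: rays_def)
  have int: "integrable lborel (\<lambda>z. indicator rays z * D (fst z) (snd z))"
  proof -
    have "integrable lborel (\<lambda>z. \<Sum>k\<in>UNIV. indicator rays z * (snd z $ k * partial_deriv k u (x + fst z *\<^sub>R snd z)))"
      by (intro Bochner_Integration.integrable_sum ray_potential_integrable cc)
    then show ?thesis by (simp add: D_def sum_distrib_left)
  qed
  have "(\<Sum>k\<in>UNIV. ray_potential k (partial_deriv k u) x) = - (LBINT z. indicator rays z * D (fst z) (snd z))"
  proof -
    have "(LBINT z. indicator rays z * D (fst z) (snd z))
        = (LBINT z. (\<Sum>k\<in>UNIV. indicator rays z * (snd z $ k * partial_deriv k u (x + fst z *\<^sub>R snd z))))"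
      by (simp only: D_def sum_distrib_left)
    also have "\<dots> = (\<Sum>k\<in>UNIV. LBINT z. indicator rays z * (snd z $ k * partial_deriv k u (x + fst z *\<^sub>R snd z)))"
      by (rule Bochner_Integration.integral_sum) (rule ray_potential_integrable[OF cc])
    finally show ?thesis by (simp add: ray_potential_def sum_negf)
  qed
  also have "(LBINT z. indicator rays z * D (fst z) (snd z)) = (LBINT w. (LBINT r. indicator rays (r, w) * D r w))"
    using lborel_pair.integral_snd[of "\<lambda>r w. indicator rays (r, w) * D r w"] int
    by (simp add: lborel_prod case_prod_beta')
  also have "\<dots> = - u x"
    unfolding inner using emeasure_cbox_1_2[where 'n = 'n] by (simp add: measure_def)
  finally show ?thesis by simp
qed

lemma ray_potential_Lq:
  fixes p q :: real
  assumes p: "1 < p" "p < real CARD('n::finite)" and q: "1 / q = 1 / p - 1 / real CARD('n)"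
  shows "\<exists>K>0. \<forall>(g :: real^'n \<Rightarrow> real) k. ccont g \<longrightarrow>
    integrable lborel (\<lambda>x. \<bar>ray_potential k g x\<bar> powr q) \<and>
    Lnorm q (ray_potential k g) \<le> K * Lnorm p g"
proof -
  have "1 / real CARD('n) < 1 / p" using p by (simp add: field_simps)
  then have "0 < 1 / q" by (simp add: q)
  then have q0: "0 < q" by (simp add: zero_less_divide_iff)
  obtain K where K: "0 < K" "\<And>f :: real^'n \<Rightarrow> real. ccont f \<Longrightarrow> (\<And>x. 0 \<le> f x) \<Longrightarrow>
    (\<integral>\<^sup>+x. ennreal (enn2real (ray_integral 1 f x) powr q) \<partial>lborel)
      \<le> ennreal (K * (LBINT x. f x powr p) powr (q / p))"
    using ray_integral_Lq[OF p q] by metis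
  have main: "integrable lborel (\<lambda>x. \<bar>ray_potential k g x\<bar> powr q) \<and>
    Lnorm q (ray_potential k g) \<le> (2 * K powr (1 / q)) * Lnorm p g" if g: "ccont g" for g :: "real^'n \<Rightarrow> real" and k
  proof -
    have gm[measurable]: "g \<in> borel_measurable borel" by (rule ccont_measurable[OF g])
    obtain C R where CR: "\<And>y. \<bar>g y\<bar> \<le> C" "0 \<le> C" "\<And>y. R < norm y \<Longrightarrow> g y = 0" "0 \<le> R"
      using ccont_support_bound[OF g] by blast
    define F where "F = (LBINT x. \<bar>g x\<bar> powr p)"
    have F: "0 \<le> F" unfolding F_def by (intro Bochner_Integration.integral_nonneg) simp
    have ag: "ccont (\<lambda>x. \<bar>g x\<bar>)"
      by (rule ccont_compose[OF g]) (auto intro!: continuous_intros)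
    have "(\<integral>\<^sup>+x. ennreal (norm (\<bar>ray_potential k g x\<bar> powr q)) \<partial>lborel)
        \<le> (\<integral>\<^sup>+x. ennreal (2 powr q) * ennreal (enn2real (ray_integral 1 (\<lambda>y. \<bar>g y\<bar>) x) powr q) \<partial>lborel)"
    proof (intro nn_integral_mono)
      fix x
      have "\<bar>ray_potential k g x\<bar> powr q \<le> (2 * enn2real (ray_integral 1 (\<lambda>y. \<bar>g y\<bar>) x)) powr q"
        using q0 by (intro powr_mono2 ray_potential_bounds(2)[OF gm CR]) auto
      then show "ennreal (norm (\<bar>ray_potential k g x\<bar> powr q)) \<le> ennreal (2 powr q) * ennreal (enn2real (ray_integral 1 (\<lambda>y. \<bar>g y\<bar>) x) powr q)"
        by (simp add: ennreal_mult[symmetric] powr_mult)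
    qed
    also have "\<dots> = ennreal (2 powr q) * (\<integral>\<^sup>+x. ennreal (enn2real (ray_integral 1 (\<lambda>y. \<bar>g y\<bar>) x) powr q) \<partial>lborel)"
      by (rule nn_integral_cmult) simp
    also have "\<dots> \<le> ennreal (2 powr q) * ennreal (K * F powr (q / p))"
      unfolding F_def by (intro mult_left_mono K(2) ag) auto
    also have "\<dots> = ennreal (2 powr q * (K * F powr (q / p)))" using K by (simp add: ennreal_mult)
    finally have le: "(\<integral>\<^sup>+x. ennreal (norm (\<bar>ray_potential k g x\<bar> powr q)) \<partial>lborel) \<le> ennreal (2 powr q * (K * F powr (q / p)))" .
    have m: "(\<lambda>x. \<bar>ray_potential k g x\<bar> powr q) \<in> borel_measurable lborel"
      using ray_potential_measurable[OF gm, of k] by simp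
    have int: "integrable lborel (\<lambda>x. \<bar>ray_potential k g x\<bar> powr q)"
      using m le_less_trans[OF le] by (intro integrableI_bounded) auto
    have "(LBINT x. \<bar>ray_potential k g x\<bar> powr q) \<le> 2 powr q * (K * F powr (q / p))"
    proof -
      have "ennreal (LBINT x. \<bar>ray_potential k g x\<bar> powr q) \<le> ennreal (2 powr q * (K * F powr (q / p)))"
        using le nn_integral_eq_integral[OF int] by simp
      then show ?thesis using K by (subst (asm) ennreal_le_iff) auto
    qed
    then have "Lnorm q (ray_potential k g) \<le> (2 powr q * (K * F powr (q / p))) powr (1 / q)"
      unfolding Lnorm_def using q0 by (auto intro!: powr_mono2 Bochner_Integration.integral_nonneg)
    also have "\<dots> = 2 * K powr (1 / q) * F powr (1 / p)"
      using q0 K by (simp add: powr_mult powr_powr)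
    finally show ?thesis using int by (simp add: Lnorm_def F_def)
  qed
  show ?thesis using K by (intro exI[of _ "2 * K powr (1 / q)"]) (auto simp: main)
qed

section \<open>Discretization of the equation\<close>

lemma Lnorm_nonneg: "0 \<le> Lnorm q f"
  by (simp add: Lnorm_def)

lemma sum_powr_le:
  fixes t :: "'i \<Rightarrow> real"
  assumes "1 \<le> q" "finite I" "\<And>i. i \<in> I \<Longrightarrow> 0 \<le> t i"
  shows "(\<Sum>i\<in>I. t i) powr q \<le> real (card I) powr q * (\<Sum>i\<in>I. t i powr q)"
proof -
  define S where "S = (\<Sum>i\<in>I. t i powr q)"
  have S: "0 \<le> S" by (simp add: S_def sum_nonneg)
  have "t i \<le> S powr (1 / q)" if "i \<in> I" for i
  proof -
    have "t i powr q \<le> S" unfolding S_def using that assms by (intro member_le_sum) auto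
    then have "(t i powr q) powr (1 / q) \<le> S powr (1 / q)" using assms by (intro powr_mono2) auto
    then show ?thesis using assms(1) assms(3)[OF that] by (simp add: powr_powr)
  qed
  then have "(\<Sum>i\<in>I. t i) \<le> card I * S powr (1 / q)" by (rule sum_bounded_above)
  then have "(\<Sum>i\<in>I. t i) powr q \<le> (card I * S powr (1 / q)) powr q"
    using assms by (intro powr_mono2) (auto intro: sum_nonneg)
  also have "\<dots> = real (card I) powr q * S" using assms S by (simp add: powr_mult powr_powr)
  finally show ?thesis by (simp add: S_def)
qed

text \<open>A crude substitute for Minkowski's inequality. Estimating each summand by a power of the
  whole sum costs \<open>card I\<close> once for the integrand and once for the root of the sum of
  integrals, hence the square.\<close>

lemma Lnorm_le_sum:
  fixes F :: "real^'n::finite \<Rightarrow> 'b::real_normed_vector" and a :: "'i \<Rightarrow> real^'n \<Rightarrow> real"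
  assumes q: "1 \<le> q" and I: "finite I" and int: "\<And>i. i \<in> I \<Longrightarrow> integrable lborel (\<lambda>x. \<bar>a i x\<bar> powr q)"
    and le: "\<And>x. norm (F x) \<le> (\<Sum>i\<in>I. \<bar>a i x\<bar>)"
  shows "Lnorm q F \<le> (real (card I))\<^sup>2 * (\<Sum>i\<in>I. Lnorm q (a i))"
proof (cases "I = {}")
  case True
  then have "F x = 0" for x using le[of x] by simp
  then show ?thesis using True q by (simp add: Lnorm_def)
next
  case False
  then have c1: "1 \<le> real (card I)" using I by (simp add: Suc_le_eq card_gt_0_iff)
  define c where "c = real (card I)"
  define X where "X i = (LBINT x. \<bar>a i x\<bar> powr q)" for i
  have X: "0 \<le> X i" for i unfolding X_def by (intro Bochner_Integration.integral_nonneg) simp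
  have "norm (F x) powr q \<le> c powr q * (\<Sum>i\<in>I. \<bar>a i x\<bar> powr q)" for x
  proof -
    have "norm (F x) powr q \<le> (\<Sum>i\<in>I. \<bar>a i x\<bar>) powr q" using le q by (intro powr_mono2) auto
    also have "\<dots> \<le> c powr q * (\<Sum>i\<in>I. \<bar>a i x\<bar> powr q)"
      unfolding c_def using q I by (intro sum_powr_le) auto
    finally show ?thesis .
  qed
  \<comment> \<open>Only the right-hand side has to be integrable: if the left one is not, its
    Bochner integral is 0.\<close>
  then have "(LBINT x. norm (F x) powr q) \<le> (LBINT x. c powr q * (\<Sum>i\<in>I. \<bar>a i x\<bar> powr q))"
    by (intro integral_mono') (auto intro!: integrable_mult_right Bochner_Integration.integrable_sum int mult_nonneg_nonneg sum_nonneg)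
  also have "\<dots> = c powr q * (\<Sum>i\<in>I. X i)"
    using int by (simp add: X_def)
  finally have 1: "(LBINT x. norm (F x) powr q) \<le> c powr q * (\<Sum>i\<in>I. X i)" .
  have "(\<Sum>i\<in>I. X i) powr (1 / q) \<le> c * (\<Sum>i\<in>I. X i powr (1 / q))" (is "_ \<le> c * ?S")
  proof -
    have S: "0 \<le> ?S" by (simp add: sum_nonneg)
    have "X i \<le> ?S powr q" if "i \<in> I" for i
    proof -
      have "X i powr (1 / q) \<le> ?S" using that I by (intro member_le_sum) auto
      then have "(X i powr (1 / q)) powr q \<le> ?S powr q" using q by (intro powr_mono2) auto
      then show ?thesis using q X[of i] by (simp add: powr_powr)
    qed
    then have "(\<Sum>i\<in>I. X i) \<le> c * ?S powr q" unfolding c_def by (rule sum_bounded_above)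
    then have "(\<Sum>i\<in>I. X i) powr (1 / q) \<le> (c * ?S powr q) powr (1 / q)"
      using q X by (intro powr_mono2) (auto intro: sum_nonneg)
    also have "\<dots> = c powr (1 / q) * ?S" using q S c1 by (simp add: powr_mult powr_powr c_def)
    also have "\<dots> \<le> c * ?S"
    proof (intro mult_right_mono S)
      show "c powr (1 / q) \<le> c" using powr_mono[of "1 / q" 1 c] q c1 by (simp add: c_def)
    qed
    finally show ?thesis .
  qed
  then have "c * (\<Sum>i\<in>I. X i) powr (1 / q) \<le> c * (c * (\<Sum>i\<in>I. X i powr (1 / q)))"
    using c1 by (intro mult_left_mono) (auto simp: c_def)
  then have 2: "c * (\<Sum>i\<in>I. X i) powr (1 / q) \<le> c\<^sup>2 * (\<Sum>i\<in>I. X i powr (1 / q))"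
    by (simp add: power2_eq_square mult.assoc)
  have "Lnorm q F \<le> (c powr q * (\<Sum>i\<in>I. X i)) powr (1 / q)"
    unfolding Lnorm_def using q 1 by (intro powr_mono2) (auto intro!: Bochner_Integration.integral_nonneg)
  also have "\<dots> = c * (\<Sum>i\<in>I. X i) powr (1 / q)"
    using q c1 X by (simp add: powr_mult powr_powr c_def sum_nonneg)
  also note 2
  finally show ?thesis by (simp add: c_def X_def Lnorm_def)
qed

lemma Lnorm_add:
  fixes f g :: "real^'n::finite \<Rightarrow> real"
  assumes q: "1 \<le> q" and f: "integrable lborel (\<lambda>x. \<bar>f x\<bar> powr q)" and g: "integrable lborel (\<lambda>x. \<bar>g x\<bar> powr q)"
    and m: "f \<in> borel_measurable borel" "g \<in> borel_measurable borel"
  shows "integrable lborel (\<lambda>x. \<bar>f x + g x\<bar> powr q)"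
    and "Lnorm q (\<lambda>x. f x + g x) \<le> 4 * (Lnorm q f + Lnorm q g)"
proof -
  let ?a = "\<lambda>b. if b then f else g"
  have le: "norm (f x + g x) \<le> (\<Sum>b\<in>UNIV. \<bar>?a b x\<bar>)" for x
    by (simp add: UNIV_bool abs_triangle_ineq)
  have int: "integrable lborel (\<lambda>x. \<bar>?a b x\<bar> powr q)" for b
    using f g by (cases b) auto
  show "Lnorm q (\<lambda>x. f x + g x) \<le> 4 * (Lnorm q f + Lnorm q g)"
    using Lnorm_le_sum[of q UNIV ?a "\<lambda>x. f x + g x", OF q finite int le]
    by (simp add: UNIV_bool add.commute)
  have "\<bar>f x + g x\<bar> powr q \<le> 2 powr q * (\<bar>f x\<bar> powr q + \<bar>g x\<bar> powr q)" for x
  proof -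
    have "\<bar>f x + g x\<bar> powr q \<le> (\<Sum>b\<in>UNIV. \<bar>?a b x\<bar>) powr q"
      using le[of x] q by (intro powr_mono2) auto
    also have "\<dots> \<le> 2 powr q * (\<Sum>b\<in>UNIV. \<bar>?a b x\<bar> powr q)"
      using sum_powr_le[of q UNIV "\<lambda>b. \<bar>?a b x\<bar>"] q by simp
    finally show ?thesis by (simp add: UNIV_bool add.commute)
  qed
  then show "integrable lborel (\<lambda>x. \<bar>f x + g x\<bar> powr q)"
    by (intro Bochner_Integration.integrable_bound[OF integrable_mult_right[OF Bochner_Integration.integrable_add[OF f g], of "2 powr q"]])
      (use m in auto)
qed

section \<open>Consistency of the difference equation\<close>

lemma partial_deriv_commute:
  fixes f :: "real^'n::finite \<Rightarrow> real"
  assumes f: "f \<in> Cc_infinity"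
  shows "partial_deriv i (partial_deriv j f) = partial_deriv j (partial_deriv i f)"
proof
  fix x
  let ?d = "\<bar>partial_deriv i (partial_deriv j f) x - partial_deriv j (partial_deriv i f) x\<bar>"
  have "?d \<le> e" if e: "0 < e" for e
  proof -
    obtain d1 where d1: "0 < d1" "\<And>h x. 0 < h \<Longrightarrow> h < d1 \<Longrightarrow>
      \<bar>cdiff h i (cdiff h j f) x - 4 * h\<^sup>2 * partial_deriv j (partial_deriv i f) x\<bar> \<le> e * h\<^sup>2"
      using cdiff_cdiff_approx[OF f e, of i j] by blast
    obtain d2 where d2: "0 < d2" "\<And>h x. 0 < h \<Longrightarrow> h < d2 \<Longrightarrow>
      \<bar>cdiff h j (cdiff h i f) x - 4 * h\<^sup>2 * partial_deriv i (partial_deriv j f) x\<bar> \<le> e * h\<^sup>2"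
      using cdiff_cdiff_approx[OF f e, of j i] by blast
    define h where "h = min d1 d2 / 2"
    have h: "0 < h" "h < d1" "h < d2" using d1 d2 by (auto simp: h_def)
    \<comment> \<open>The two iterated differences agree exactly, and each approximates one of the
      two mixed derivatives.\<close>
    have "cdiff h i (cdiff h j f) x = cdiff h j (cdiff h i f) x"
      by (simp add: cdiff_def algebra_simps)
    then have "\<bar>4 * h\<^sup>2 * partial_deriv i (partial_deriv j f) x - 4 * h\<^sup>2 * partial_deriv j (partial_deriv i f) x\<bar> \<le> 2 * e * h\<^sup>2"
      using d1(2)[OF h(1,2), of x] d2(2)[OF h(1,3), of x] by linarith
    also have "\<bar>4 * h\<^sup>2 * partial_deriv i (partial_deriv j f) x - 4 * h\<^sup>2 * partial_deriv j (partial_deriv i f) x\<bar> = 4 * h\<^sup>2 * ?d"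
      by (simp add: right_diff_distrib[symmetric] abs_mult)
    finally have "h\<^sup>2 * (4 * ?d) \<le> h\<^sup>2 * (2 * e)" by simp
    then have "4 * ?d \<le> 2 * e" using h by (simp only: mult_le_cancel_left_pos zero_less_power)
    then have "?d \<le> e / 2" by simp
    also have "e / 2 \<le> e" using e by simp
    finally show ?thesis .
  qed
  then have "?d \<le> 0" by (rule field_le_epsilon) simp
  then show "partial_deriv i (partial_deriv j f) x = partial_deriv j (partial_deriv i f) x" by simp
qed

text \<open>Two half steps reach the neighbours at distance \<open>h\<close>, so second central
  differences with step \<open>h / 2\<close> add up to the discrete Laplacian.\<close>

lemma shift_mean_minus_id:
  "shift_mean h v x - v x = (\<Sum>k\<in>UNIV. cdiff (h / 2) k (cdiff (h / 2) k v) x) / (2 * real CARD('n))"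
  for v :: "real^'n::finite \<Rightarrow> real"
proof -
  have 1: "cdiff (h / 2) k (cdiff (h / 2) k v) x = v (x + h *\<^sub>R axis k 1) + v (x - h *\<^sub>R axis k 1) - 2 * v x" for k
  proof -
    have e: "x + (h / 2) *\<^sub>R axis k 1 + (h / 2) *\<^sub>R axis k 1 = x + h *\<^sub>R axis k (1::real)"
      "x - (h / 2) *\<^sub>R axis k 1 - (h / 2) *\<^sub>R axis k 1 = x - h *\<^sub>R axis k (1::real)"
      by (simp_all add: add.assoc diff_diff_eq scaleR_left_distrib[symmetric])
    show ?thesis unfolding cdiff_def e add_diff_cancel_right' diff_add_cancel by linarith
  qed
  have "(\<Sum>i\<in>UNIV. v (x + h *\<^sub>R unit_dir i)) = (\<Sum>k\<in>UNIV. \<Sum>b\<in>UNIV. v (x + h *\<^sub>R unit_dir (k, b)))"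
    unfolding UNIV_Times_UNIV[symmetric] by (simp add: sum.cartesian_product)
  also have "\<dots> = (\<Sum>k\<in>UNIV. v (x + h *\<^sub>R axis k 1) + v (x - h *\<^sub>R axis k 1))"
    by (simp add: UNIV_bool unit_dir_def add.commute)
  finally have "shift_mean h v x = (\<Sum>k\<in>UNIV. v (x + h *\<^sub>R axis k 1) + v (x - h *\<^sub>R axis k 1)) / (2 * real CARD('n))"
    by (simp add: shift_mean_def mult.commute)
  then show ?thesis unfolding 1 by (simp add: sum_subtractf diff_divide_distrib)
qed

text \<open>With \<open>n\<close> the dimension, \<open>shift_mean h v - v\<close> is
  \<open>h\<^sup>2 / (2 * n)\<close> times the Laplacian of \<open>v\<close> up to
  \<open>o(h\<^sup>2)\<close>. The differences with full step give \<open>4 * h\<^sup>2\<close>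
  times the \<open>i\<close>-th derivative of the divergence of \<open>H\<close>, which is the same
  Laplacian; hence the factor \<open>8 * n\<close>. For an error uniform in \<open>x\<close>,
  differences of \<open>ray_potential j g\<close> are rewritten as ray potentials of differences of
  \<open>g\<close>.\<close>

lemma discrete_laplace_consistency:
  fixes i :: "'n::finite" and u g :: "real^'n \<Rightarrow> real" and F :: "'n \<Rightarrow> real^'n \<Rightarrow> real"
  assumes u: "u \<in> Cc_infinity" and F: "\<And>k. F k \<in> Cc_infinity" and g: "g \<in> Cc_infinity"
    and eq: "\<And>x. (\<Sum>k\<in>UNIV. partial_deriv k (partial_deriv k u) x) = (\<Sum>k\<in>UNIV. partial_deriv k (F k) x) + g x"
    and e: "0 < e"
  defines "v \<equiv> partial_deriv i u"
  defines "H \<equiv> (\<lambda>j x. F j x + ray_potential j g x)"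
  obtains d where "0 < d" "\<And>h x. 0 < h \<Longrightarrow> h < d \<Longrightarrow>
    \<bar>shift_mean h v x - v x - (\<Sum>j\<in>UNIV. cdiff h j (cdiff h i (H j)) x) / (8 * real CARD('n))\<bar> \<le> e * h\<^sup>2"
proof -
  let ?n = "real CARD('n)"
  have n: "0 < ?n" by simp
  have v: "v \<in> Cc_infinity" unfolding v_def by (rule Cc_partial_deriv[OF u])
  obtain R1 where R1: "\<And>y. R1 < norm y \<Longrightarrow> g y = 0" "0 \<le> R1"
    using ccont_support_bound[OF Cc_ccont[OF g]] by metis
  have "\<exists>R\<ge>0. \<forall>y. R < norm y \<longrightarrow> partial_deriv j (partial_deriv i g) y = 0" for j
    using ccont_support_bound[OF Cc_ccont[OF Cc_partial_deriv[OF Cc_partial_deriv[OF g, of i], of j]]] by metis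
  then obtain R2 where R2: "\<And>j. 0 \<le> R2 j" "\<And>j y. R2 j < norm y \<Longrightarrow> partial_deriv j (partial_deriv i g) y = 0"
    by metis
  \<comment> \<open>The iterated differences of \<open>g\<close> shift the argument by two vectors
    shorter than 1, which enlarges the support radius \<open>R1\<close> by 2; the radii
    \<open>R2 j\<close> cover the second derivatives.\<close>
  define R where "R = R1 + 2 + (\<Sum>j\<in>UNIV. R2 j)"
  have R2le: "R2 j \<le> (\<Sum>j\<in>UNIV. R2 j)" for j by (rule member_le_sum) (auto simp: R2)
  have R: "0 \<le> R" "\<And>j. R2 j \<le> R" "R1 + 2 \<le> R"
    using R1(2) R2le R2(1) by (auto simp: R_def add_increasing sum_nonneg)
  \<comment> \<open>The error coefficients \<open>4 + 1 + 4 * R\<close> below are at most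
    \<open>8 * (1 + R)\<close>, and the 8 cancels against the denominator.\<close>
  define e1 where "e1 = e / (1 + R)"
  have e1: "0 < e1" using e R by (simp add: e1_def)
  have "\<exists>d>0. \<forall>h x. 0 < h \<longrightarrow> h < d \<longrightarrow>
    \<bar>cdiff h k (cdiff h k v) x - 4 * h\<^sup>2 * partial_deriv k (partial_deriv k v) x\<bar> \<le> e1 * h\<^sup>2" for k
    using cdiff_cdiff_approx[OF v e1, of k k] by metis
  then obtain dv where dv: "\<And>k. 0 < dv k" "\<And>k h x. 0 < h \<Longrightarrow> h < dv k \<Longrightarrow>
    \<bar>cdiff h k (cdiff h k v) x - 4 * h\<^sup>2 * partial_deriv k (partial_deriv k v) x\<bar> \<le> e1 * h\<^sup>2" by metis
  have "\<exists>d>0. \<forall>h x. 0 < h \<longrightarrow> h < d \<longrightarrow>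
    \<bar>cdiff h k (cdiff h i (F k)) x - 4 * h\<^sup>2 * partial_deriv i (partial_deriv k (F k)) x\<bar> \<le> e1 * h\<^sup>2" for k
    using cdiff_cdiff_approx[OF F e1, of k i] by metis
  then obtain dF where dF: "\<And>k. 0 < dF k" "\<And>k h x. 0 < h \<Longrightarrow> h < dF k \<Longrightarrow>
    \<bar>cdiff h k (cdiff h i (F k)) x - 4 * h\<^sup>2 * partial_deriv i (partial_deriv k (F k)) x\<bar> \<le> e1 * h\<^sup>2" by metis
  have "\<exists>d>0. \<forall>h x. 0 < h \<longrightarrow> h < d \<longrightarrow>
    \<bar>cdiff h i (cdiff h k g) x - 4 * h\<^sup>2 * partial_deriv k (partial_deriv i g) x\<bar> \<le> e1 * h\<^sup>2" for k
    using cdiff_cdiff_approx[OF g e1, of i k] by metis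
  then obtain dg where dg: "\<And>k. 0 < dg k" "\<And>k h x. 0 < h \<Longrightarrow> h < dg k \<Longrightarrow>
    \<bar>cdiff h i (cdiff h k g) x - 4 * h\<^sup>2 * partial_deriv k (partial_deriv i g) x\<bar> \<le> e1 * h\<^sup>2" by metis
  define d where "d = Min (insert 1 (range dv \<union> range dF \<union> range dg))"
  have d0: "0 < d" unfolding d_def using dv(1) dF(1) dg(1) by (subst Min_gr_iff) auto
  have dle: "d \<le> 1" "d \<le> dv k" "d \<le> dF k" "d \<le> dg k" for k
    unfolding d_def by (rule Min_le, simp, blast)+
  have "\<bar>shift_mean h v x - v x - (\<Sum>j\<in>UNIV. cdiff h j (cdiff h i (H j)) x) / (8 * ?n)\<bar> \<le> e * h\<^sup>2"
    if h: "0 < h" "h < d" for h x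
  proof -
    have hl: "h < 1" "h < dv k" "h < dF k" "h < dg k" for k using h dle(1) dle(2-4)[of k] by linarith+
    define Ev where "Ev k = cdiff (h / 2) k (cdiff (h / 2) k v) x - h\<^sup>2 * partial_deriv k (partial_deriv k v) x" for k
    have Ev: "\<bar>Ev k\<bar> \<le> e1 * h\<^sup>2" for k
    proof -
      have "\<bar>Ev k\<bar> \<le> e1 * (h / 2)\<^sup>2"
        using dv(2)[of "h / 2" k x] hl(2)[of k] h by (simp add: Ev_def power_divide)
      also have "\<dots> \<le> e1 * h\<^sup>2" using e1 h by (intro mult_left_mono power_mono) auto
      finally show ?thesis .
    qed
    define EF where "EF j = cdiff h j (cdiff h i (F j)) x - 4 * h\<^sup>2 * partial_deriv i (partial_deriv j (F j)) x" for j
    have EF: "\<bar>EF j\<bar> \<le> e1 * h\<^sup>2" for j unfolding EF_def by (rule dF(2)[OF h(1) hl(3)])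
    define Eg where "Eg j y = cdiff h i (cdiff h j g) y - 4 * h\<^sup>2 * partial_deriv j (partial_deriv i g) y" for j y
    have Eg: "\<bar>Eg j y\<bar> \<le> e1 * h\<^sup>2" for j y unfolding Eg_def by (rule dg(2)[OF h(1) hl(4)])
    note gcc = Cc_ccont[OF g]
    have gg: "ccont (partial_deriv j (partial_deriv i g))" for j
      by (rule Cc_ccont[OF Cc_partial_deriv[OF Cc_partial_deriv[OF g]]])
    have Egcc: "ccont (Eg j)" for j
      unfolding Eg_def[abs_def] by (intro ccont_diff ccont_cdiff ccont_cmult gcc gg)
    have Eg0: "Eg j y = 0" if "R < norm y" for j y
    proof -
      have ny: "R1 < norm (y + s *\<^sub>R axis i 1 + t *\<^sub>R axis j 1)" if "\<bar>s\<bar> < 1" "\<bar>t\<bar> < 1" for s t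
      proof -
        have "norm y \<le> norm (y + s *\<^sub>R axis i 1 + t *\<^sub>R axis j 1) + norm (s *\<^sub>R axis i (1::real) :: real^'n) + norm (t *\<^sub>R axis j (1::real) :: real^'n)"
          using norm_triangle_ineq4[of "y + s *\<^sub>R axis i 1 + t *\<^sub>R axis j 1" "s *\<^sub>R axis i 1 + t *\<^sub>R axis j 1"]
            norm_triangle_ineq[of "s *\<^sub>R axis i (1::real)" "t *\<^sub>R axis j 1"] by (simp add: algebra_simps)
        moreover have "norm (s *\<^sub>R axis i (1::real) :: real^'n) = \<bar>s\<bar>" "norm (t *\<^sub>R axis j (1::real) :: real^'n) = \<bar>t\<bar>" by simp_all
        ultimately show ?thesis using R(3) \<open>R < norm y\<close> that by linarith
      qed
      have "cdiff h i (cdiff h j g) y = 0"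
        using R1(1)[OF ny[of h h]] R1(1)[OF ny[of h "-h"]] R1(1)[OF ny[of "-h" h]] R1(1)[OF ny[of "-h" "-h"]] h hl(1)
        by (simp add: cdiff_def)
      moreover have "partial_deriv j (partial_deriv i g) y = 0"
        using R2(2)[of j y] R(2)[of j] \<open>R < norm y\<close> by simp
      ultimately show ?thesis by (simp add: Eg_def)
    qed
    \<comment> \<open>The consistency error of \<open>g\<close> vanishes outside a ball that does
      not depend on \<open>h\<close>, so its ray potential is at most \<open>4 * R\<close> times its
      supremum.\<close>
    have rE: "\<bar>ray_potential j (Eg j) x\<bar> \<le> 4 * R * (e1 * h\<^sup>2)" for j
    proof -
      have 0: "0 \<le> e1 * h\<^sup>2" using e1 by simp
      show ?thesis
        using ray_potential_bounds(2)[OF ccont_measurable[OF Egcc[of j]] Eg[of j] 0 Eg0[of _ j] R(1), of j x]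
          ray_potential_bounds(3)[OF ccont_measurable[OF Egcc[of j]] Eg[of j] 0 Eg0[of _ j] R(1), of x]
        by linarith
    qed
    have rg: "(\<Sum>j\<in>UNIV. cdiff h j (cdiff h i (ray_potential j g)) x)
        = 4 * h\<^sup>2 * partial_deriv i g x + (\<Sum>j\<in>UNIV. ray_potential j (Eg j) x)"
    proof -
      have "cdiff h j (cdiff h i (ray_potential j g)) x = ray_potential j (cdiff h i (cdiff h j g)) x" for j
      proof -
        have "cdiff h j (cdiff h i (ray_potential j g)) x = cdiff h i (cdiff h j (ray_potential j g)) x"
          by (simp add: cdiff_def algebra_simps)
        also have "cdiff h j (ray_potential j g) = ray_potential j (cdiff h j g)"
          by (rule ext) (rule ray_potential_cdiff[OF gcc, symmetric])
        also have "cdiff h i (ray_potential j (cdiff h j g)) x = ray_potential j (cdiff h i (cdiff h j g)) x"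
          by (rule ray_potential_cdiff[OF ccont_cdiff[OF gcc], symmetric])
        finally show ?thesis .
      qed
      moreover have "ray_potential j (Eg j) x = ray_potential j (cdiff h i (cdiff h j g)) x
          - 4 * h\<^sup>2 * ray_potential j (partial_deriv j (partial_deriv i g)) x" for j
        unfolding Eg_def[abs_def] ray_potential_cmult[symmetric]
        by (rule ray_potential_diff[OF ccont_cdiff[OF ccont_cdiff[OF gcc]] ccont_cmult[OF gg]])
      ultimately show ?thesis
        using ray_potential_divergence[OF Cc_partial_deriv[OF g, of i], of x]
        by (simp add: sum_subtractf sum_distrib_left[symmetric])
    qed
    have lap: "(\<Sum>k\<in>UNIV. partial_deriv k (partial_deriv k v) x)
        = (\<Sum>k\<in>UNIV. partial_deriv i (partial_deriv k (F k)) x) + partial_deriv i g x"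
    proof -
      have "partial_deriv k (partial_deriv k v) = partial_deriv i (partial_deriv k (partial_deriv k u))" for k
        unfolding v_def partial_deriv_commute[OF u, of k i] by (rule partial_deriv_commute[OF Cc_partial_deriv[OF u]])
      then have "(\<Sum>k\<in>UNIV. partial_deriv k (partial_deriv k v) x) = partial_deriv i (\<lambda>x. \<Sum>k\<in>UNIV. partial_deriv k (partial_deriv k u) x) x"
        by (simp add: partial_deriv_sum Cc_partial_deriv u)
      also have "\<dots> = partial_deriv i (\<lambda>x. (\<Sum>k\<in>UNIV. partial_deriv k (F k) x) + g x) x" by (simp add: eq)
      also have "\<dots> = (\<Sum>k\<in>UNIV. partial_deriv i (partial_deriv k (F k)) x) + partial_deriv i g x"
        by (simp add: partial_deriv_add Cc_differentiable Cc_sum partial_deriv_sum Cc_partial_deriv F g)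
      finally show ?thesis .
    qed
    have 1: "shift_mean h v x - v x = (h\<^sup>2 * (\<Sum>k\<in>UNIV. partial_deriv k (partial_deriv k v) x) + (\<Sum>k\<in>UNIV. Ev k)) / (2 * ?n)"
      unfolding shift_mean_minus_id Ev_def by (simp add: sum_subtractf sum_distrib_left)
    have 2: "(\<Sum>j\<in>UNIV. cdiff h j (cdiff h i (H j)) x)
        = 4 * h\<^sup>2 * (\<Sum>k\<in>UNIV. partial_deriv k (partial_deriv k v) x) + (\<Sum>j\<in>UNIV. EF j) + (\<Sum>j\<in>UNIV. ray_potential j (Eg j) x)"
    proof -
      have "cdiff h j (cdiff h i (H j)) x = cdiff h j (cdiff h i (F j)) x + cdiff h j (cdiff h i (ray_potential j g)) x" for j
        by (simp add: H_def cdiff_def)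
      then show ?thesis unfolding lap by (simp add: sum.distrib rg EF_def sum_subtractf sum_distrib_left algebra_simps)
    qed
    have "shift_mean h v x - v x - (\<Sum>j\<in>UNIV. cdiff h j (cdiff h i (H j)) x) / (8 * ?n)
        = (4 * (\<Sum>k\<in>UNIV. Ev k) - (\<Sum>j\<in>UNIV. EF j) - (\<Sum>j\<in>UNIV. ray_potential j (Eg j) x)) / (8 * ?n)"
      unfolding 1 2 using n by (simp add: field_simps)
    also have "\<bar>\<dots>\<bar> \<le> (?n * (8 * (1 + R) * (e1 * h\<^sup>2))) / (8 * ?n)"
    proof -
      have "\<bar>\<Sum>k\<in>UNIV. Ev k\<bar> \<le> ?n * (e1 * h\<^sup>2)" "\<bar>\<Sum>j\<in>UNIV. EF j\<bar> \<le> ?n * (e1 * h\<^sup>2)"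
        "\<bar>\<Sum>j\<in>UNIV. ray_potential j (Eg j) x\<bar> \<le> ?n * (4 * R * (e1 * h\<^sup>2))"
        using sum_mono[of UNIV "\<lambda>k. \<bar>Ev k\<bar>", OF Ev] sum_mono[of UNIV "\<lambda>k. \<bar>EF k\<bar>", OF EF] sum_mono[of UNIV "\<lambda>j. \<bar>ray_potential j (Eg j) x\<bar>", OF rE]
        by (auto intro!: order_trans[OF sum_abs])
      moreover have "0 \<le> ?n * (e1 * h\<^sup>2)" "0 \<le> ?n * (R * (e1 * h\<^sup>2))" using e1 R by auto
      ultimately have "\<bar>4 * (\<Sum>k\<in>UNIV. Ev k) - (\<Sum>j\<in>UNIV. EF j) - (\<Sum>j\<in>UNIV. ray_potential j (Eg j) x)\<bar> \<le> ?n * (8 * (1 + R) * (e1 * h\<^sup>2))"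
        by (simp add: algebra_simps) 
      then have "\<bar>4 * (\<Sum>k\<in>UNIV. Ev k) - (\<Sum>j\<in>UNIV. EF j) - (\<Sum>j\<in>UNIV. ray_potential j (Eg j) x)\<bar> / (8 * ?n)
          \<le> (?n * (8 * (1 + R) * (e1 * h\<^sup>2))) / (8 * ?n)" by (rule divide_right_mono) simp
      moreover have "\<bar>8 * ?n\<bar> = 8 * ?n" by simp
      ultimately show ?thesis unfolding abs_divide by (simp only:)
    qed
    also have "\<dots> = (e1 * (1 + R)) * h\<^sup>2" using n by simp
    also have "e1 * (1 + R) = e" using R by (simp add: e1_def)
    finally show ?thesis .
  qed
  then show ?thesis using that d0 by blast
qed

lemma cdiff_abs_le:
  fixes f :: "real^'n::finite \<Rightarrow> real"
  assumes "\<And>x. \<bar>f x\<bar> \<le> C"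
  shows "\<bar>cdiff h k f x\<bar> \<le> 2 * C"
  using assms[of "x + h *\<^sub>R axis k 1"] assms[of "x - h *\<^sub>R axis k 1"] unfolding cdiff_def by linarith

lemma mean_pow_shift_mean: "mean_pow h n (shift_mean h f) = shift_mean h (mean_pow h n f)"
  by (rule funpow_swap1[symmetric])

lemma Lnorm_shift_mean:
  fixes f :: "real^'n::finite \<Rightarrow> real"
  assumes "1 \<le> r" "ccont f"
  shows "Lnorm r (shift_mean h f) \<le> Lnorm r f"
  unfolding Lnorm_def
  using shift_mean_powr(2)[OF assms(1) ccont_measurable[OF assms(2)], of h] ccont_powr_integrable[OF assms(2), of r] assms(1)
  by (auto intro!: powr_mono2 Bochner_Integration.integral_nonneg)

text \<open>With \<open>w = A\<^sup>m v\<close>, \<open>\<psi> = A\<^sup>m \<phi>\<close> and \<open>A\<close> self-adjoint, the difference of the two pairings equals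
  the integral of \<open>(w - A w) (\<psi> + A \<psi>)\<close>.\<close>

lemma discrete_pairing_step:
  fixes v \<phi> :: "real^'n::finite \<Rightarrow> real" and H :: "'n \<Rightarrow> real^'n \<Rightarrow> real"
  assumes v: "ccont v" and Hm: "\<And>j. H j \<in> borel_measurable borel" and Hb: "\<And>j x. \<bar>H j x\<bar> \<le> C j"
    and phi: "ccont \<phi>"
    and e: "\<And>x. \<bar>shift_mean h v x - v x - (\<Sum>j\<in>UNIV. cdiff h j (cdiff h i (H j)) x) / (8 * real CARD('n))\<bar> \<le> e"
  defines "\<phi>2 \<equiv> (\<lambda>x. \<phi> x + shift_mean h \<phi> x)"
  shows "\<bar>(LBINT x. mean_pow h m v x * mean_pow h m \<phi> x)
      - (LBINT x. mean_pow h (Suc m) v x * mean_pow h (Suc m) \<phi> x)\<bar>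
    \<le> (\<Sum>j\<in>UNIV. LBINT x. \<bar>cdiff h i (mean_pow h m (H j)) x\<bar> * \<bar>cdiff h j (mean_pow h m \<phi>2) x\<bar>) / (8 * real CARD('n))
      + e * (2 * (LBINT x. \<bar>\<phi> x\<bar>))"
proof -
  let ?n = "real CARD('n)"
  let ?A = "shift_mean h"
  define w where "w = mean_pow h m v"
  define \<psi> where "\<psi> = mean_pow h m \<phi>"
  define \<psi>2 where "\<psi>2 = mean_pow h m \<phi>2"
  define W where "W j = mean_pow h m (H j)" for j
  define er where "er x = ?A v x - v x - (\<Sum>j\<in>UNIV. cdiff h j (cdiff h i (H j)) x) / (8 * ?n)" for x
  obtain Cv where Cv: "\<And>x. \<bar>v x\<bar> \<le> Cv" using ccont_support_bound[OF v] by metis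
  have vm[measurable]: "v \<in> borel_measurable borel" by (rule ccont_measurable[OF v])
  note [measurable] = Hm
  have erm: "er \<in> borel_measurable borel" unfolding er_def[abs_def] by measurable
  have erb: "\<bar>er x\<bar> \<le> e" for x unfolding er_def by (rule e)
  have wm: "w \<in> borel_measurable borel" and wb: "\<bar>w x\<bar> \<le> Cv" for x
    unfolding w_def by (auto intro!: mean_pow_measurable mean_pow_abs_le Cv)
  have Wm: "W j \<in> borel_measurable borel" and Wb: "\<bar>W j x\<bar> \<le> C j" for j x
    unfolding W_def by (auto intro!: mean_pow_measurable mean_pow_abs_le Hb Hm)
  have phi_i: "integrable lborel \<phi>" by (rule ccont_integrable[OF phi])
  have phi2_i: "integrable lborel \<phi>2" unfolding \<phi>2_def
    by (intro Bochner_Integration.integrable_add shift_mean_integrable phi_i)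
  have psi_i: "integrable lborel \<psi>" and psi2_i: "integrable lborel \<psi>2"
    unfolding \<psi>_def \<psi>2_def by (auto intro: mean_pow_integrable phi_i phi2_i)
  have psi2: "\<psi>2 x = \<psi> x + ?A \<psi> x" for x
    unfolding \<psi>2_def \<psi>_def \<phi>2_def mean_pow_add mean_pow_shift_mean ..
  have Apsi_i: "integrable lborel (?A \<psi>)" by (rule shift_mean_integrable[OF psi_i])
  note I = integrable_bounded_mult[OF wm wb] integrable_bounded_mult[OF shift_mean_measurable[OF wm] shift_mean_abs_le[OF wb]]
  have "(LBINT x. w x * \<psi> x) - (LBINT x. ?A w x * ?A \<psi> x) = (LBINT x. (w x - ?A w x) * \<psi>2 x)"
  proof -
    have "(LBINT x. (w x - ?A w x) * \<psi>2 x)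
        = (LBINT x. (w x * \<psi> x + w x * ?A \<psi> x) - (?A w x * \<psi> x + ?A w x * ?A \<psi> x))"
      unfolding psi2 by (simp add: algebra_simps)
    also have "\<dots> = (LBINT x. w x * \<psi> x) + (LBINT x. w x * ?A \<psi> x)
        - ((LBINT x. ?A w x * \<psi> x) + (LBINT x. ?A w x * ?A \<psi> x))"
      using I[OF psi_i] I[OF Apsi_i] by simp
    also have "(LBINT x. ?A w x * \<psi> x) = (LBINT x. w x * ?A \<psi> x)"
      by (rule shift_mean_self_adjoint[OF wm wb psi_i])
    finally show ?thesis by simp
  qed
  also have "\<dots> = (\<Sum>j\<in>UNIV. LBINT x. cdiff h i (W j) x * cdiff h j \<psi>2 x) / (8 * ?n) - (LBINT x. mean_pow h m er x * \<psi>2 x)"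
  proof -
    \<comment> \<open>Since means commute with each other and with differences, the approximate
      equation for \<open>v\<close> passes to \<open>w\<close>, with the error
      \<open>mean_pow h m er\<close> still bounded by \<open>e\<close>.\<close>
    have rel: "(\<lambda>x. v x - ?A v x) = (\<lambda>x. (- 1 / (8 * ?n)) * (\<Sum>j\<in>UNIV. cdiff h j (cdiff h i (H j)) x) - er x)"
      by (simp add: er_def fun_eq_iff)
    have "(\<lambda>x. w x - ?A w x) = mean_pow h m (\<lambda>x. v x - ?A v x)"
      unfolding w_def mean_pow_diff mean_pow_shift_mean ..
    also have "\<dots> = (\<lambda>x. (- 1 / (8 * ?n)) * (\<Sum>j\<in>UNIV. cdiff h j (cdiff h i (W j)) x) - mean_pow h m er x)"
      unfolding rel mean_pow_diff mean_pow_cmult mean_pow_sum mean_pow_cdiff W_def ..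
    finally have "w x - ?A w x = (- 1 / (8 * ?n)) * (\<Sum>j\<in>UNIV. cdiff h j (cdiff h i (W j)) x) - mean_pow h m er x" for x
      by (rule fun_cong)
    then have "(LBINT x. (w x - ?A w x) * \<psi>2 x)
        = (LBINT x. (- 1 / (8 * ?n)) * (\<Sum>j\<in>UNIV. cdiff h j (cdiff h i (W j)) x * \<psi>2 x) - mean_pow h m er x * \<psi>2 x)"
      by (simp only: left_diff_distrib mult.assoc sum_distrib_right)
    also have "\<dots> = (- 1 / (8 * ?n)) * (\<Sum>j\<in>UNIV. LBINT x. cdiff h j (cdiff h i (W j)) x * \<psi>2 x) - (LBINT x. mean_pow h m er x * \<psi>2 x)"
    proof -
      have 1: "integrable lborel (\<lambda>x. cdiff h j (cdiff h i (W j)) x * \<psi>2 x)" for j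
        by (intro integrable_bounded_mult[where C = "2 * (2 * C j)"] cdiff_abs_le cdiff_measurable Wm Wb psi2_i)
      have 2: "integrable lborel (\<lambda>x. mean_pow h m er x * \<psi>2 x)"
        by (intro integrable_bounded_mult[where C = e] mean_pow_measurable mean_pow_abs_le erm erb psi2_i)
      show ?thesis
        by (subst Bochner_Integration.integral_diff[OF _ 2])
          (simp_all add: 1 Bochner_Integration.integral_sum[OF 1])
    qed
    also have "\<dots> = (\<Sum>j\<in>UNIV. LBINT x. cdiff h i (W j) x * cdiff h j \<psi>2 x) / (8 * ?n) - (LBINT x. mean_pow h m er x * \<psi>2 x)"
    proof -
      \<comment> \<open>One difference is moved onto \<open>\<psi>2\<close>. Each factor then
        carries exactly one difference, as the bilinear embedding requires.\<close>
      have "(LBINT x. cdiff h j (cdiff h i (W j)) x * \<psi>2 x) = - (LBINT x. cdiff h i (W j) x * cdiff h j \<psi>2 x)" for j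
        by (intro cdiff_skew_adjoint[where C = "2 * C j"] cdiff_abs_le cdiff_measurable Wm Wb psi2_i)
      then show ?thesis by (simp add: sum_negf)
    qed
    finally show ?thesis .
  qed
  finally have "\<bar>(LBINT x. w x * \<psi> x) - (LBINT x. ?A w x * ?A \<psi> x)\<bar>
      \<le> (\<Sum>j\<in>UNIV. \<bar>LBINT x. cdiff h i (W j) x * cdiff h j \<psi>2 x\<bar>) / (8 * ?n) + \<bar>LBINT x. mean_pow h m er x * \<psi>2 x\<bar>"
  proof (simp only:)
    let ?S = "\<lambda>j. LBINT x. cdiff h i (W j) x * cdiff h j \<psi>2 x"
    have "\<bar>(\<Sum>j\<in>UNIV. ?S j) / (8 * ?n)\<bar> \<le> (\<Sum>j\<in>UNIV. \<bar>?S j\<bar>) / (8 * ?n)"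
      by (simp add: divide_right_mono sum_abs)
    then show "\<bar>(\<Sum>j\<in>UNIV. ?S j) / (8 * ?n) - (LBINT x. mean_pow h m er x * \<psi>2 x)\<bar>
        \<le> (\<Sum>j\<in>UNIV. \<bar>?S j\<bar>) / (8 * ?n) + \<bar>LBINT x. mean_pow h m er x * \<psi>2 x\<bar>" by linarith
  qed
  also have "\<dots> \<le> (\<Sum>j\<in>UNIV. LBINT x. \<bar>cdiff h i (W j) x\<bar> * \<bar>cdiff h j \<psi>2 x\<bar>) / (8 * ?n) + e * (2 * (LBINT x. \<bar>\<phi> x\<bar>))"
  proof (intro add_mono divide_right_mono sum_mono)
    show "\<bar>LBINT x. cdiff h i (W j) x * cdiff h j \<psi>2 x\<bar> \<le> (LBINT x. \<bar>cdiff h i (W j) x\<bar> * \<bar>cdiff h j \<psi>2 x\<bar>)" for j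
      using integral_abs_bound[of lborel "\<lambda>x. cdiff h i (W j) x * cdiff h j \<psi>2 x"] by (simp add: abs_mult)
    have e0: "0 \<le> e" using erb[of 0] by linarith
    have "\<bar>LBINT x. mean_pow h m er x * \<psi>2 x\<bar> \<le> (LBINT x. \<bar>mean_pow h m er x * \<psi>2 x\<bar>)"
      by (rule integral_abs_bound)
    also have "\<dots> \<le> (LBINT x. e * \<bar>\<psi>2 x\<bar>)"
      using psi2_i mean_pow_abs_le[OF erb]
      by (intro integral_mono') (auto simp: abs_mult e0 intro!: mult_right_mono)
    also have "\<dots> = e * (LBINT x. \<bar>\<psi>2 x\<bar>)" by simp
    finally have 1: "\<bar>LBINT x. mean_pow h m er x * \<psi>2 x\<bar> \<le> e * (LBINT x. \<bar>\<psi>2 x\<bar>)" .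
    have "(LBINT x. \<bar>\<psi>2 x\<bar>) \<le> (LBINT x. \<bar>\<phi>2 x\<bar>)"
      unfolding \<psi>2_def by (rule integral_abs_mean_pow[OF phi2_i])
    also have "\<dots> \<le> (LBINT x. \<bar>\<phi> x\<bar> + \<bar>?A \<phi> x\<bar>)"
      unfolding \<phi>2_def using phi_i shift_mean_integrable[OF phi_i]
      by (intro integral_mono') auto
    also have "\<dots> = (LBINT x. \<bar>\<phi> x\<bar>) + (LBINT x. \<bar>?A \<phi> x\<bar>)"
      using phi_i shift_mean_integrable[OF phi_i] by simp
    also have "\<dots> \<le> 2 * (LBINT x. \<bar>\<phi> x\<bar>)"
      using integral_abs_mean_pow[OF phi_i, of 1 h] by simp
    finally have "e * (LBINT x. \<bar>\<psi>2 x\<bar>) \<le> e * (2 * (LBINT x. \<bar>\<phi> x\<bar>))"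
      using e0 by (rule mult_left_mono)
    with 1 show "\<bar>LBINT x. mean_pow h m er x * \<psi>2 x\<bar> \<le> e * (2 * (LBINT x. \<bar>\<phi> x\<bar>))"
      by (rule order_trans)
  qed simp
  finally show ?thesis by (simp add: w_def \<psi>_def W_def \<psi>2_def)
qed

text \<open>In the telescoped sum the embedding bounds the main terms uniformly in \<open>h\<close>
  and \<open>N\<close>; only the consistency error accumulates with the number of steps. The 8 lost
  in the norm of \<open>\<phi>2\<close> cancels against the 8 in the denominator.\<close>

lemma discrete_pairing_bound:
  fixes q r :: real
  assumes q: "1 < q" and r: "r = q / (q - 1)"
  shows "\<exists>K>0. \<forall>h N e i (v :: real^'n::finite \<Rightarrow> real) (H :: 'n \<Rightarrow> real^'n \<Rightarrow> real) C \<phi>.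
    ccont v \<longrightarrow> (\<forall>j. H j \<in> borel_measurable borel) \<longrightarrow> (\<forall>j x. \<bar>H j x\<bar> \<le> C j) \<longrightarrow>
    (\<forall>j. integrable lborel (\<lambda>x. \<bar>H j x\<bar> powr q)) \<longrightarrow> ccont \<phi> \<longrightarrow>
    (\<forall>x. \<bar>shift_mean h v x - v x - (\<Sum>j\<in>UNIV. cdiff h j (cdiff h i (H j)) x) / (8 * real CARD('n))\<bar> \<le> e) \<longrightarrow>
    \<bar>(LBINT x. v x * \<phi> x) - (LBINT x. mean_pow h N v x * mean_pow h N \<phi> x)\<bar>
      \<le> K * (\<Sum>j\<in>UNIV. Lnorm q (H j)) * Lnorm r \<phi> + real N * (e * (2 * (LBINT x. \<bar>\<phi> x\<bar>)))"
proof -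
  let ?n = "real CARD('n)"
  have n1: "1 \<le> ?n" by (simp add: Suc_le_eq)
  have r1: "1 < r" using q by (auto simp: r field_simps)
  obtain K where K: "0 < K" and emb: "\<And>h i j N (f :: real^'n \<Rightarrow> real) g.
    f \<in> borel_measurable borel \<Longrightarrow> integrable lborel (\<lambda>x. \<bar>f x\<bar> powr q) \<Longrightarrow>
    g \<in> borel_measurable borel \<Longrightarrow> integrable lborel (\<lambda>x. \<bar>g x\<bar> powr r) \<Longrightarrow>
    (\<Sum>n<N. LBINT x. \<bar>cdiff h i (mean_pow h n f) x\<bar> * \<bar>cdiff h j (mean_pow h n g) x\<bar>)
      \<le> K * (LBINT x. \<bar>f x\<bar> powr q) powr (1 / q) * (LBINT x. \<bar>g x\<bar> powr r) powr (1 / r)"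
    using bilinear_embedding[OF q r, where 'n = 'n] by blast
  have "\<bar>(LBINT x. v x * \<phi> x) - (LBINT x. mean_pow h N v x * mean_pow h N \<phi> x)\<bar>
      \<le> K * (\<Sum>j\<in>UNIV. Lnorm q (H j)) * Lnorm r \<phi> + real N * (e * (2 * (LBINT x. \<bar>\<phi> x\<bar>)))"
    if v: "ccont v" and Hm: "\<And>j. H j \<in> borel_measurable borel" and Hb: "\<And>j x. \<bar>H j x\<bar> \<le> C j"
      and Hi: "\<And>j. integrable lborel (\<lambda>x. \<bar>H j x\<bar> powr q)" and phi: "ccont \<phi>"
      and e: "\<And>x. \<bar>shift_mean h v x - v x - (\<Sum>j\<in>UNIV. cdiff h j (cdiff h i (H j)) x) / (8 * real CARD('n))\<bar> \<le> e"
    for h N e i C and v \<phi> :: "real^'n \<Rightarrow> real" and H :: "'n \<Rightarrow> real^'n \<Rightarrow> real"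
  proof -
    define \<phi>2 where "\<phi>2 = (\<lambda>x. \<phi> x + shift_mean h \<phi> x)"
    define d where "d m = (LBINT x. mean_pow h m v x * mean_pow h m \<phi> x)" for m
    define J where "J j m = (LBINT x. \<bar>cdiff h i (mean_pow h m (H j)) x\<bar> * \<bar>cdiff h j (mean_pow h m \<phi>2) x\<bar>)" for j m
    define E where "E = e * (2 * (LBINT x. \<bar>\<phi> x\<bar>))"
    have Aphi: "ccont (shift_mean h \<phi>)" by (rule ccont_shift_mean[OF phi])
    have phi2: "ccont \<phi>2" unfolding \<phi>2_def by (rule ccont_add[OF phi Aphi])
    have pint: "integrable lborel (\<lambda>x. \<bar>f x\<bar> powr r)" if "ccont f" for f :: "real^'n \<Rightarrow> real"
      using ccont_powr_integrable[OF that, of r] r1 by simp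
    have "Lnorm r \<phi>2 \<le> 4 * (Lnorm r \<phi> + Lnorm r (shift_mean h \<phi>))"
      unfolding \<phi>2_def using r1
      by (intro Lnorm_add(2) pint phi Aphi ccont_measurable) auto
    also have "\<dots> \<le> 8 * Lnorm r \<phi>" using Lnorm_shift_mean[OF _ phi, of r h] r1 by simp
    finally have L2: "Lnorm r \<phi>2 \<le> 8 * Lnorm r \<phi>" .
    have "\<bar>d 0 - d N\<bar> = \<bar>\<Sum>m<N. d m - d (Suc m)\<bar>"
      unfolding sum_lessThan_telescope'[of d] ..
    also have "\<dots> \<le> (\<Sum>m<N. \<bar>d m - d (Suc m)\<bar>)" by (rule sum_abs)
    also have "\<dots> \<le> (\<Sum>m<N. (\<Sum>j\<in>UNIV. J j m) / (8 * ?n) + E)"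
      unfolding d_def J_def E_def \<phi>2_def by (intro sum_mono discrete_pairing_step[where C = C] v Hm Hb phi e)
    also have "\<dots> = (\<Sum>j\<in>UNIV. \<Sum>m<N. J j m) / (8 * ?n) + real N * E"
      by (simp add: sum.distrib sum_divide_distrib[symmetric]) (rule sum.swap)
    also have "(\<Sum>j\<in>UNIV. \<Sum>m<N. J j m) \<le> (\<Sum>j\<in>UNIV. K * Lnorm q (H j) * (8 * Lnorm r \<phi>))"
    proof (rule sum_mono)
      fix j
      have "(\<Sum>m<N. J j m) \<le> K * Lnorm q (H j) * Lnorm r \<phi>2"
        unfolding J_def Lnorm_def real_norm_def by (intro emb Hm Hi ccont_measurable phi2 pint)
      also have "\<dots> \<le> K * Lnorm q (H j) * (8 * Lnorm r \<phi>)"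
        using K L2 by (intro mult_left_mono) (auto intro!: mult_nonneg_nonneg Lnorm_nonneg)
      finally show "(\<Sum>m<N. J j m) \<le> K * Lnorm q (H j) * (8 * Lnorm r \<phi>)" .
    qed
    also have "(\<Sum>j\<in>UNIV. K * Lnorm q (H j) * (8 * Lnorm r \<phi>)) = 8 * (K * (\<Sum>j\<in>UNIV. Lnorm q (H j)) * Lnorm r \<phi>)"
      by (simp add: sum_distrib_left sum_distrib_right algebra_simps)
    finally have "\<bar>d 0 - d N\<bar> \<le> 8 * (K * (\<Sum>j\<in>UNIV. Lnorm q (H j)) * Lnorm r \<phi>) / (8 * ?n) + real N * E"
      by (simp add: divide_right_mono)
    also have "8 * (K * (\<Sum>j\<in>UNIV. Lnorm q (H j)) * Lnorm r \<phi>) / (8 * ?n) \<le> K * (\<Sum>j\<in>UNIV. Lnorm q (H j)) * Lnorm r \<phi>"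
    proof -
      have "0 \<le> K * (\<Sum>j\<in>UNIV. Lnorm q (H j)) * Lnorm r \<phi>"
        using K by (intro mult_nonneg_nonneg sum_nonneg Lnorm_nonneg) auto
      from mult_left_mono[OF n1 this] show ?thesis by (simp add: divide_le_eq)
    qed
    finally show ?thesis by (simp add: d_def E_def)
  qed
  then show ?thesis using K by blast
qed

section \<open>The gradient estimate\<close>

text \<open>The integrals of \<open>\<bar>D\<^sub>i A\<^sup>n u\<bar>\<^sup>2\<close> decrease in \<open>n\<close> and are summable by the embedding with \<open>q = r = 2\<close>,
  so the \<open>N\<close>-th one is of order \<open>1/N\<close>.\<close>

lemma mean_pow_cdiff_decay:
  "\<exists>K>0. \<forall>h N i (u :: real^'n::finite \<Rightarrow> real) \<phi> \<kappa>. ccont u \<longrightarrow> ccont \<phi> \<longrightarrow> 0 < N \<longrightarrow> 0 < \<kappa> \<longrightarrow>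
    \<bar>LBINT x. cdiff h i (mean_pow h N u) x * mean_pow h N \<phi> x\<bar>
      \<le> \<kappa> * (K * (LBINT x. \<bar>u x\<bar> powr 2) / real N) + (LBINT x. \<bar>\<phi> x\<bar> powr 2) / \<kappa>"
proof -
  obtain K where K: "0 < K" and emb: "\<And>h i j N (f :: real^'n \<Rightarrow> real) g.
    f \<in> borel_measurable borel \<Longrightarrow> integrable lborel (\<lambda>x. \<bar>f x\<bar> powr 2) \<Longrightarrow>
    g \<in> borel_measurable borel \<Longrightarrow> integrable lborel (\<lambda>x. \<bar>g x\<bar> powr 2) \<Longrightarrow>
    (\<Sum>n<N. LBINT x. \<bar>cdiff h i (mean_pow h n f) x\<bar> * \<bar>cdiff h j (mean_pow h n g) x\<bar>)
      \<le> K * (LBINT x. \<bar>f x\<bar> powr 2) powr (1 / 2) * (LBINT x. \<bar>g x\<bar> powr 2) powr (1 / 2)"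
    using bilinear_embedding[of 2 2, where 'n = 'n] by force
  have sq: "\<bar>a\<bar> powr 2 = a\<^sup>2" "\<bar>a\<bar> powr 2 = \<bar>a\<bar> * \<bar>a\<bar>" for a :: real
    by (simp_all add: powr_numeral power2_eq_square)
  have "\<bar>LBINT x. cdiff h i (mean_pow h N u) x * mean_pow h N \<phi> x\<bar>
      \<le> \<kappa> * (K * (LBINT x. \<bar>u x\<bar> powr 2) / real N) + (LBINT x. \<bar>\<phi> x\<bar> powr 2) / \<kappa>"
    if u: "ccont u" and phi: "ccont \<phi>" and N: "0 < N" and \<kappa>: "0 < \<kappa>"
    for h N i \<kappa> and u \<phi> :: "real^'n \<Rightarrow> real"
  proof -
    define a where "a n = cdiff h i (mean_pow h n u)" for n
    define U where "U = (LBINT x. \<bar>u x\<bar> powr 2)"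
    have um: "u \<in> borel_measurable borel" by (rule ccont_measurable[OF u])
    have U0: "0 \<le> U" unfolding U_def by (intro Bochner_Integration.integral_nonneg) simp
    have i2: "integrable lborel (\<lambda>x. \<bar>f x\<bar> powr 2)" if "ccont f" for f :: "real^'n \<Rightarrow> real"
      using ccont_powr_integrable[OF that, of 2] by simp
    have am: "a n \<in> borel_measurable borel" for n
      unfolding a_def by (intro cdiff_measurable mean_pow_measurable um)
    have acc: "ccont (a 0)" unfolding a_def by (simp add: ccont_cdiff u)
    have a0: "a n = mean_pow h n (a 0)" for n by (simp add: a_def mean_pow_cdiff)
    have ai: "integrable lborel (\<lambda>x. \<bar>a n x\<bar> powr 2)" for n
      using mean_pow_powr[of 2 "a 0" n h] i2[OF acc] am unfolding a0[of n] by simp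
    have mono: "(LBINT x. \<bar>a N x\<bar> powr 2) \<le> (LBINT x. \<bar>a n x\<bar> powr 2)" if "n < N" for n
    proof -
      have "a N = mean_pow h (N - n) (a n)"
        using that unfolding a0[of n] a0[of N] by (simp add: funpow_add[symmetric, THEN fun_cong, unfolded o_apply])
      then show ?thesis using mean_pow_powr[of 2 "a n" "N - n" h] am ai by simp
    qed
    have "real N * (LBINT x. \<bar>a N x\<bar> powr 2) = (\<Sum>n<N. LBINT x. \<bar>a N x\<bar> powr 2)" by simp
    also have "\<dots> \<le> (\<Sum>n<N. LBINT x. \<bar>a n x\<bar> powr 2)" by (intro sum_mono mono) simp
    also have "\<dots> \<le> K * U powr (1 / 2) * U powr (1 / 2)"
      using emb[OF um i2[OF u] um i2[OF u], where h = h and i = i and j = i and N = N] unfolding a_def U_def sq(2) by simp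
    also have "\<dots> = K * U"
      using U0 by (cases "U = 0") (simp_all add: mult.assoc powr_add[symmetric])
    finally have aN: "(LBINT x. \<bar>a N x\<bar> powr 2) \<le> K * U / real N"
      using N by (simp add: field_simps)
    let ?\<psi> = "mean_pow h N \<phi>"
    have psi: "integrable lborel (\<lambda>x. \<bar>?\<psi> x\<bar> powr 2)" "(LBINT x. \<bar>?\<psi> x\<bar> powr 2) \<le> (LBINT x. \<bar>\<phi> x\<bar> powr 2)"
      using mean_pow_powr[of 2 \<phi> N h] i2[OF phi] ccont_measurable[OF phi] by auto
    have "\<bar>LBINT x. a N x * ?\<psi> x\<bar> \<le> (LBINT x. \<bar>a N x * ?\<psi> x\<bar>)"
      by (rule integral_abs_bound)
    also have "\<dots> \<le> (LBINT x. \<kappa> * \<bar>a N x\<bar> powr 2 + \<bar>?\<psi> x\<bar> powr 2 / \<kappa>)"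
    proof (rule integral_mono')
      fix x
      \<comment> \<open>Weighted arithmetic-geometric mean. The weight stays free so that the
        decaying term can later be balanced against the one that does not decay.\<close>
      have "0 \<le> (\<kappa> * \<bar>a N x\<bar> - \<bar>?\<psi> x\<bar>)\<^sup>2 / \<kappa>" using \<kappa> by simp
      also have "\<dots> = \<kappa> * \<bar>a N x\<bar> powr 2 - 2 * (\<bar>a N x\<bar> * \<bar>?\<psi> x\<bar>) + \<bar>?\<psi> x\<bar> powr 2 / \<kappa>"
        unfolding sq(2) using \<kappa> by (simp add: power2_eq_square field_simps)
      finally have "2 * (\<bar>a N x\<bar> * \<bar>?\<psi> x\<bar>) \<le> \<kappa> * \<bar>a N x\<bar> powr 2 + \<bar>?\<psi> x\<bar> powr 2 / \<kappa>" by linarith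
      moreover have "0 \<le> \<bar>a N x\<bar> * \<bar>?\<psi> x\<bar>" by simp
      ultimately show "\<bar>a N x * ?\<psi> x\<bar> \<le> \<kappa> * \<bar>a N x\<bar> powr 2 + \<bar>?\<psi> x\<bar> powr 2 / \<kappa>"
        unfolding abs_mult by linarith
    qed (use ai psi \<kappa> in auto)
    also have "\<dots> = \<kappa> * (LBINT x. \<bar>a N x\<bar> powr 2) + (LBINT x. \<bar>?\<psi> x\<bar> powr 2) / \<kappa>"
      using ai psi by simp
    also have "\<dots> \<le> \<kappa> * (K * U / real N) + (LBINT x. \<bar>\<phi> x\<bar> powr 2) / \<kappa>"
      using \<kappa> aN psi by (intro add_mono mult_left_mono divide_right_mono) auto
    finally show ?thesis by (simp add: a_def U_def)
  qed
  then show ?thesis using K by blast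
qed

text \<open>\<open>discrete_pairing_bound\<close> compares the pairing with the one after
  \<open>N\<close> steps. The latter is small because \<open>partial_deriv i u\<close> is a
  derivative: up to a small error it is \<open>cdiff h i u / (2 * h)\<close>, to which
  \<open>mean_pow_cdiff_decay\<close> applies. Step size and number of steps depend on the tolerance
  \<open>\<eta>\<close> but do not enter the constant.\<close>

lemma gradient_pairing:
  fixes q r :: real
  assumes q: "1 < q" and r: "r = q / (q - 1)"
  shows "\<exists>K>0. \<forall>i (u :: real^'n::finite \<Rightarrow> real) F g \<phi>.
    u \<in> Cc_infinity \<longrightarrow> (\<forall>k. F k \<in> Cc_infinity) \<longrightarrow> g \<in> Cc_infinity \<longrightarrow>
    (\<forall>x. (\<Sum>k\<in>UNIV. partial_deriv k (partial_deriv k u) x) = (\<Sum>k\<in>UNIV. partial_deriv k (F k) x) + g x) \<longrightarrow>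
    (\<forall>k. integrable lborel (\<lambda>x. \<bar>ray_potential k g x\<bar> powr q)) \<longrightarrow> ccont \<phi> \<longrightarrow>
    \<bar>LBINT x. partial_deriv i u x * \<phi> x\<bar>
      \<le> K * (\<Sum>j\<in>UNIV. Lnorm q (\<lambda>x. F j x + ray_potential j g x)) * Lnorm r \<phi>"
proof -
  obtain K where K: "0 < K" and pair: "\<And>h N e i (v :: real^'n \<Rightarrow> real) (H :: 'n \<Rightarrow> real^'n \<Rightarrow> real) C \<phi>.
    ccont v \<Longrightarrow> (\<And>j. H j \<in> borel_measurable borel) \<Longrightarrow> (\<And>j x. \<bar>H j x\<bar> \<le> C j) \<Longrightarrow>
    (\<And>j. integrable lborel (\<lambda>x. \<bar>H j x\<bar> powr q)) \<Longrightarrow> ccont \<phi> \<Longrightarrow>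
    (\<And>x. \<bar>shift_mean h v x - v x - (\<Sum>j\<in>UNIV. cdiff h j (cdiff h i (H j)) x) / (8 * real CARD('n))\<bar> \<le> e) \<Longrightarrow>
    \<bar>(LBINT x. v x * \<phi> x) - (LBINT x. mean_pow h N v x * mean_pow h N \<phi> x)\<bar>
      \<le> K * (\<Sum>j\<in>UNIV. Lnorm q (H j)) * Lnorm r \<phi> + real N * (e * (2 * (LBINT x. \<bar>\<phi> x\<bar>)))"
    using discrete_pairing_bound[OF q r, where 'n = 'n] by blast
  obtain K2 where K2: "0 < K2" and decay: "\<And>h N i (u :: real^'n \<Rightarrow> real) \<phi> \<kappa>. ccont u \<Longrightarrow> ccont \<phi> \<Longrightarrow> 0 < N \<Longrightarrow> 0 < \<kappa> \<Longrightarrow>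
    \<bar>LBINT x. cdiff h i (mean_pow h N u) x * mean_pow h N \<phi> x\<bar>
      \<le> \<kappa> * (K2 * (LBINT x. \<bar>u x\<bar> powr 2) / real N) + (LBINT x. \<bar>\<phi> x\<bar> powr 2) / \<kappa>"
    using mean_pow_cdiff_decay[where 'n = 'n] by blast
  have "\<bar>LBINT x. partial_deriv i u x * \<phi> x\<bar>
      \<le> K * (\<Sum>j\<in>UNIV. Lnorm q (\<lambda>x. F j x + ray_potential j g x)) * Lnorm r \<phi>"
    if u: "u \<in> Cc_infinity" and F: "\<And>k. F k \<in> Cc_infinity" and g: "g \<in> Cc_infinity"
      and eq: "\<And>x. (\<Sum>k\<in>UNIV. partial_deriv k (partial_deriv k u) x) = (\<Sum>k\<in>UNIV. partial_deriv k (F k) x) + g x"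
      and gi: "\<And>k. integrable lborel (\<lambda>x. \<bar>ray_potential k g x\<bar> powr q)" and phi: "ccont \<phi>"
    for i F and u g \<phi> :: "real^'n \<Rightarrow> real"
  proof (rule field_le_epsilon)
    fix \<eta> :: real assume \<eta>: "0 < \<eta>"
    define v where "v = partial_deriv i u"
    define H where "H j = (\<lambda>x. F j x + ray_potential j g x)" for j
    define U where "U = (LBINT x. \<bar>u x\<bar> powr 2)"
    define \<Phi> where "\<Phi> = (LBINT x. \<bar>\<phi> x\<bar> powr 2)"
    define \<Phi>1 where "\<Phi>1 = (LBINT x. \<bar>\<phi> x\<bar>)"
    have nn: "0 \<le> U" "0 \<le> \<Phi>" "0 \<le> \<Phi>1"
      unfolding U_def \<Phi>_def \<Phi>1_def by (auto intro!: Bochner_Integration.integral_nonneg)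
    have ucc: "ccont u" and vcc: "ccont v" and Fcc: "ccont (F j)" and gcc: "ccont g" for j
      unfolding v_def by (intro Cc_ccont Cc_partial_deriv u F g)+
    obtain Cg Rg where Cg: "\<And>y. \<bar>g y\<bar> \<le> Cg" "0 \<le> Cg" "\<And>y. Rg < norm y \<Longrightarrow> g y = 0" "0 \<le> Rg"
      using ccont_support_bound[OF gcc] by blast
    have "\<exists>C. \<forall>x. \<bar>F j x\<bar> \<le> C" for j using ccont_support_bound[OF Fcc] by metis
    then obtain CF where CF: "\<And>j x. \<bar>F j x\<bar> \<le> CF j" by metis
    have Hb: "\<bar>H j x\<bar> \<le> CF j + 4 * Rg * Cg" for j x
      using ray_potential_bounds(2)[OF ccont_measurable[OF gcc] Cg, of j x]
        ray_potential_bounds(3)[OF ccont_measurable[OF gcc] Cg, of x] CF[of j x]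
      unfolding H_def by linarith
    have gm: "ray_potential j g \<in> borel_measurable borel" for j
      by (rule ray_potential_measurable[OF ccont_measurable[OF gcc]])
    have Hm: "H j \<in> borel_measurable borel" for j
      unfolding H_def using gm ccont_measurable[OF Fcc] by simp
    have Hi: "integrable lborel (\<lambda>x. \<bar>H j x\<bar> powr q)" for j
      unfolding H_def using q ccont_powr_integrable[OF Fcc, of q]
      by (intro Lnorm_add(1) gi gm ccont_measurable Fcc) auto
    \<comment> \<open>The flow runs up to time \<open>N h\<^sup>2 = T = S\<^sup>2\<close>. First \<open>S\<close> makes the remaining pairing small, then
      \<open>e\<close> and the step \<open>h = 1/M\<close> make the accumulated discretization error small.\<close>
    obtain S :: nat where S: "(K2 * U + \<Phi>) / \<eta> < real S" using reals_Archimedean2 by blast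
    have S0: "0 < S"
    proof (rule ccontr)
      assume "\<not> 0 < S"
      moreover have "0 \<le> (K2 * U + \<Phi>) / \<eta>" using nn K2 \<eta> by simp
      ultimately show False using S by simp
    qed
    have SS: "(K2 * U + \<Phi>) / (2 * real S) \<le> \<eta> / 2"
      using S S0 \<eta> by (simp add: field_simps)
    define T where "T = (real S)\<^sup>2"
    have T0: "0 < T" using S0 by (simp add: T_def)
    \<comment> \<open>\<open>2 * T\<close> collects the errors of the \<open>N\<close> flow steps,
      and the summand 1 is the error of the difference quotient. \<open>\<Phi>1 + 1\<close> avoids a
      division by zero.\<close>
    define e where "e = \<eta> / (2 * (2 * T + 1) * (\<Phi>1 + 1))"
    have e: "0 < e" using \<eta> T0 nn by (simp add: e_def)
    have eT: "(2 * T + 1) * e * \<Phi>1 \<le> \<eta> / 2"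
    proof -
      have "(2 * T + 1) * e * \<Phi>1 \<le> (2 * T + 1) * e * (\<Phi>1 + 1)"
        using T0 e by (intro mult_left_mono) auto
      also have "\<dots> = \<eta> / 2"
      proof -
        have "a * (\<eta> / (2 * a * b)) * b = \<eta> / 2" if "0 < a" "0 < b" for a b :: real
          using that by simp
        from this[of "2 * T + 1" "\<Phi>1 + 1"] show ?thesis using T0 nn unfolding e_def by simp
      qed
      finally show ?thesis .
    qed
    obtain d1 where d1: "0 < d1" "\<And>h x. 0 < h \<Longrightarrow> h < d1 \<Longrightarrow>
      \<bar>shift_mean h v x - v x - (\<Sum>j\<in>UNIV. cdiff h j (cdiff h i (H j)) x) / (8 * real CARD('n))\<bar> \<le> e * h\<^sup>2"
      unfolding v_def H_def using discrete_laplace_consistency[OF u F g eq e, of i] by blast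
    obtain d2 where d2: "0 < d2" "\<And>h x. 0 < h \<Longrightarrow> h < d2 \<Longrightarrow> \<bar>cdiff h i u x - 2 * h * v x\<bar> \<le> e * h"
      unfolding v_def using cdiff_approx[OF u e, of i] by blast
    obtain m where m: "inverse (real (Suc m)) < min d1 d2"
      using reals_Archimedean[of "min d1 d2"] d1 d2 by auto
    define M where "M = real (Suc m)"
    define h where "h = 1 / M"
    define N where "N = S\<^sup>2 * (Suc m)\<^sup>2"
    have M: "0 < M" by (simp add: M_def)
    have h: "0 < h" "h < d1" "h < d2" using m M by (auto simp: h_def M_def inverse_eq_divide)
    have N: "0 < N" "real N = T * M\<^sup>2" using S0 by (auto simp: N_def T_def M_def)
    have Nh: "real N * h\<^sup>2 = T" using M by (simp add: N h_def power_divide)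
    let ?\<psi> = "mean_pow h N \<phi>"
    have psi_i: "integrable lborel ?\<psi>" by (rule mean_pow_integrable[OF ccont_integrable[OF phi]])
    have 1: "\<bar>(LBINT x. v x * \<phi> x) - (LBINT x. mean_pow h N v x * ?\<psi> x)\<bar>
        \<le> K * (\<Sum>j\<in>UNIV. Lnorm q (H j)) * Lnorm r \<phi> + 2 * T * e * \<Phi>1"
    proof -
      have "\<bar>(LBINT x. v x * \<phi> x) - (LBINT x. mean_pow h N v x * ?\<psi> x)\<bar>
        \<le> K * (\<Sum>j\<in>UNIV. Lnorm q (H j)) * Lnorm r \<phi> + real N * (e * h\<^sup>2 * (2 * \<Phi>1))"
        unfolding \<Phi>1_def by (intro pair[where i = i and C = "\<lambda>j. CF j + 4 * Rg * Cg"] vcc Hm Hb Hi phi d1 h)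
      also have "real N * (e * h\<^sup>2 * (2 * \<Phi>1)) = 2 * (real N * h\<^sup>2) * e * \<Phi>1" by simp
      finally show ?thesis by (simp only: Nh)
    qed
    have 2: "\<bar>LBINT x. mean_pow h N v x * ?\<psi> x\<bar> \<le> (K2 * U + \<Phi>) / (2 * real S) + e * \<Phi>1"
    proof -
      define er where "er x = v x - (1 / (2 * h)) * cdiff h i u x" for x
      have erb: "\<bar>er x\<bar> \<le> e" for x
      proof -
        have "2 * h * er x = 2 * h * v x - cdiff h i u x" using h by (simp add: er_def field_simps)
        then have "\<bar>2 * h * er x\<bar> \<le> e * h" using d2(2)[OF h(1,3), of x] by (simp add: abs_minus_commute)
        then have "h * (2 * \<bar>er x\<bar>) \<le> h * e" using h by (simp add: abs_mult mult.commute)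
        then have "2 * \<bar>er x\<bar> \<le> e" using h by (simp only: mult_le_cancel_left_pos)
        then show ?thesis using abs_ge_zero[of "er x"] by linarith
      qed
      have erm: "er \<in> borel_measurable borel"
        using cdiff_measurable[OF ccont_measurable[OF ucc], of h i] ccont_measurable[OF vcc]
        unfolding er_def[abs_def] by simp
      have ve: "v = (\<lambda>x. (1 / (2 * h)) * cdiff h i u x + er x)" by (simp add: er_def)
      have vN: "mean_pow h N v x = (1 / (2 * h)) * cdiff h i (mean_pow h N u) x + mean_pow h N er x" for x
        by (subst ve) (simp only: mean_pow_add mean_pow_cmult mean_pow_cdiff)
      obtain Cu where Cu: "\<And>x. \<bar>u x\<bar> \<le> Cu" using ccont_support_bound[OF ucc] by metis
      have i1: "integrable lborel (\<lambda>x. cdiff h i (mean_pow h N u) x * ?\<psi> x)"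
        by (intro integrable_bounded_mult[where C = "2 * Cu"] cdiff_abs_le mean_pow_abs_le Cu cdiff_measurable mean_pow_measurable
            ccont_measurable ucc psi_i)
      have i2: "integrable lborel (\<lambda>x. mean_pow h N er x * ?\<psi> x)"
        by (intro integrable_bounded_mult[where C = e] mean_pow_abs_le erb mean_pow_measurable erm psi_i)
      have "(LBINT x. mean_pow h N v x * ?\<psi> x)
          = (LBINT x. (1 / (2 * h)) * (cdiff h i (mean_pow h N u) x * ?\<psi> x) + mean_pow h N er x * ?\<psi> x)"
        by (simp only: vN distrib_right mult.assoc)
      also have "\<dots> = (1 / (2 * h)) * (LBINT x. cdiff h i (mean_pow h N u) x * ?\<psi> x) + (LBINT x. mean_pow h N er x * ?\<psi> x)"
        using i1 i2 by simp
      finally have s: "(LBINT x. mean_pow h N v x * ?\<psi> x)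
          = (1 / (2 * h)) * (LBINT x. cdiff h i (mean_pow h N u) x * ?\<psi> x) + (LBINT x. mean_pow h N er x * ?\<psi> x)" .
      \<comment> \<open>Since \<open>real N = (M * real S)\<^sup>2\<close>, this weight makes both
        terms of \<open>decay\<close> of order \<open>1 / (M * real S)\<close>. The factor
        \<open>1 / (2 * h) = M / 2\<close> turns this into \<open>1 / S\<close>, independent of
        \<open>h\<close>.\<close>
      define \<kappa> where "\<kappa> = M * real S"
      have \<kappa>: "0 < \<kappa>" using M S0 by (simp add: \<kappa>_def)
      have "\<bar>LBINT x. cdiff h i (mean_pow h N u) x * ?\<psi> x\<bar> \<le> \<kappa> * (K2 * U / real N) + \<Phi> / \<kappa>"
        unfolding U_def \<Phi>_def by (rule decay[OF ucc phi N(1) \<kappa>])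
      also have "\<dots> = (K2 * U + \<Phi>) / (M * real S)"
        using M S0 by (simp add: N T_def \<kappa>_def field_simps power2_eq_square)
      finally have "(M / 2) * \<bar>LBINT x. cdiff h i (mean_pow h N u) x * ?\<psi> x\<bar> \<le> (M / 2) * ((K2 * U + \<Phi>) / (M * real S))"
        using M by (intro mult_left_mono) auto
      also have "\<dots> = (K2 * U + \<Phi>) / (2 * real S)" using M by simp
      finally have a: "\<bar>(1 / (2 * h)) * (LBINT x. cdiff h i (mean_pow h N u) x * ?\<psi> x)\<bar> \<le> (K2 * U + \<Phi>) / (2 * real S)"
        using M by (simp add: h_def abs_mult)
      have "\<bar>LBINT x. mean_pow h N er x * ?\<psi> x\<bar> \<le> (LBINT x. \<bar>mean_pow h N er x * ?\<psi> x\<bar>)"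
        by (rule integral_abs_bound)
      also have "\<dots> \<le> (LBINT x. e * \<bar>?\<psi> x\<bar>)"
        using psi_i mean_pow_abs_le[OF erb] e
        by (intro integral_mono') (auto simp: abs_mult intro!: mult_right_mono)
      also have "\<dots> = e * (LBINT x. \<bar>?\<psi> x\<bar>)" by simp
      also have "\<dots> \<le> e * \<Phi>1"
        unfolding \<Phi>1_def using e by (intro mult_left_mono integral_abs_mean_pow ccont_integrable phi) simp
      finally have b: "\<bar>LBINT x. mean_pow h N er x * ?\<psi> x\<bar> \<le> e * \<Phi>1" .
      show ?thesis unfolding s using a b by linarith
    qed
    have "(2 * T + 1) * e * \<Phi>1 = 2 * T * e * \<Phi>1 + e * \<Phi>1" by (simp add: algebra_simps)
    then have "\<bar>LBINT x. v x * \<phi> x\<bar> \<le> K * (\<Sum>j\<in>UNIV. Lnorm q (H j)) * Lnorm r \<phi> + \<eta>"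
      using 1 2 SS eT by linarith
    then show "\<bar>LBINT x. partial_deriv i u x * \<phi> x\<bar>
      \<le> K * (\<Sum>j\<in>UNIV. Lnorm q (\<lambda>x. F j x + ray_potential j g x)) * Lnorm r \<phi> + \<eta>"
      by (simp add: v_def H_def)
  qed
  then show ?thesis using K by (intro exI[of _ K]) auto
qed

lemma gradient_estimate:
  fixes p q :: real
  assumes p: "1 < p" "p < real CARD('n::finite)" and q: "1 / q = 1 / p - 1 / real CARD('n)"
  shows "\<exists>K>0. \<forall>i (u :: real^'n \<Rightarrow> real) F g.
    u \<in> Cc_infinity \<longrightarrow> (\<forall>k. F k \<in> Cc_infinity) \<longrightarrow> g \<in> Cc_infinity \<longrightarrow>
    (\<forall>x. (\<Sum>k\<in>UNIV. partial_deriv k (partial_deriv k u) x) = (\<Sum>k\<in>UNIV. partial_deriv k (F k) x) + g x) \<longrightarrow>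
    Lnorm q (partial_deriv i u) \<le> K * ((\<Sum>k\<in>UNIV. Lnorm q (F k)) + Lnorm p g)"
proof -
  let ?n = "real CARD('n)"
  have "1 / ?n < 1 / p" using p by (simp add: field_simps)
  then have "0 < 1 / q" "1 / q < 1 / p" using p by (auto simp: q)
  then have "p < q" using p by (simp add: field_simps zero_less_divide_iff)
  then have q1: "1 < q" using p by simp
  define r where "r = q / (q - 1)"
  have r1: "1 < r" using q1 by (simp add: r_def)
  obtain K where K: "0 < K" and pair: "\<And>i (u :: real^'n \<Rightarrow> real) F g \<phi>.
    u \<in> Cc_infinity \<Longrightarrow> (\<And>k. F k \<in> Cc_infinity) \<Longrightarrow> g \<in> Cc_infinity \<Longrightarrow>
    (\<And>x. (\<Sum>k\<in>UNIV. partial_deriv k (partial_deriv k u) x) = (\<Sum>k\<in>UNIV. partial_deriv k (F k) x) + g x) \<Longrightarrow>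
    (\<And>k. integrable lborel (\<lambda>x. \<bar>ray_potential k g x\<bar> powr q)) \<Longrightarrow> ccont \<phi> \<Longrightarrow>
    \<bar>LBINT x. partial_deriv i u x * \<phi> x\<bar>
      \<le> K * (\<Sum>j\<in>UNIV. Lnorm q (\<lambda>x. F j x + ray_potential j g x)) * Lnorm r \<phi>"
    using gradient_pairing[OF q1 r_def, where 'n = 'n] by blast
  obtain K' where K': "0 < K'" and pot: "\<And>(g :: real^'n \<Rightarrow> real) k. ccont g \<Longrightarrow>
    integrable lborel (\<lambda>x. \<bar>ray_potential k g x\<bar> powr q)" "\<And>(g :: real^'n \<Rightarrow> real) k. ccont g \<Longrightarrow>
    Lnorm q (ray_potential k g) \<le> K' * Lnorm p g"
    using ray_potential_Lq[OF p q] by blast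
  have "Lnorm q (partial_deriv i u) \<le> (4 * K * (1 + ?n * K')) * ((\<Sum>k\<in>UNIV. Lnorm q (F k)) + Lnorm p g)"
    if u: "u \<in> Cc_infinity" and F: "\<And>k. F k \<in> Cc_infinity" and g: "g \<in> Cc_infinity"
      and eq: "\<And>x. (\<Sum>k\<in>UNIV. partial_deriv k (partial_deriv k u) x) = (\<Sum>k\<in>UNIV. partial_deriv k (F k) x) + g x"
    for i F and u g :: "real^'n \<Rightarrow> real"
  proof -
    define v where "v = partial_deriv i u"
    \<comment> \<open>This is \<open>sgn y\<close> times \<open>\<bar>y\<bar> powr (q - 1)\<close>,
      written with positive and negative parts so that continuity at 0 is immediate.\<close>
    define s where "s y = max 0 y powr (q - 1) - max 0 (- y) powr (q - 1)" for y :: real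
    define Z where "Z = (\<Sum>j\<in>UNIV. Lnorm q (\<lambda>x. F j x + ray_potential j g x))"
    define X where "X = (LBINT x. \<bar>v x\<bar> powr q)"
    have vcc: "ccont v" unfolding v_def by (intro Cc_ccont Cc_partial_deriv u)
    have gcc: "ccont g" by (rule Cc_ccont[OF g])
    have s1: "y * s y = \<bar>y\<bar> powr q" for y
    proof -
      have "a * a powr (q - 1) = a powr q" if "0 < a" for a :: real using that by (simp add: powr_diff)
      from this[of y] this[of "- y"] show ?thesis
        by (cases "y = 0") (auto simp: s_def max_def abs_if)
    qed
    have s2: "\<bar>s y\<bar> = \<bar>y\<bar> powr (q - 1)" for y
      by (cases "y = 0") (auto simp: s_def max_def abs_if)
    have phi: "ccont (\<lambda>x. s (v x))"
    proof (rule ccont_compose[OF vcc])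
      show "continuous_on UNIV s" unfolding s_def using q1
        by (intro continuous_on_diff continuous_on_powr' continuous_on_max continuous_on_minus continuous_on_const continuous_on_id) auto
    qed (simp add: s_def)
    have X0: "0 \<le> X" unfolding X_def by (intro Bochner_Integration.integral_nonneg) simp
    have "(q - 1) * r = q" using q1 by (simp add: r_def)
    then have Lr: "Lnorm r (\<lambda>x. s (v x)) = X powr (1 / r)"
      by (simp add: Lnorm_def s2 powr_powr X_def)
    have "X \<le> K * Z * X powr (1 / r)"
      using pair[OF u F g eq pot(1)[OF gcc] phi, of i] X0
      unfolding v_def[symmetric] Z_def[symmetric] Lr s1 X_def[symmetric] by simp
    have Z0: "0 \<le> Z" unfolding Z_def by (intro sum_nonneg Lnorm_nonneg)
    \<comment> \<open>\<open>X\<close> is the true integral because \<open>v\<close> is continuous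
      with compact support, so the power of \<open>X\<close> on the right can be divided
      out.\<close>
    have "X powr (1 / q) \<le> K * Z"
    proof (cases "X = 0")
      case False
      then have Xp: "0 < X" using X0 by simp
      have "1 / q = 1 - 1 / r" using q1 by (simp add: r_def field_simps)
      then have "X powr (1 / q) = X / X powr (1 / r)" using Xp by (simp add: powr_diff)
      also have "\<dots> \<le> K * Z" using \<open>X \<le> K * Z * X powr (1 / r)\<close> Xp by (simp add: divide_le_eq)
      finally show ?thesis .
    qed (use K Z0 in simp)
    moreover have "Z \<le> 4 * (1 + ?n * K') * ((\<Sum>k\<in>UNIV. Lnorm q (F k)) + Lnorm p g)"
    proof -
      have "Z \<le> (\<Sum>j\<in>UNIV. 4 * (Lnorm q (F j) + K' * Lnorm p g))"
        unfolding Z_def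
      proof (rule sum_mono)
        fix j
        have Fcc: "ccont (F j)" by (rule Cc_ccont[OF F])
        have "Lnorm q (\<lambda>x. F j x + ray_potential j g x) \<le> 4 * (Lnorm q (F j) + Lnorm q (ray_potential j g))"
          using q1 ccont_powr_integrable[OF Fcc, of q]
          by (intro Lnorm_add(2) pot(1) gcc ccont_measurable[OF Fcc] ray_potential_measurable ccont_measurable[OF gcc]) auto
        then show "Lnorm q (\<lambda>x. F j x + ray_potential j g x) \<le> 4 * (Lnorm q (F j) + K' * Lnorm p g)"
          using pot(2)[OF gcc, of j] by simp
      qed
      also have "\<dots> = 4 * ((\<Sum>j\<in>UNIV. Lnorm q (F j)) + ?n * K' * Lnorm p g)"
        by (simp add: sum.distrib sum_distrib_left[symmetric])
      also have "\<dots> \<le> 4 * ((1 + ?n * K') * (\<Sum>j\<in>UNIV. Lnorm q (F j)) + (1 + ?n * K') * Lnorm p g)"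
      proof -
        have "0 \<le> ?n * K' * (\<Sum>j\<in>UNIV. Lnorm q (F j))"
          using K' by (intro mult_nonneg_nonneg sum_nonneg Lnorm_nonneg) auto
        moreover have "0 \<le> Lnorm p g" by (rule Lnorm_nonneg)
        ultimately show ?thesis by (simp add: distrib_right)
      qed
      finally show ?thesis by (simp add: algebra_simps)
    qed
    then have "K * Z \<le> K * (4 * (1 + ?n * K') * ((\<Sum>k\<in>UNIV. Lnorm q (F k)) + Lnorm p g))"
      using K by (intro mult_left_mono) auto
    ultimately have "X powr (1 / q) \<le> K * (4 * (1 + ?n * K') * ((\<Sum>k\<in>UNIV. Lnorm q (F k)) + Lnorm p g))"
      by linarith
    moreover have "X powr (1 / q) = Lnorm q (partial_deriv i u)" by (simp add: Lnorm_def X_def v_def)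
    ultimately show ?thesis by (simp only: ac_simps)
  qed
  moreover have "0 < 4 * K * (1 + ?n * K')" using K K' by (simp add: add_pos_pos)
  ultimately show ?thesis by (intro exI[of _ "4 * K * (1 + ?n * K')"]) auto
qed

lemma Lnorm_cmult:
  fixes f :: "real^'n::finite \<Rightarrow> real"
  assumes "1 \<le> q"
  shows "Lnorm q (\<lambda>x. c * f x) = \<bar>c\<bar> * Lnorm q f"
proof -
  have "\<bar>c * f x\<bar> powr q = \<bar>c\<bar> powr q * \<bar>f x\<bar> powr q" for x by (simp add: abs_mult powr_mult)
  then show ?thesis using assms
    by (simp add: Lnorm_def powr_mult powr_powr Bochner_Integration.integral_nonneg)
qed

section \<open>The theorem\<close>

lemma ccont_norm: "ccont f \<Longrightarrow> ccont (\<lambda>x. norm (f x))"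
  by (rule ccont_compose) (auto intro!: continuous_intros)

text \<open>Two copies of \<open>a\<close>, indexed by \<open>bool\<close>, give an instance of
  \<open>Lnorm_le_sum\<close>: \<open>2\<^sup>2\<close> from the index set times two equal norms is
  8.\<close>

lemma Lnorm_le_double:
  fixes F :: "real^'n::finite \<Rightarrow> 'b::real_normed_vector" and a :: "real^'n \<Rightarrow> real"
  assumes q: "1 \<le> q" and a: "ccont a" and le: "\<And>x. norm (F x) \<le> 2 * \<bar>a x\<bar>"
  shows "Lnorm q F \<le> 8 * Lnorm q a"
proof -
  have "integrable lborel (\<lambda>x. \<bar>a x\<bar> powr q)" using ccont_powr_integrable[OF a, of q] q by simp
  then show ?thesis
    using Lnorm_le_sum[of q "UNIV :: bool set" "\<lambda>_. a" F] q le by simp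
qed

lemma norm_vec_le_sum:
  fixes x :: "'b::real_normed_vector^'n::finite"
  shows "norm x \<le> (\<Sum>k\<in>UNIV. norm (x $ k))"
  unfolding norm_vec_def by (rule L2_set_le_sum) auto

lemma norm_vec_nth_le: "norm (x $ k) \<le> norm (x :: 'b::real_normed_vector^'n::finite)"
  unfolding norm_vec_def by (rule member_le_L2_set) auto

lemma ccont_full_deriv:
  fixes P :: "real^'n::finite \<Rightarrow> 'b::real_normed_vector"
  assumes "P \<in> Cc_infinity"
  shows "ccont (full_deriv P)"
proof -
  note cc = Cc_ccont[OF Cc_partial_deriv[OF assms]]
  have "\<exists>R. \<forall>x. R < norm x \<longrightarrow> partial_deriv k P x = 0" for k
    using cc[of k] unfolding ccont_def by blast
  then obtain R where R: "\<And>k x. R k < norm x \<Longrightarrow> partial_deriv k P x = 0" by metis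
  have "full_deriv P x = 0" if x: "Max (range R) < norm x" for x
  proof -
    have "R k < norm x" for k using x Max_ge[of "range R" "R k"] by simp
    then show ?thesis by (simp add: full_deriv_def R vec_eq_iff)
  qed
  moreover have "continuous_on UNIV (full_deriv P)"
    unfolding full_deriv_def[abs_def] using cc by (intro continuous_on_vec_lambda) (simp add: ccont_def)
  ultimately show ?thesis unfolding ccont_def by blast
qed

theorem mainTheorem6:
  fixes p :: real
  assumes "1 < p" and "p < 3"
  shows "\<exists>c>0. \<forall>P \<in> (Cc_infinity :: (real^3 \<Rightarrow> real^3^3) set).
    W1_seminorm (3 * p / (3 - p)) P
      \<le> c * (W1_seminorm (3 * p / (3 - p)) (\<lambda>x. dev (P x)) + Lnorm p (\<lambda>x. trace (inc P x)))"
proof -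
  define q where "q = 3 * p / (3 - p)"
  have q: "1 / q = 1 / p - 1 / real CARD(3)" using assms by (simp add: q_def field_simps)
  have "3 - p < 3 * p" using assms by simp
  then have q1: "1 \<le> q" using assms by (simp add: q_def field_simps)
  obtain K where K: "0 < K" and est: "\<And>i (u :: real^3 \<Rightarrow> real) F g.
    u \<in> Cc_infinity \<Longrightarrow> (\<And>k. F k \<in> Cc_infinity) \<Longrightarrow> g \<in> Cc_infinity \<Longrightarrow>
    (\<And>x. (\<Sum>k\<in>UNIV. partial_deriv k (partial_deriv k u) x) = (\<Sum>k\<in>UNIV. partial_deriv k (F k) x) + g x) \<Longrightarrow>
    Lnorm q (partial_deriv i u) \<le> K * ((\<Sum>k\<in>UNIV. Lnorm q (F k)) + Lnorm p g)"
    using gradient_estimate[of p q, where 'n = 3] assms q by auto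
  define I where "I = norm (mat 1 :: real^3^3)"
  \<comment> \<open>16 is the square of the number of functions in the final
    \<open>Lnorm_le_sum\<close>, the deviatoric part and three derivatives of \<open>t\<close>; 24
    stands for three components of \<open>F\<close>, each with the factor 8.\<close>
  define c where "c = 16 * (1 + 3 * I * (K * 24))"
  have I: "0 \<le> I" by (simp add: I_def)
  have "W1_seminorm q P \<le> c * (W1_seminorm q (\<lambda>x. dev (P x)) + Lnorm p (\<lambda>x. trace (inc P x)))"
    if P: "P \<in> Cc_infinity" for P :: "real^3 \<Rightarrow> real^3^3"
  proof -
    define t where "t x = trace (P x) / 3" for x
    define D where "D x = dev (P x)" for x
    define F where "F a x = (\<Sum>b\<in>UNIV. (1/2) *\<^sub>R partial_deriv b (\<lambda>y. D y $ b $ a) x)" for a x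
    define g where "g x = (1/2) *\<^sub>R trace (inc P x)" for x
    note PE = Cc_entry[OF P]
    have tC: "t \<in> Cc_infinity"
      unfolding t_def[abs_def] trace_def using Cc_scale[OF Cc_sum[of UNIV "\<lambda>i x. P x $ i $ i", OF PE], of "1/3"] by simp
    have tI: "(\<lambda>x. t x *\<^sub>R (mat 1 :: real^3^3)) \<in> Cc_infinity"
      by (rule Cc_bounded_linear[OF bounded_linear_scaleR_left tC])
    have D_eq: "D = (\<lambda>x. P x - t x *\<^sub>R mat 1)" by (simp add: D_def dev_def t_def fun_eq_iff)
    have DC: "D \<in> Cc_infinity" unfolding D_eq by (rule Cc_diff[OF P tI])
    note DE = Cc_entry[OF DC]
    have FC: "F a \<in> Cc_infinity" for a
      unfolding F_def[abs_def] by (intro Cc_sum Cc_scale Cc_partial_deriv DE)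
    have trinc: "(\<lambda>x. trace (inc P x)) \<in> Cc_infinity"
      unfolding trace_inc[OF P] by (intro Cc_sum Cc_diff Cc_partial_deriv PE)
    have gC: "g \<in> Cc_infinity" unfolding g_def[abs_def] by (rule Cc_scale[OF trinc])
    have entry: "P y $ b $ a = D y $ b $ a + (if a = b then t y else 0)" for y a b
      by (auto simp: D_eq mat_def)
    have dd: "partial_deriv a (partial_deriv b (\<lambda>y. P y $ b $ a)) x
        = partial_deriv a (partial_deriv b (\<lambda>y. D y $ b $ a)) x + (if a = b then partial_deriv a (partial_deriv a t) x else 0)" for a b x
    proof (cases "a = b")
      case True
      have "partial_deriv b (\<lambda>y. P y $ b $ b) = (\<lambda>y. partial_deriv b (\<lambda>y. D y $ b $ b) y + partial_deriv b t y)"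
        by (rule ext) (simp add: entry[of _ b b] partial_deriv_add Cc_differentiable DE tC)
      then show ?thesis using True by (simp add: partial_deriv_add Cc_differentiable Cc_partial_deriv DE tC)
    qed (simp add: entry)
    \<comment> \<open>The Laplacian of the trace contributes \<open>3 \<Delta>t\<close> to
      \<open>trace (inc P x)\<close>, and the multiple of the unit matrix in the double divergence
      takes one \<open>\<Delta>t\<close> away. The remaining \<open>2 \<Delta>t\<close> explains the
      halves in \<open>F\<close> and \<open>g\<close>.\<close>
    have lap: "(\<Sum>k\<in>UNIV. partial_deriv k (partial_deriv k t) x) = (\<Sum>k\<in>UNIV. partial_deriv k (F k) x) + g x" for x
    proof -
      have tr: "(\<Sum>b\<in>UNIV. partial_deriv a (partial_deriv a (\<lambda>y. P y $ b $ b)) x) = 3 * partial_deriv a (partial_deriv a t) x" for a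
      proof -
        have "(\<Sum>b\<in>UNIV. partial_deriv a (partial_deriv a (\<lambda>y. P y $ b $ b)) x)
            = partial_deriv a (\<lambda>y. \<Sum>b\<in>UNIV. partial_deriv a (\<lambda>y. P y $ b $ b) y) x"
          by (simp add: partial_deriv_sum Cc_partial_deriv PE)
        also have "(\<lambda>y. \<Sum>b\<in>UNIV. partial_deriv a (\<lambda>y. P y $ b $ b) y) = partial_deriv a (\<lambda>y. \<Sum>b\<in>UNIV. P y $ b $ b)"
          by (rule ext) (simp add: partial_deriv_sum PE)
        also have "(\<lambda>y. \<Sum>b\<in>UNIV. P y $ b $ b) = (\<lambda>y. 3 * t y)" by (simp add: t_def trace_def)
        also have "partial_deriv a (\<lambda>y. 3 * t y) = (\<lambda>y. 3 * partial_deriv a t y)"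
          by (rule ext) (rule partial_deriv_bounded_linear[OF bounded_linear_mult_right Cc_differentiable[OF tC]])
        also have "partial_deriv a (\<lambda>y. 3 * partial_deriv a t y) x = 3 * partial_deriv a (partial_deriv a t) x"
          by (rule partial_deriv_bounded_linear[OF bounded_linear_mult_right Cc_differentiable[OF Cc_partial_deriv[OF tC]]])
        finally show ?thesis .
      qed
      have "partial_deriv k (F k) x = (\<Sum>b\<in>UNIV. (1/2) * partial_deriv k (partial_deriv b (\<lambda>y. D y $ b $ k)) x)" for k
      proof -
        have "partial_deriv k (F k) x = (\<Sum>b\<in>UNIV. partial_deriv k (\<lambda>x. (1/2) *\<^sub>R partial_deriv b (\<lambda>y. D y $ b $ k) x) x)"
          unfolding F_def[abs_def] by (rule partial_deriv_sum) (intro Cc_scale Cc_partial_deriv DE)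
        moreover have "partial_deriv k (\<lambda>x. (1/2) *\<^sub>R partial_deriv b (\<lambda>y. D y $ b $ k) x) x
            = (1/2) *\<^sub>R partial_deriv k (partial_deriv b (\<lambda>y. D y $ b $ k)) x" for b
          by (rule partial_deriv_bounded_linear[OF bounded_linear_scaleR_right Cc_differentiable[OF Cc_partial_deriv[OF DE]]])
        ultimately show ?thesis by (simp only: real_scaleR_def)
      qed
      then have "2 * partial_deriv k (F k) x = (\<Sum>b\<in>UNIV. partial_deriv k (partial_deriv b (\<lambda>y. D y $ b $ k)) x)" for k
        by (simp add: sum_divide_distrib[symmetric] mult.commute[of 2])
      then have "2 * ((\<Sum>k\<in>UNIV. partial_deriv k (F k) x) + g x)
          = (\<Sum>a\<in>UNIV. \<Sum>b\<in>UNIV. partial_deriv a (partial_deriv b (\<lambda>y. D y $ b $ a)) x) + trace (inc P x)"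
        by (simp add: g_def distrib_left sum_distrib_left)
      also have "trace (inc P x) = 3 * (\<Sum>a\<in>UNIV. partial_deriv a (partial_deriv a t) x)
          - (\<Sum>a\<in>UNIV. \<Sum>b\<in>UNIV. partial_deriv a (partial_deriv b (\<lambda>y. P y $ b $ a)) x)"
        unfolding trace_inc[OF P] by (simp add: sum_subtractf tr sum_distrib_left)
      also have "(\<Sum>a\<in>UNIV. \<Sum>b\<in>UNIV. partial_deriv a (partial_deriv b (\<lambda>y. P y $ b $ a)) x)
          = (\<Sum>a\<in>UNIV. \<Sum>b\<in>UNIV. partial_deriv a (partial_deriv b (\<lambda>y. D y $ b $ a)) x) + (\<Sum>a\<in>UNIV. partial_deriv a (partial_deriv a t) x)"
        unfolding dd by (simp add: sum.distrib)
      finally show ?thesis by simp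
    qed
    define A where "A = W1_seminorm q D"
    define B where "B = Lnorm p (\<lambda>x. trace (inc P x))"
    have AB: "0 \<le> A" "0 \<le> B" unfolding A_def B_def W1_seminorm_def by (rule Lnorm_nonneg)+
    define nd where "nd x = norm (full_deriv D x)" for x
    have ndcc: "ccont nd" unfolding nd_def[abs_def] by (rule ccont_norm[OF ccont_full_deriv[OF DC]])
    have ndA: "Lnorm q nd = A" by (simp add: A_def W1_seminorm_def Lnorm_def nd_def)
    have FA: "Lnorm q (F a) \<le> 8 * A" for a
      unfolding ndA[symmetric]
    proof (rule Lnorm_le_double[OF q1 ndcc])
      fix x
      have "\<bar>partial_deriv b (\<lambda>y. D y $ b $ a) x\<bar> \<le> nd x" for b
      proof -
        have "partial_deriv b (\<lambda>y. D y $ b $ a) x = full_deriv D x $ b $ b $ a"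
          unfolding full_deriv_def vec_lambda_beta
          by (rule partial_deriv_bounded_linear[OF bounded_linear_compose[OF bounded_linear_vec_nth bounded_linear_vec_nth] Cc_differentiable[OF DC]])
        also have "\<bar>\<dots>\<bar> \<le> norm (full_deriv D x $ b $ b)" using norm_vec_nth_le[of "full_deriv D x $ b $ b" a] by simp
        also have "\<dots> \<le> norm (full_deriv D x $ b)" by (rule norm_vec_nth_le)
        also have "\<dots> \<le> nd x" unfolding nd_def by (rule norm_vec_nth_le)
        finally show ?thesis .
      qed
      \<comment> \<open>\<open>F a x\<close> is half a sum of three terms of size at most
        \<open>nd x\<close>, and \<open>3 / 2 \<le> 2\<close>.\<close>
      from this[of 1] this[of 2] this[of 3]
      show "norm (F a x) \<le> 2 * \<bar>nd x\<bar>"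
        unfolding F_def sum_3 real_norm_def real_scaleR_def by linarith
    qed
    have gB: "Lnorm p g \<le> B"
    proof -
      have "Lnorm p g = \<bar>1/2\<bar> * B" unfolding B_def g_def[abs_def] real_scaleR_def using assms by (intro Lnorm_cmult) simp
      then show ?thesis using AB by simp
    qed
    have tE: "Lnorm q (partial_deriv i t) \<le> K * 24 * (A + B)" for i
    proof -
      have "Lnorm q (partial_deriv i t) \<le> K * ((\<Sum>k\<in>UNIV. Lnorm q (F k)) + Lnorm p g)"
        by (rule est[OF tC FC gC lap])
      also have "\<dots> \<le> K * (24 * (A + B))"
        using FA[of 1] FA[of 2] FA[of 3] gB AB K by (intro mult_left_mono) (auto simp: sum_3)
      finally show ?thesis by (simp only: mult.assoc)
    qed
    \<comment> \<open>\<open>None\<close> stands for the deviatoric part and \<open>Some k\<close>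
      for the \<open>k\<close>-th derivative of \<open>t\<close>, scaled by the norm of the unit
      matrix.\<close>
    define a where "a k = (case k of None \<Rightarrow> nd | Some k \<Rightarrow> (\<lambda>x. I * partial_deriv k t x))" for k :: "3 option"
    have acc: "ccont (a k)" for k
      by (cases k) (simp_all add: a_def ndcc ccont_cmult Cc_ccont Cc_partial_deriv tC)
    have U: "(UNIV :: 3 option set) = insert None (Some ` UNIV)" by (auto simp: UNIV_option_conv)
    have sumU: "(\<Sum>k\<in>UNIV. f k) = f None + (\<Sum>k\<in>UNIV. f (Some k))" for f :: "3 option \<Rightarrow> real"
      unfolding U by (subst sum.insert) (auto simp: sum.reindex)
    have "W1_seminorm q P \<le> (real (card (UNIV :: 3 option set)))\<^sup>2 * (\<Sum>k\<in>UNIV. Lnorm q (a k))"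
      unfolding W1_seminorm_def
    proof (rule Lnorm_le_sum[OF q1])
      show "integrable lborel (\<lambda>x. \<bar>a k x\<bar> powr q)" for k
        using ccont_powr_integrable[OF acc[of k], of q] q1 by simp
      fix x
      have pP: "partial_deriv k P x = partial_deriv k D x + partial_deriv k t x *\<^sub>R mat 1" for k
      proof -
        have "P = (\<lambda>x. D x + t x *\<^sub>R mat 1)" by (simp add: D_eq)
        then have "partial_deriv k P x = partial_deriv k D x + partial_deriv k (\<lambda>x. t x *\<^sub>R (mat 1 :: real^3^3)) x"
          using partial_deriv_add[OF Cc_differentiable[OF DC] Cc_differentiable[OF tI], of k x] by simp
        then show ?thesis
          by (simp add: partial_deriv_bounded_linear[OF bounded_linear_scaleR_left Cc_differentiable[OF tC]])
      qed
      have "full_deriv P x = full_deriv D x + (\<chi> k. partial_deriv k t x *\<^sub>R mat 1)"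
        by (simp add: full_deriv_def vec_eq_iff pP)
      then have "norm (full_deriv P x) \<le> nd x + norm (\<chi> k. partial_deriv k t x *\<^sub>R (mat 1 :: real^3^3))"
        unfolding nd_def by (simp add: norm_triangle_ineq)
      also have "\<dots> \<le> nd x + (\<Sum>k\<in>UNIV. \<bar>I * partial_deriv k t x\<bar>)"
        using norm_vec_le_sum[of "\<chi> k. partial_deriv k t x *\<^sub>R (mat 1 :: real^3^3)"] I
        by (simp add: I_def abs_mult mult.commute)
      also have "\<dots> = (\<Sum>k\<in>UNIV. \<bar>a k x\<bar>)"
        unfolding sumU by (simp add: a_def nd_def)
      finally show "norm (full_deriv P x) \<le> (\<Sum>k\<in>UNIV. \<bar>a k x\<bar>)" .
    qed simp
    also have "real (card (UNIV :: 3 option set)) = 4" by (simp add: card_UNIV_option)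
    also have "(\<Sum>k\<in>UNIV. Lnorm q (a k)) = A + (\<Sum>k\<in>UNIV. I * Lnorm q (partial_deriv k t))"
      unfolding sumU using I by (simp add: a_def ndA Lnorm_cmult[OF q1])
    also have "4\<^sup>2 * (A + (\<Sum>k\<in>UNIV. I * Lnorm q (partial_deriv k t))) \<le> 4\<^sup>2 * ((A + B) + (\<Sum>k\<in>(UNIV :: 3 set). I * (K * 24 * (A + B))))"
      using AB I by (intro mult_left_mono add_mono sum_mono tE) auto
    also have "\<dots> = c * (A + B)" by (simp add: c_def algebra_simps)
    finally show ?thesis by (simp add: A_def B_def D_def[abs_def])
  qed
  moreover have "0 < c" using I K by (simp add: c_def add_pos_nonneg)
  ultimately show ?thesis unfolding q_def by blast
qed

end
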